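(* Let $(M,\omega)$ be a compact connected symplectic manifold such that the cohomology class of $(2\pi\hbar)^{-1}\omega$ lies in the image of $H^2(M,\mathbb{Z})$ in $H^2(M,\mathbb{R})$. Let $(L,H)$ be a Hermitian line bundle on $M$ with a Hermitian connection $\nabla$ whose curvature is $\hbar^{-1}\omega$. Then the Hermitian connection $$\widetilde\nabla:=\mathrm{ev}_0^*\nabla-\sqrt{-1}\,\hbar^{-1}\lambda$$ on the Hermitian line bundle $(\mathrm{ev}_0^*L,\mathrm{ev}_0^*H)$ over the path space $\mathcal{P}M$ has curvature $\hbar^{-1}\widetilde\omega$, where $\lambda$ is the $1$-form $$\bigl(\lambda(v)\bigr)(\gamma)=\int_0^1\left(\int_0^t\omega\bigl(\dot\gamma(\tau),d\,\mathrm{ev}_\tau(v(\gamma))\bigr)\,d\tau\right)dt$$ and $\widetilde\omega$ is the $2$-form $$\bigl(\widetilde\omega(v_1,v_2)\bigr)(\gamma)=\int_0^1\omega\bigl(d\,\mathrm{ev}_t(v_1(\gamma)),d\,\mathrm{ev}_t(v_2(\gamma))\bigr)\,dt$$ on $\mathcal{P}M$.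
   Context: $\hbar>0$ is a constant. $\mathcal{P}M$ is the space of all smooth maps $\gamma:[0,1]\to M$, with its standard (Chen) differentiable structure; the tangent space at $\gamma$ is the space of smooth vector fields along $\gamma$. $\mathrm{ev}_t:\mathcal{P}M\to M$ is $\mathrm{ev}_t(\gamma)=\gamma(t)$, so $d\,\mathrm{ev}_t(v(\gamma))=(v(\gamma))(t)$. Curvature convention: a connection locally of the form $d-\sqrt{-1}\,\hbar^{-1}\theta$ (with $\theta$ a real $1$-form) has curvature $\hbar^{-1}d\theta$; in particular $\nabla$ is locally $d-\sqrt{-1}\,\hbar^{-1}\theta$ with $\omega=d\theta$. *)

theory Defs
  imports "HOL-Analysis.Analysis" "HOL-Homology.Homology"
begin

section \<open>Smooth functions on convex regions\<close>

text \<open>Chen's model domains: convex subsets, not necessarily open or closed, of a Euclidean space,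
  with nonempty interior.\<close>

definition region :: "'a::euclidean_space set \<Rightarrow> bool" where
  "region S \<longleftrightarrow> convex S \<and> interior S \<noteq> {}"

text \<open>These are only used for relatively open subsets \<open>S\<close> of regions; there the derivative within
  \<open>S\<close> is unique, one-sided at boundary points.\<close>

primrec Ck_on :: "nat \<Rightarrow> 'a::euclidean_space set \<Rightarrow> ('a \<Rightarrow> 'b::real_normed_vector) \<Rightarrow> bool" where
  "Ck_on 0 S f \<longleftrightarrow> continuous_on S f"
| "Ck_on (Suc k) S f \<longleftrightarrow>
     f differentiable_on S \<and> (\<forall>a. Ck_on k S (\<lambda>x. frechet_derivative f (at x within S) a))"

definition smooth_on :: "'a::euclidean_space set \<Rightarrow> ('a \<Rightarrow> 'b::real_normed_vector) \<Rightarrow> bool" where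
  "smooth_on S f \<longleftrightarrow> (\<forall>k. Ck_on k S f)"


section \<open>Smooth spaces\<close>

text \<open>A chart is a pair of its domain and its coordinate map. The only two kinds of smooth spaces
  used are manifolds (\<open>smooth_manifold\<close>) and regions of a Euclidean space with the identity as their
  single chart (\<open>std\<close>).\<close>

type_synonym ('m, 'e) chart = "'m set \<times> ('m \<Rightarrow> 'e)"

record ('m, 'e) smooth_space =
  mtop :: "'m topology"
  atlas :: "('m, 'e) chart set"

definition chart_at :: "('m, 'e::euclidean_space) smooth_space \<Rightarrow> 'm \<Rightarrow> ('m, 'e) chart \<Rightarrow> bool" where
  "chart_at X x c \<longleftrightarrow> c \<in> atlas X \<and> x \<in> fst c"

definition cimg :: "('m, 'e) chart \<Rightarrow> 'e set" where
  "cimg c = snd c ` fst c"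

definition cinv :: "('m, 'e) chart \<Rightarrow> 'e \<Rightarrow> 'm" where
  "cinv c = inv_into (fst c) (snd c)"

definition std :: "'u::euclidean_space set \<Rightarrow> ('u, 'u) smooth_space" where
  "std U = \<lparr>mtop = top_of_set U, atlas = {(U, \<lambda>x. x)}\<rparr>"

definition smooth_manifold :: "('m, 'e::euclidean_space) smooth_space \<Rightarrow> bool" where
  "smooth_manifold M \<longleftrightarrow>
     Hausdorff_space (mtop M) \<and> second_countable (mtop M) \<and>
     (\<forall>c\<in>atlas M. openin (mtop M) (fst c) \<and> open (cimg c) \<and>
        homeomorphic_map (subtopology (mtop M) (fst c)) (top_of_set (cimg c)) (snd c)) \<and>
     (\<Union>c\<in>atlas M. fst c) = topspace (mtop M) \<and>
     (\<forall>c\<in>atlas M. \<forall>d\<in>atlas M. smooth_on (snd c ` (fst c \<inter> fst d)) (snd d \<circ> cinv c))"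

definition smooth_fun ::
  "('m, 'e::euclidean_space) smooth_space \<Rightarrow> 'm set \<Rightarrow> ('m \<Rightarrow> 'b::real_normed_vector) \<Rightarrow> bool" where
  "smooth_fun X W f \<longleftrightarrow> (\<forall>c\<in>atlas X. smooth_on (snd c ` (fst c \<inter> W)) (f \<circ> cinv c))"

definition smooth_map ::
  "('m, 'e::euclidean_space) smooth_space \<Rightarrow> ('n, 'd::euclidean_space) smooth_space \<Rightarrow>
   ('m \<Rightarrow> 'n) \<Rightarrow> bool" where
  "smooth_map X Y f \<longleftrightarrow> continuous_map (mtop X) (mtop Y) f \<and>
     (\<forall>c\<in>atlas X. \<forall>d\<in>atlas Y.
        smooth_on (snd c ` {x \<in> fst c. f x \<in> fst d}) (snd d \<circ> f \<circ> cinv c))"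

text \<open>A tangent vector at \<open>x\<close> is the family of its coordinate representations in all charts around
  \<open>x\<close>, which transform by the derivatives of the coordinate changes.\<close>

type_synonym ('m, 'e) tvec = "('m, 'e) chart \<Rightarrow> 'e"

definition tangent :: "('m, 'e::euclidean_space) smooth_space \<Rightarrow> 'm \<Rightarrow> ('m, 'e) tvec set" where
  "tangent X x = {v. (\<forall>c. \<not> chart_at X x c \<longrightarrow> v c = 0) \<and>
     (\<forall>c d. chart_at X x c \<and> chart_at X x d \<longrightarrow>
        v d = frechet_derivative (snd d \<circ> cinv c) (at (snd c x) within cimg c) (v c))}"

definition tcomb :: "real \<Rightarrow> ('c \<Rightarrow> 'e::real_vector) \<Rightarrow> real \<Rightarrow> ('c \<Rightarrow> 'e) \<Rightarrow> 'c \<Rightarrow> 'e" where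
  "tcomb a v b w = (\<lambda>c. a *\<^sub>R v c + b *\<^sub>R w c)"

text \<open>The tangent vector at \<open>x\<close> with components \<open>a\<close> in the chart \<open>c\<close>.\<close>

definition coord_vec ::
  "('m, 'e::euclidean_space) smooth_space \<Rightarrow> ('m, 'e) chart \<Rightarrow> 'm \<Rightarrow> 'e \<Rightarrow> ('m, 'e) tvec" where
  "coord_vec X c x a = (\<lambda>d. if chart_at X x d
     then frechet_derivative (snd d \<circ> cinv c) (at (snd c x) within cimg c) a else 0)"

abbreviation std_vec :: "'u::euclidean_space set \<Rightarrow> 'u \<Rightarrow> 'u \<Rightarrow> ('u, 'u) tvec" where
  "std_vec U \<equiv> coord_vec (std U) (U, \<lambda>x. x)"

text \<open>Differentials of maps and of functions; by the chain rule the values do not depend on the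
  chart selected.\<close>

definition tmap ::
  "('m, 'e::euclidean_space) smooth_space \<Rightarrow> ('n, 'd::euclidean_space) smooth_space \<Rightarrow>
   ('m \<Rightarrow> 'n) \<Rightarrow> 'm \<Rightarrow> ('m, 'e) tvec \<Rightarrow> ('n, 'd) tvec" where
  "tmap X Y f x v = (let c = (SOME c. chart_at X x c) in
     (\<lambda>d. if chart_at Y (f x) d
        then frechet_derivative (snd d \<circ> f \<circ> cinv c) (at (snd c x) within cimg c) (v c) else 0))"

definition ddir ::
  "('m, 'e::euclidean_space) smooth_space \<Rightarrow> ('m \<Rightarrow> 'b::real_normed_vector) \<Rightarrow>
   'm \<Rightarrow> ('m, 'e) tvec \<Rightarrow> 'b" where
  "ddir X f x v = (let c = (SOME c. chart_at X x c) in
     frechet_derivative (f \<circ> cinv c) (at (snd c x) within cimg c) (v c))"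


section \<open>Differential forms\<close>

type_synonym ('m, 'e) form1 = "'m \<Rightarrow> ('m, 'e) tvec \<Rightarrow> real"
type_synonym ('m, 'e) form2 = "'m \<Rightarrow> ('m, 'e) tvec \<Rightarrow> ('m, 'e) tvec \<Rightarrow> real"

definition linear_on_set :: "('c \<Rightarrow> 'e::real_vector) set \<Rightarrow> (('c \<Rightarrow> 'e) \<Rightarrow> real) \<Rightarrow> bool" where
  "linear_on_set T f \<longleftrightarrow> (\<forall>v\<in>T. \<forall>w\<in>T. \<forall>a b. f (tcomb a v b w) = a * f v + b * f w)"

definition alternating_on_set ::
  "('c \<Rightarrow> 'e::real_vector) set \<Rightarrow> (('c \<Rightarrow> 'e) \<Rightarrow> ('c \<Rightarrow> 'e) \<Rightarrow> real) \<Rightarrow> bool" where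
  "alternating_on_set T f \<longleftrightarrow>
     (\<forall>u\<in>T. linear_on_set T (f u) \<and> linear_on_set T (\<lambda>v. f v u) \<and> f u u = 0)"

definition coef1 ::
  "('m, 'e::euclidean_space) smooth_space \<Rightarrow> ('m, 'e) chart \<Rightarrow> ('m, 'e) form1 \<Rightarrow> 'e \<Rightarrow> 'e \<Rightarrow> real" where
  "coef1 X c A a = (\<lambda>y. A (cinv c y) (coord_vec X c (cinv c y) a))"

definition coef2 ::
  "('m, 'e::euclidean_space) smooth_space \<Rightarrow> ('m, 'e) chart \<Rightarrow> ('m, 'e) form2 \<Rightarrow>
   'e \<Rightarrow> 'e \<Rightarrow> 'e \<Rightarrow> real" where
  "coef2 X c K a b = (\<lambda>y. K (cinv c y) (coord_vec X c (cinv c y) a) (coord_vec X c (cinv c y) b))"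

definition one_form :: "('m, 'e::euclidean_space) smooth_space \<Rightarrow> ('m, 'e) form1 \<Rightarrow> bool" where
  "one_form X A \<longleftrightarrow> (\<forall>x\<in>topspace (mtop X). linear_on_set (tangent X x) (A x)) \<and>
     (\<forall>c\<in>atlas X. \<forall>a. smooth_on (cimg c) (coef1 X c A a))"

definition two_form :: "('m, 'e::euclidean_space) smooth_space \<Rightarrow> ('m, 'e) form2 \<Rightarrow> bool" where
  "two_form X K \<longleftrightarrow> (\<forall>x\<in>topspace (mtop X). alternating_on_set (tangent X x) (K x)) \<and>
     (\<forall>c\<in>atlas X. \<forall>a b. smooth_on (cimg c) (coef2 X c K a b))"

text \<open>The exterior derivatives, computed in a chart \<open>c\<close> around \<open>x\<close>, with
  \<open>dA(u, v) = u(A(v)) - v(A(u))\<close> for coordinate fields \<open>u\<close>, \<open>v\<close> (no factor 1/2).\<close>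

definition ext_d1 ::
  "('m, 'e::euclidean_space) smooth_space \<Rightarrow> ('m, 'e) chart \<Rightarrow> ('m, 'e) form1 \<Rightarrow> ('m, 'e) form2" where
  "ext_d1 X c A x u v =
     frechet_derivative (coef1 X c A (v c)) (at (snd c x) within cimg c) (u c) -
     frechet_derivative (coef1 X c A (u c)) (at (snd c x) within cimg c) (v c)"

definition ext_d2 ::
  "('m, 'e::euclidean_space) smooth_space \<Rightarrow> ('m, 'e) chart \<Rightarrow> ('m, 'e) form2 \<Rightarrow>
   'm \<Rightarrow> ('m, 'e) tvec \<Rightarrow> ('m, 'e) tvec \<Rightarrow> ('m, 'e) tvec \<Rightarrow> real" where
  "ext_d2 X c K x u v w =
     frechet_derivative (coef2 X c K (v c) (w c)) (at (snd c x) within cimg c) (u c) -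
     frechet_derivative (coef2 X c K (u c) (w c)) (at (snd c x) within cimg c) (v c) +
     frechet_derivative (coef2 X c K (u c) (v c)) (at (snd c x) within cimg c) (w c)"

definition closed_form2 :: "('m, 'e::euclidean_space) smooth_space \<Rightarrow> ('m, 'e) form2 \<Rightarrow> bool" where
  "closed_form2 X K \<longleftrightarrow> (\<forall>x c. chart_at X x c \<longrightarrow>
     (\<forall>u\<in>tangent X x. \<forall>v\<in>tangent X x. \<forall>w\<in>tangent X x. ext_d2 X c K x u v w = 0))"

definition symplectic_form :: "('m, 'e::euclidean_space) smooth_space \<Rightarrow> ('m, 'e) form2 \<Rightarrow> bool" where
  "symplectic_form X \<omega> \<longleftrightarrow> two_form X \<omega> \<and> closed_form2 X \<omega> \<and>
     (\<forall>x\<in>topspace (mtop X). \<forall>u\<in>tangent X x.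
        (\<forall>v\<in>tangent X x. \<omega> x u v = 0) \<longrightarrow> u = (\<lambda>_. 0))"


section \<open>Integrality of the de Rham class of a 2-form\<close>

definition triangle :: "(real \<times> real) set" where
  "triangle = {(s, t). 0 \<le> s \<and> 0 \<le> t \<and> s + t \<le> 1}"

text \<open>A singular 2-simplex in the affine coordinates \<open>(s, t)\<close> of the standard simplex, whose
  vertices 0, 1, 2 are at \<open>(0, 0)\<close>, \<open>(1, 0)\<close>, \<open>(0, 1)\<close>.\<close>

definition simplex2_coords :: "((nat \<Rightarrow> real) \<Rightarrow> 'm) \<Rightarrow> real \<times> real \<Rightarrow> 'm" where
  "simplex2_coords \<sigma> = (\<lambda>(s, t).
     \<sigma> (\<lambda>i::nat. if i = 0 then 1 - s - t else if i = 1 then s else if i = 2 then t else 0))"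

definition smooth_simplex2 ::
  "('m, 'e::euclidean_space) smooth_space \<Rightarrow> ((nat \<Rightarrow> real) \<Rightarrow> 'm) \<Rightarrow> bool" where
  "smooth_simplex2 M \<sigma> \<longleftrightarrow> singular_simplex 2 (mtop M) \<sigma> \<and>
     smooth_map (std triangle) M (simplex2_coords \<sigma>)"

definition integral_simplex2 ::
  "('m, 'e::euclidean_space) smooth_space \<Rightarrow> ('m, 'e) form2 \<Rightarrow> ((nat \<Rightarrow> real) \<Rightarrow> 'm) \<Rightarrow> real" where
  "integral_simplex2 M K \<sigma> = (let f = simplex2_coords \<sigma> in
     integral triangle (\<lambda>p. K (f p)
       (tmap (std triangle) M f p (std_vec triangle p (1, 0)))
       (tmap (std triangle) M f p (std_vec triangle p (0, 1)))))"

definition cochain :: "nat \<Rightarrow> 'm topology \<Rightarrow> ('m chain \<Rightarrow> 'g::ab_group_add) \<Rightarrow> bool" where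
  "cochain p X f \<longleftrightarrow>
     (\<forall>a b. singular_chain p X a \<and> singular_chain p X b \<longrightarrow> f (a + b) = f a + f b)"

definition cocycle :: "nat \<Rightarrow> 'm topology \<Rightarrow> ('m chain \<Rightarrow> 'g::ab_group_add) \<Rightarrow> bool" where
  "cocycle p X f \<longleftrightarrow> cochain p X f \<and>
     (\<forall>a. singular_chain (Suc p) X a \<longrightarrow> f (chain_boundary (Suc p) a) = 0)"

text \<open>The de Rham class of \<open>K\<close> is the class of its integration cochain in smooth singular cohomology,
  which restriction identifies with singular cohomology. It lies in the image of integral cohomology
  iff that cochain and an integral singular cocycle \<open>z\<close> differ by the coboundary of a real cochain
  \<open>b\<close> on the smooth simplices.\<close>

definition integral_class :: "('m, 'e::euclidean_space) smooth_space \<Rightarrow> ('m, 'e) form2 \<Rightarrow> bool" where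
  "integral_class M K \<longleftrightarrow>
     (\<exists>(z :: 'm chain \<Rightarrow> int) (b :: 'm chain \<Rightarrow> real).
        cocycle 2 (mtop M) z \<and> cochain 1 (mtop M) b \<and>
        (\<forall>\<sigma>. smooth_simplex2 M \<sigma> \<longrightarrow>
           integral_simplex2 M K \<sigma> =
             of_int (z (frag_of \<sigma>)) + b (chain_boundary 2 (frag_of \<sigma>))))"


section \<open>Hermitian line bundles and connections\<close>

text \<open>A line bundle is the family of its fibres, together with local frames that trivialise it; the
  frames carry the smooth structure. The fibrewise operations take the base point as an argument, so
  the total space is the disjoint union of the fibres.\<close>

record ('b, 'l) line_bundle =
  fib :: "'b \<Rightarrow> 'l set"
  vadd :: "'b \<Rightarrow> 'l \<Rightarrow> 'l \<Rightarrow> 'l"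
  vscl :: "'b \<Rightarrow> complex \<Rightarrow> 'l \<Rightarrow> 'l"
  herm :: "'b \<Rightarrow> 'l \<Rightarrow> 'l \<Rightarrow> complex"
  frames :: "('b set \<times> ('b \<Rightarrow> 'l)) set"

text \<open>One-dimensional complex vector spaces: the operations are those of the complex numbers in terms
  of a basis vector \<open>e\<close>.\<close>

definition complex_line :: "'l set \<Rightarrow> ('l \<Rightarrow> 'l \<Rightarrow> 'l) \<Rightarrow> (complex \<Rightarrow> 'l \<Rightarrow> 'l) \<Rightarrow> bool" where
  "complex_line F pl sc \<longleftrightarrow> (\<exists>e\<in>F. bij_betw (\<lambda>z. sc z e) UNIV F \<and>
     (\<forall>z w. pl (sc z e) (sc w e) = sc (z + w) e \<and> sc z (sc w e) = sc (z * w) e))"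

definition hermitian_line ::
  "'l set \<Rightarrow> ('l \<Rightarrow> 'l \<Rightarrow> 'l) \<Rightarrow> (complex \<Rightarrow> 'l \<Rightarrow> 'l) \<Rightarrow> ('l \<Rightarrow> 'l \<Rightarrow> complex) \<Rightarrow> bool" where
  "hermitian_line F pl sc H \<longleftrightarrow> complex_line F pl sc \<and>
     (\<forall>a\<in>F. \<forall>b\<in>F. \<forall>c\<in>F. H (pl a b) c = H a c + H b c) \<and>
     (\<forall>a\<in>F. \<forall>b\<in>F. \<forall>z. H (sc z a) b = z * H a b) \<and>
     (\<forall>a\<in>F. \<forall>b\<in>F. H b a = cnj (H a b)) \<and>
     (\<forall>a\<in>F. a \<noteq> sc 0 a \<longrightarrow> Im (H a a) = 0 \<and> Re (H a a) > 0)"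

text \<open>The quotient \<open>a / e\<close> in the fibre over \<open>x\<close>.\<close>

definition ratio :: "('b, 'l) line_bundle \<Rightarrow> 'b \<Rightarrow> 'l \<Rightarrow> 'l \<Rightarrow> complex" where
  "ratio L x a e = (THE z. a = vscl L x z e)"

definition hermitian_line_bundle ::
  "('b, 'e::euclidean_space) smooth_space \<Rightarrow> ('b, 'l) line_bundle \<Rightarrow> bool" where
  "hermitian_line_bundle X L \<longleftrightarrow>
     (\<forall>x\<in>topspace (mtop X). hermitian_line (fib L x) (vadd L x) (vscl L x) (herm L x)) \<and>
     (\<forall>(W, e)\<in>frames L. openin (mtop X) W \<and>
        (\<forall>x\<in>W. e x \<in> fib L x \<and> e x \<noteq> vscl L x 0 (e x)) \<and>
        smooth_fun X W (\<lambda>x. herm L x (e x) (e x))) \<and>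
     (\<Union>(W, e)\<in>frames L. W) = topspace (mtop X) \<and>
     (\<forall>(W, e)\<in>frames L. \<forall>(W', e')\<in>frames L.
        smooth_fun X (W \<inter> W') (\<lambda>x. ratio L x (e' x) (e x)))"

definition smooth_section ::
  "('b, 'e::euclidean_space) smooth_space \<Rightarrow> ('b, 'l) line_bundle \<Rightarrow> 'b set \<Rightarrow> ('b \<Rightarrow> 'l) \<Rightarrow> bool" where
  "smooth_section X L W s \<longleftrightarrow> openin (mtop X) W \<and> (\<forall>x\<in>W. s x \<in> fib L x) \<and>
     (\<forall>(V, e)\<in>frames L. smooth_fun X (W \<inter> V) (\<lambda>x. ratio L x (s x) (e x)))"

text \<open>\<open>D s x v\<close> is the covariant derivative at \<open>x\<close> in direction \<open>v\<close> of a section \<open>s\<close> that is smooth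
  near \<open>x\<close>.\<close>

type_synonym ('b, 'e, 'l) conn = "('b \<Rightarrow> 'l) \<Rightarrow> 'b \<Rightarrow> ('b, 'e) tvec \<Rightarrow> 'l"

definition is_connection ::
  "('b, 'e::euclidean_space) smooth_space \<Rightarrow> ('b, 'l) line_bundle \<Rightarrow> ('b, 'e, 'l) conn \<Rightarrow> bool" where
  "is_connection X L D \<longleftrightarrow> (\<forall>W s. smooth_section X L W s \<longrightarrow>
     (\<forall>x\<in>W. \<forall>v\<in>tangent X x. D s x v \<in> fib L x) \<and>
     (\<forall>x\<in>W. \<forall>v\<in>tangent X x. \<forall>w\<in>tangent X x. \<forall>a b.
        D s x (tcomb a v b w) =
          vadd L x (vscl L x (of_real a) (D s x v)) (vscl L x (of_real b) (D s x w))) \<and>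
     (\<forall>c\<in>atlas X. \<forall>a. smooth_section X L (W \<inter> fst c) (\<lambda>x. D s x (coord_vec X c x a))) \<and>
     (\<forall>s'. smooth_section X L W s' \<longrightarrow>
        ((\<forall>x\<in>W. s x = s' x) \<longrightarrow> (\<forall>x\<in>W. \<forall>v\<in>tangent X x. D s x v = D s' x v)) \<and>
        (\<forall>x\<in>W. \<forall>v\<in>tangent X x.
           D (\<lambda>y. vadd L y (s y) (s' y)) x v = vadd L x (D s x v) (D s' x v))) \<and>
     (\<forall>f :: 'b \<Rightarrow> complex. smooth_fun X W f \<longrightarrow>
        (\<forall>x\<in>W. \<forall>v\<in>tangent X x.
           D (\<lambda>y. vscl L y (f y) (s y)) x v =
             vadd L x (vscl L x (ddir X f x v) (s x)) (vscl L x (f x) (D s x v)))))"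

definition hermitian_connection ::
  "('b, 'e::euclidean_space) smooth_space \<Rightarrow> ('b, 'l) line_bundle \<Rightarrow> ('b, 'e, 'l) conn \<Rightarrow> bool" where
  "hermitian_connection X L D \<longleftrightarrow> is_connection X L D \<and>
     (\<forall>W s s'. smooth_section X L W s \<and> smooth_section X L W s' \<longrightarrow>
        (\<forall>x\<in>W. \<forall>v\<in>tangent X x.
           ddir X (\<lambda>y. herm L y (s y) (s' y)) x v =
             herm L x (D s x v) (s' x) + herm L x (s x) (D s' x v)))"

definition unitary_frame ::
  "('b, 'e::euclidean_space) smooth_space \<Rightarrow> ('b, 'l) line_bundle \<Rightarrow> 'b set \<Rightarrow> ('b \<Rightarrow> 'l) \<Rightarrow> bool" where
  "unitary_frame X L W e \<longleftrightarrow> smooth_section X L W e \<and> (\<forall>x\<in>W. herm L x (e x) (e x) = 1)"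

text \<open>The connection \<open>D\<close> has curvature \<open>K\<close>: wherever \<open>D\<close> is locally \<open>d - \<i> A\<close> with a real 1-form
  \<open>A\<close>, i.e. \<open>D e = - \<i> A e\<close> for a unitary frame \<open>e\<close>, we have \<open>K = dA\<close>.\<close>

definition has_curvature ::
  "('b, 'e::euclidean_space) smooth_space \<Rightarrow> ('b, 'l) line_bundle \<Rightarrow> ('b, 'e, 'l) conn \<Rightarrow>
   ('b, 'e) form2 \<Rightarrow> bool" where
  "has_curvature X L D K \<longleftrightarrow>
     (\<forall>W e A. unitary_frame X L W e \<and>
        (\<forall>x\<in>W. \<forall>v\<in>tangent X x. D e x v = vscl L x (- \<i> * of_real (A x v)) (e x)) \<longrightarrow>
        (\<forall>x\<in>W. \<forall>c. chart_at X x c \<longrightarrow>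
           (\<forall>u\<in>tangent X x. \<forall>v\<in>tangent X x. K x u v = ext_d1 X c A x u v)))"

text \<open>The connection \<open>D - \<i> A\<close>.\<close>

definition conn_minus_form ::
  "('b, 'l) line_bundle \<Rightarrow> ('b, 'e, 'l) conn \<Rightarrow> ('b, 'e) form1 \<Rightarrow> ('b, 'e, 'l) conn" where
  "conn_minus_form L D A s x v = vadd L x (D s x v) (vscl L x (- \<i> * of_real (A x v)) (s x))"

text \<open>Pullback along a map \<open>f\<close> with domain \<open>S\<close>.\<close>

definition pull_bundle :: "'a set \<Rightarrow> ('a \<Rightarrow> 'b) \<Rightarrow> ('b, 'l) line_bundle \<Rightarrow> ('a, 'l) line_bundle" where
  "pull_bundle S f L = \<lparr>fib = fib L \<circ> f, vadd = vadd L \<circ> f, vscl = vscl L \<circ> f, herm = herm L \<circ> f,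
     frames = (\<lambda>(W, e). ({x \<in> S. f x \<in> W}, e \<circ> f)) ` frames L\<rparr>"

text \<open>The pullback of a connection is determined by \<open>(f\<^sup>*D) (e \<circ> f) = (D e) (df)\<close> and the Leibniz rule,
  applied to \<open>s = h (e \<circ> f)\<close>; the value does not depend on the frame \<open>e\<close> selected.\<close>

definition pull_conn ::
  "('a, 'c::euclidean_space) smooth_space \<Rightarrow> ('b, 'e::euclidean_space) smooth_space \<Rightarrow>
   ('a \<Rightarrow> 'b) \<Rightarrow> ('b, 'l) line_bundle \<Rightarrow> ('b, 'e, 'l) conn \<Rightarrow> ('a, 'c, 'l) conn" where
  "pull_conn X Y f L D s x v =
     (let e = snd (SOME F. F \<in> frames L \<and> f x \<in> fst F);
          h = (\<lambda>y. ratio L (f y) (s y) (e (f y)))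
      in vadd L (f x) (vscl L (f x) (ddir X h x v) (e (f x)))
                      (vscl L (f x) (h x) (D e (f x) (tmap X Y f x v))))"


section \<open>The path space as a Chen space\<close>

definition paths :: "('m, 'e::euclidean_space) smooth_space \<Rightarrow> (real \<Rightarrow> 'm) set" where
  "paths M = {\<gamma>. \<gamma> \<in> extensional {0..1} \<and> smooth_map (std {0..1}) M \<gamma>}"

definition ev :: "real \<Rightarrow> (real \<Rightarrow> 'm) \<Rightarrow> 'm" where
  "ev t \<gamma> = \<gamma> t"

text \<open>Smooth vector fields along \<open>\<gamma>\<close>.\<close>

definition path_tangent ::
  "('m, 'e::euclidean_space) smooth_space \<Rightarrow> (real \<Rightarrow> 'm) \<Rightarrow> (real \<Rightarrow> ('m, 'e) tvec) set" where
  "path_tangent M \<gamma> = {v. v \<in> extensional {0..1} \<and> (\<forall>t\<in>{0..1}. v t \<in> tangent M (\<gamma> t)) \<and>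
     (\<forall>c\<in>atlas M. smooth_on {t \<in> {0..1}. \<gamma> t \<in> fst c} (\<lambda>t. v t c))}"

definition d_ev :: "real \<Rightarrow> (real \<Rightarrow> ('m, 'e) tvec) \<Rightarrow> ('m, 'e) tvec" where
  "d_ev t v = v t"

definition path_comb ::
  "real \<Rightarrow> (real \<Rightarrow> ('m, 'e::real_vector) tvec) \<Rightarrow> real \<Rightarrow> (real \<Rightarrow> ('m, 'e) tvec) \<Rightarrow>
   real \<Rightarrow> ('m, 'e) tvec" where
  "path_comb a v b w = (\<lambda>t\<in>{0..1}. tcomb a (v t) b (w t))"

definition velocity ::
  "('m, 'e::euclidean_space) smooth_space \<Rightarrow> (real \<Rightarrow> 'm) \<Rightarrow> real \<Rightarrow> ('m, 'e) tvec" where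
  "velocity M \<gamma> t = tmap (std {0..1}) M \<gamma> t (std_vec {0..1} t 1)"

definition plot ::
  "('m, 'e::euclidean_space) smooth_space \<Rightarrow> 'u::euclidean_space set \<Rightarrow> ('u \<Rightarrow> real \<Rightarrow> 'm) \<Rightarrow> bool" where
  "plot M U \<alpha> \<longleftrightarrow> region U \<and> (\<forall>p\<in>U. \<alpha> p \<in> paths M) \<and>
     smooth_map (std (U \<times> {0..1})) M (\<lambda>(p, t). \<alpha> p t)"

text \<open>The differential of a plot.\<close>

definition plot_tmap ::
  "('m, 'e::euclidean_space) smooth_space \<Rightarrow> 'u::euclidean_space set \<Rightarrow> ('u \<Rightarrow> real \<Rightarrow> 'm) \<Rightarrow>
   'u \<Rightarrow> ('u, 'u) tvec \<Rightarrow> real \<Rightarrow> ('m, 'e) tvec" where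
  "plot_tmap M U \<alpha> p u = (\<lambda>t\<in>{0..1}. tmap (std U) M (ev t \<circ> \<alpha>) p u)"

type_synonym ('m, 'e) path_form1 = "(real \<Rightarrow> 'm) \<Rightarrow> (real \<Rightarrow> ('m, 'e) tvec) \<Rightarrow> real"
type_synonym ('m, 'e) path_form2 =
  "(real \<Rightarrow> 'm) \<Rightarrow> (real \<Rightarrow> ('m, 'e) tvec) \<Rightarrow> (real \<Rightarrow> ('m, 'e) tvec) \<Rightarrow> real"

definition plot_pull1 ::
  "('m, 'e::euclidean_space) smooth_space \<Rightarrow> 'u::euclidean_space set \<Rightarrow> ('u \<Rightarrow> real \<Rightarrow> 'm) \<Rightarrow>
   ('m, 'e) path_form1 \<Rightarrow> ('u, 'u) form1" where
  "plot_pull1 M U \<alpha> A p u = A (\<alpha> p) (plot_tmap M U \<alpha> p u)"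

definition plot_pull2 ::
  "('m, 'e::euclidean_space) smooth_space \<Rightarrow> 'u::euclidean_space set \<Rightarrow> ('u \<Rightarrow> real \<Rightarrow> 'm) \<Rightarrow>
   ('m, 'e) path_form2 \<Rightarrow> ('u, 'u) form2" where
  "plot_pull2 M U \<alpha> K p u v = K (\<alpha> p) (plot_tmap M U \<alpha> p u) (plot_tmap M U \<alpha> p v)"

text \<open>Differential forms, line bundles and connections on the path space are tested on all plots. The
  Euclidean space containing the domain of a plot is a type, passed as an \<open>itself\<close> argument.\<close>

definition path_one_form ::
  "'u::euclidean_space itself \<Rightarrow> ('m, 'e::euclidean_space) smooth_space \<Rightarrow>
   ('m, 'e) path_form1 \<Rightarrow> bool" where
  "path_one_form _ M A \<longleftrightarrow>
     (\<forall>\<gamma>\<in>paths M. \<forall>v\<in>path_tangent M \<gamma>. \<forall>w\<in>path_tangent M \<gamma>. \<forall>a b.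
        A \<gamma> (path_comb a v b w) = a * A \<gamma> v + b * A \<gamma> w) \<and>
     (\<forall>(U :: 'u set) \<alpha>. plot M U \<alpha> \<longrightarrow> one_form (std U) (plot_pull1 M U \<alpha> A))"

definition path_two_form ::
  "'u::euclidean_space itself \<Rightarrow> ('m, 'e::euclidean_space) smooth_space \<Rightarrow>
   ('m, 'e) path_form2 \<Rightarrow> bool" where
  "path_two_form _ M K \<longleftrightarrow>
     (\<forall>\<gamma>\<in>paths M. \<forall>u\<in>path_tangent M \<gamma>. K \<gamma> u u = 0 \<and>
        (\<forall>v\<in>path_tangent M \<gamma>. \<forall>w\<in>path_tangent M \<gamma>. \<forall>a b.
           K \<gamma> u (path_comb a v b w) = a * K \<gamma> u v + b * K \<gamma> u w \<and>
           K \<gamma> (path_comb a v b w) u = a * K \<gamma> v u + b * K \<gamma> w u)) \<and>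
     (\<forall>(U :: 'u set) \<alpha>. plot M U \<alpha> \<longrightarrow> two_form (std U) (plot_pull2 M U \<alpha> K))"

definition path_hermitian_line_bundle ::
  "'u::euclidean_space itself \<Rightarrow> ('m, 'e::euclidean_space) smooth_space \<Rightarrow>
   (real \<Rightarrow> 'm, 'l) line_bundle \<Rightarrow> bool" where
  "path_hermitian_line_bundle _ M E \<longleftrightarrow>
     (\<forall>(U :: 'u set) \<alpha>. plot M U \<alpha> \<longrightarrow> hermitian_line_bundle (std U) (pull_bundle U \<alpha> E))"

text \<open>A connection on a line bundle \<open>E\<close> over the path space assigns to each plot \<open>\<alpha>\<close> on \<open>U\<close> a connection
  on \<open>\<alpha>\<^sup>*E\<close>, compatibly with reparametrisations \<open>g\<close> of plots.\<close>

type_synonym ('u, 'm, 'l) path_conn =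
  "'u set \<Rightarrow> ('u \<Rightarrow> real \<Rightarrow> 'm) \<Rightarrow> ('u, 'u, 'l) conn"

definition path_conn_compatible ::
  "('m, 'e::euclidean_space) smooth_space \<Rightarrow> (real \<Rightarrow> 'm, 'l) line_bundle \<Rightarrow>
   ('u::euclidean_space, 'm, 'l) path_conn \<Rightarrow> ('v::euclidean_space, 'm, 'l) path_conn \<Rightarrow> bool" where
  "path_conn_compatible M E D D' \<longleftrightarrow>
     (\<forall>U \<alpha> V g. plot M U \<alpha> \<and> region V \<and> smooth_map (std V) (std U) g \<longrightarrow>
        (\<forall>W s. smooth_section (std V) (pull_bundle V (\<alpha> \<circ> g) E) W s \<longrightarrow>
           (\<forall>q\<in>W. \<forall>w\<in>tangent (std V) q.
              D' V (\<alpha> \<circ> g) s q w =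
                pull_conn (std V) (std U) g (pull_bundle U \<alpha> E) (D U \<alpha>) s q w)))"

definition path_hermitian_connection ::
  "('m, 'e::euclidean_space) smooth_space \<Rightarrow> (real \<Rightarrow> 'm, 'l) line_bundle \<Rightarrow>
   ('u::euclidean_space, 'm, 'l) path_conn \<Rightarrow> bool" where
  "path_hermitian_connection M E D \<longleftrightarrow>
     (\<forall>U \<alpha>. plot M U \<alpha> \<longrightarrow> hermitian_connection (std U) (pull_bundle U \<alpha> E) (D U \<alpha>))"

definition path_has_curvature ::
  "('m, 'e::euclidean_space) smooth_space \<Rightarrow> (real \<Rightarrow> 'm, 'l) line_bundle \<Rightarrow>
   ('u::euclidean_space, 'm, 'l) path_conn \<Rightarrow> ('m, 'e) path_form2 \<Rightarrow> bool" where
  "path_has_curvature M E D K \<longleftrightarrow>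
     (\<forall>U \<alpha>. plot M U \<alpha> \<longrightarrow>
        has_curvature (std U) (pull_bundle U \<alpha> E) (D U \<alpha>) (plot_pull2 M U \<alpha> K))"

definition path_conn_minus_form ::
  "('m, 'e::euclidean_space) smooth_space \<Rightarrow> (real \<Rightarrow> 'm, 'l) line_bundle \<Rightarrow>
   ('u::euclidean_space, 'm, 'l) path_conn \<Rightarrow> ('m, 'e) path_form1 \<Rightarrow> ('u, 'm, 'l) path_conn" where
  "path_conn_minus_form M E D A U \<alpha> =
     conn_minus_form (pull_bundle U \<alpha> E) (D U \<alpha>) (plot_pull1 M U \<alpha> A)"

definition ev_bundle ::
  "('m, 'e::euclidean_space) smooth_space \<Rightarrow> real \<Rightarrow> ('m, 'l) line_bundle \<Rightarrow>
   (real \<Rightarrow> 'm, 'l) line_bundle" where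
  "ev_bundle M t L = pull_bundle (paths M) (ev t) L"

definition ev_conn ::
  "('m, 'e::euclidean_space) smooth_space \<Rightarrow> real \<Rightarrow> ('m, 'l) line_bundle \<Rightarrow> ('m, 'e, 'l) conn \<Rightarrow>
   ('u::euclidean_space, 'm, 'l) path_conn" where
  "ev_conn M t L D U \<alpha> = pull_conn (std U) M (ev t \<circ> \<alpha>) L D"

definition lambda_form ::
  "('m, 'e::euclidean_space) smooth_space \<Rightarrow> ('m, 'e) form2 \<Rightarrow> ('m, 'e) path_form1" where
  "lambda_form M \<omega> \<gamma> v =
     integral {0..1} (\<lambda>t. integral {0..t} (\<lambda>\<tau>. \<omega> (\<gamma> \<tau>) (velocity M \<gamma> \<tau>) (d_ev \<tau> v)))"

definition omega_tilde :: "('m, 'e) form2 \<Rightarrow> ('m, 'e) path_form2" where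
  "omega_tilde \<omega> \<gamma> v\<^sub>1 v\<^sub>2 = integral {0..1} (\<lambda>t. \<omega> (\<gamma> t) (d_ev t v\<^sub>1) (d_ev t v\<^sub>2))"

definition nabla_tilde ::
  "real \<Rightarrow> ('m, 'e::euclidean_space) smooth_space \<Rightarrow> ('m, 'e) form2 \<Rightarrow> ('m, 'l) line_bundle \<Rightarrow>
   ('m, 'e, 'l) conn \<Rightarrow> ('u::euclidean_space, 'm, 'l) path_conn" where
  "nabla_tilde hb M \<omega> L D =
     path_conn_minus_form M (ev_bundle M 0 L) (ev_conn M 0 L D)
       (\<lambda>\<gamma> v. inverse hb * lambda_form M \<omega> \<gamma> v)"

end

theory Submission
  imports Defs
begin

text \<open>Let \<open>A\<close> be the real 1-form of \<open>\<nabla> = d - \<i> A\<close> in a local unitary frame of \<open>L\<close>, so that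
  \<open>dA = \<omega> / \<hbar>\<close>. On a plot \<open>\<alpha>\<close> with domain \<open>U\<close>, the connection of the theorem is \<open>d - \<i> A'\<close> in the
  pulled back frame, where \<open>A' = f\<^sup>*A + \<lambda> / \<hbar>\<close> and \<open>f = ev\<^sub>0 \<circ> \<alpha>\<close>. Its curvature is therefore
  \<open>(f\<^sup>*\<omega> + d\<lambda>) / \<hbar>\<close>, and what has to be shown is \<open>d\<lambda> = \<omega>~ - ev\<^sub>0\<^sup>*\<omega>\<close>.

  This is a computation with the closed 2-form \<open>\<Omega>\<close> that \<open>\<omega>\<close> induces on \<open>U \<times> [0, 1]\<close> along
  \<open>(p, t) \<mapsto> \<alpha> p t\<close>. Integrating by parts once, \<open>\<lambda>(v) = \<integral> (1 - t) \<Omega>(\<partial>\<^sub>t, v) dt\<close> (\<open>iterated_integral\<close>). After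
  differentiation under the integral sign, \<open>d\<Omega> = 0\<close> gives
  \<open>d\<lambda>(u, v) = \<integral> (1 - t) \<partial>\<^sub>t(\<Omega>(u, v)) dt\<close>, and integrating by parts again gives
  \<open>\<integral> \<Omega>(u, v) dt - \<Omega>(u, v)\<close> with the last term at \<open>t = 0\<close> (\<open>fibre_integral_of_closed\<close>). The two terms
  are \<open>\<omega>~\<close> and \<open>ev\<^sub>0\<^sup>*\<omega>\<close> (\<open>ext_d1_lambda\<close>). That \<open>\<Omega>\<close> is closed follows from the curvature of \<open>\<nabla>\<close>, which
  makes \<open>\<Omega>\<close> locally the differential of \<open>\<hbar>\<close> times a pulled back connection form
  (\<open>plot_coef_closed\<close>).

  Everything about the connections is read off from their forms in local unitary frames
  (\<open>conn_form\<close>). A Hermitian connection has such forms around every point (\<open>conn_form_exists\<close>),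
  and whatever is locally of the form \<open>d - \<i> A\<close> is a Hermitian connection
  (\<open>hermitian_connection_of_conn_forms\<close>). Pulling a connection back pulls its forms back
  (\<open>conn_form_pull\<close>), and subtracting \<open>\<i> B\<close> adds \<open>B\<close> to them (\<open>conn_form_minus\<close>). Two connections
  with the same form in the same frame agree, which gives the compatibility with
  reparametrisations. Passing to another unitary frame changes \<open>A\<close> by a closed form
  (\<open>log_derivative_closed_coords\<close>), so the curvature may be computed in any one frame around each
  point (\<open>has_curvature_of_conn_forms\<close>).

  Domains of plots may contain boundary points. Derivatives there are still unique
  (\<open>derivative_unique_on_relopen\<close>), and the symmetry of second derivatives extends to them by
  density of the interior (\<open>fd_fd_symmetric\<close>); with these two facts the calculus is the same as on
  open sets.\<close>

section \<open>Smooth calculus on relatively open subsets of regions\<close>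

text \<open>The domains on which smoothness is tested below: coordinate images of open sets, in particular
  the relatively open pieces of a region that contain some of its boundary points.\<close>

definition relopen :: "'a::euclidean_space set \<Rightarrow> bool" where
  "relopen S \<longleftrightarrow> (\<exists>U T. region U \<and> open T \<and> S = U \<inter> T)"

abbreviation fd :: "'a::euclidean_space set \<Rightarrow> ('a \<Rightarrow> 'b::real_normed_vector) \<Rightarrow> 'a \<Rightarrow> 'a \<Rightarrow> 'b" where
  "fd S f x \<equiv> frechet_derivative f (at x within S)"

lemma relopen_region: "region U \<Longrightarrow> relopen U"
  unfolding relopen_def by (intro exI[of _ U] exI[of _ UNIV]) auto

lemma region_UNIV: "region (UNIV :: 'a::euclidean_space set)"
  unfolding region_def by auto

lemma relopen_open: "open S \<Longrightarrow> relopen S"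
  unfolding relopen_def by (intro exI[of _ UNIV] exI[of _ S]) (auto simp: region_UNIV)

lemma relopen_Int_open: "relopen S \<Longrightarrow> open T \<Longrightarrow> relopen (S \<inter> T)"
  unfolding relopen_def by (metis Int_assoc open_Int)

lemma relopen_openin: "relopen S \<Longrightarrow> openin (top_of_set S) S' \<Longrightarrow> relopen S'"
  by (metis openin_open relopen_Int_open)

lemma at_within_openin:
  assumes "openin (top_of_set S) S'" "x \<in> S'"
  shows "at x within S' = at x within S"
proof -
  obtain T where "open T" "S' = S \<inter> T" using assms(1) by (auto simp: openin_open)
  then show ?thesis using assms(2) by (intro at_within_nhd[of x T]) auto
qed

text \<open>At a boundary point \<open>x\<close> a derivative is only tested in the directions \<open>y - x\<close> with \<open>y\<close> in the
  region. By convexity the whole segment from \<open>x\<close> to \<open>y\<close> is available, and as \<open>y\<close> ranges over a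
  ball these directions span the space.\<close>

lemma derivative_unique_on_relopen:
  assumes S: "relopen S" and x: "x \<in> S"
    and D: "(f has_derivative D) (at x within S)" "(f has_derivative D') (at x within S)"
  shows "D = D'"
proof -
  obtain U T where U: "convex U" "interior U \<noteq> {}" and T: "open T" "S = U \<inter> T"
    using S by (auto simp: relopen_def region_def)
  have "openin (top_of_set U) S" using T by (auto simp: openin_open)
  then have at: "at x within S = at x within U" using x by (rule at_within_openin)
  define L where "L = (\<lambda>h. D h - D' h)"
  have L: "((\<lambda>x. 0) has_derivative L) (at x within U)"
    using has_derivative_diff[OF D] unfolding L_def at by simp
  then interpret L: bounded_linear L by (rule has_derivative_bounded_linear)
  have xU: "x \<in> U" using x T by auto
  have along: "L (y - x) = 0" if y: "y \<in> U" for y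
  proof -
    define c where "c = (\<lambda>s::real. x + s *\<^sub>R (y - x))"
    have sub: "c ` {0..1} \<subseteq> U"
    proof safe
      fix s :: real assume "s \<in> {0..1}"
      then have "(1 - s) *\<^sub>R x + s *\<^sub>R y \<in> U" using U(1) xU y by (auto simp: convex_alt)
      then show "c s \<in> U" by (simp add: c_def algebra_simps)
    qed
    have "(c has_derivative (\<lambda>s. s *\<^sub>R (y - x))) (at 0 within {0..1})"
      unfolding c_def by (auto intro!: derivative_eq_intros)
    moreover have "((\<lambda>x. 0) has_derivative L) (at (c 0) within c ` {0..1})"
      using L sub by (simp add: c_def has_derivative_subset)
    ultimately have "((\<lambda>x. 0) \<circ> c has_derivative L \<circ> (\<lambda>s. s *\<^sub>R (y - x))) (at 0 within {0..1})"
      by (rule diff_chain_within)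
    then have "((\<lambda>_. 0) has_vector_derivative L (y - x)) (at (0::real) within {0..1})"
      by (simp add: has_vector_derivative_def o_def L.scaleR)
    moreover have "((\<lambda>_. 0) has_vector_derivative 0) (at (0::real) within {0..1})"
      by simp
    moreover have "at (0::real) within {0..1} \<noteq> bot" by (simp add: trivial_limit_within islimpt_Icc)
    ultimately show ?thesis using vector_derivative_unique_within by blast
  qed
  obtain y r where r: "r > 0" "ball y r \<subseteq> U"
    using U(2) by (meson all_not_in_conv mem_interior)
  have "L h = 0" for h
  proof (cases "h = 0")
    case False
    \<comment> \<open>scales \<open>h\<close> to length \<open>r / 2\<close>, so that \<open>y + s h\<close> stays in the ball\<close>
    define s where "s = r / 2 / norm h"
    have s: "s > 0" using False r by (simp add: s_def)
    have "y + s *\<^sub>R h \<in> U" using r False by (intro subsetD[OF r(2)]) (simp add: dist_norm s_def)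
    moreover have "y \<in> U" using r by auto
    ultimately have "L ((y + s *\<^sub>R h - x) - (y - x)) = 0"
      using along unfolding L.diff by simp
    then show ?thesis using s by (simp add: L.scaleR)
  qed (simp add: L.zero)
  then show ?thesis by (auto simp: L_def fun_eq_iff)
qed

lemma fd_eq:
  assumes "relopen S" "x \<in> S" "(f has_derivative D) (at x within S)"
  shows "fd S f x = D"
  using assms derivative_unique_on_relopen frechet_derivative_works differentiableI by metis

lemma has_derivative_fd:
  "f differentiable (at x within S) \<Longrightarrow> (f has_derivative fd S f x) (at x within S)"
  by (simp add: frechet_derivative_works)

lemma fd_cong:
  assumes "\<And>y. y \<in> S \<Longrightarrow> f y = g y" "x \<in> S"
  shows "fd S f x = fd S g x"
  unfolding frechet_derivative_def
  using assms by (metis has_derivative_transform)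

lemma fd_linear:
  assumes "f differentiable (at x within S)"
  shows "fd S f x (r *\<^sub>R a + s *\<^sub>R b) = r *\<^sub>R fd S f x a + s *\<^sub>R fd S f x b"
proof -
  interpret bounded_linear "fd S f x"
    using has_derivative_fd[OF assms] by (rule has_derivative_bounded_linear)
  show ?thesis by (simp add: add scaleR)
qed

lemma fd_expand:
  fixes f :: "'a::euclidean_space \<Rightarrow> 'b::real_normed_vector"
  assumes "f differentiable (at x within S)"
  shows "fd S f x a = (\<Sum>i\<in>Basis. (a \<bullet> i) *\<^sub>R fd S f x i)"
proof -
  interpret bounded_linear "fd S f x"
    using has_derivative_fd[OF assms] by (rule has_derivative_bounded_linear)
  have "fd S f x (\<Sum>i\<in>Basis. (a \<bullet> i) *\<^sub>R i) = (\<Sum>i\<in>Basis. (a \<bullet> i) *\<^sub>R fd S f x i)"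
    by (simp add: sum scaleR)
  then show ?thesis by (simp add: euclidean_representation)
qed

lemma Ck_on_cong:
  assumes "\<And>x. x \<in> S \<Longrightarrow> f x = g x"
  shows "Ck_on k S f \<longleftrightarrow> Ck_on k S g"
proof -
  have "Ck_on k S g" if "Ck_on k S f" "\<And>x. x \<in> S \<Longrightarrow> f x = g x" for f g :: "'a \<Rightarrow> 'b"
    using that
  proof (induction k arbitrary: f g)
    case 0
    then show ?case using continuous_on_cong by (metis Ck_on.simps(1))
  next
    case (Suc k)
    have "g differentiable_on S"
      using Suc.prems unfolding differentiable_on_def differentiable_def Ck_on.simps
      by (metis has_derivative_transform)
    moreover have "Ck_on k S (\<lambda>x. fd S g x a)" for a
    proof (rule Suc.IH)
      show "Ck_on k S (\<lambda>x. fd S f x a)" using Suc.prems by simp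
      show "fd S f x a = fd S g x a" if "x \<in> S" for x
        using fd_cong Suc.prems(2) that by metis
    qed
    ultimately show ?case by simp
  qed
  then show ?thesis using assms by metis
qed

lemma Ck_on_SucD: "Ck_on (Suc k) S f \<Longrightarrow> Ck_on k S f"
  by (induction k arbitrary: f) (auto simp: differentiable_imp_continuous_on)

lemma Ck_on_SucI:
  assumes "relopen S" "\<And>x. x \<in> S \<Longrightarrow> (f has_derivative D x) (at x within S)"
    and "\<And>a. Ck_on k S (\<lambda>x. D x a)"
  shows "Ck_on (Suc k) S f"
proof -
  have "f differentiable_on S"
    using assms(2) unfolding differentiable_on_def differentiable_def by blast
  moreover have "Ck_on k S (\<lambda>x. fd S f x a)" for a
    using assms(3)[of a] fd_eq[OF assms(1) _ assms(2)]
    by (subst Ck_on_cong[where g = "\<lambda>x. D x a"]) auto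
  ultimately show ?thesis by simp
qed

lemma Ck_on_has_derivative:
  "Ck_on (Suc k) S f \<Longrightarrow> x \<in> S \<Longrightarrow> (f has_derivative fd S f x) (at x within S)"
  by (simp add: differentiable_on_def frechet_derivative_works)

lemma Ck_on_fd: "Ck_on (Suc k) S f \<Longrightarrow> Ck_on k S (\<lambda>x. fd S f x a)"
  by simp

lemma Ck_on_const: "relopen S \<Longrightarrow> Ck_on k S (\<lambda>_. c)"
proof (induction k arbitrary: c)
  case (Suc k)
  show ?case using Suc by (intro Ck_on_SucI[where D = "\<lambda>_ _. 0"]) auto
qed simp

lemma Ck_on_bounded_linear:
  assumes "bounded_linear L" "relopen S" "Ck_on k S f"
  shows "Ck_on k S (\<lambda>x. L (f x))"
  using assms(3)
proof (induction k arbitrary: f)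
  case 0
  then show ?case using linear_continuous_on_compose[OF _ bounded_linear.linear] assms(1)
    by (simp add: bounded_linear.continuous_on)
next
  case (Suc k)
  show ?case
    using Suc by (intro Ck_on_SucI[OF assms(2) bounded_linear.has_derivative[OF assms(1) Ck_on_has_derivative]])
      auto
qed

lemma Ck_on_linear: 
  assumes "bounded_linear L" "relopen S"
  shows "Ck_on k S L"
proof (cases k)
  case 0
  then show ?thesis using linear_continuous_on[OF assms(1)] by simp
next
  case (Suc m)
  show ?thesis unfolding Suc
    using assms(1) by (intro Ck_on_SucI[OF assms(2) bounded_linear_imp_has_derivative] Ck_on_const assms(2))
qed

lemma Ck_on_add:
  assumes "relopen S" "Ck_on k S f" "Ck_on k S g"
  shows "Ck_on k S (\<lambda>x. f x + g x)"
  using assms(2,3)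
proof (induction k arbitrary: f g)
  case 0
  then show ?case by (simp add: continuous_on_add)
next
  case (Suc k)
  show ?case
    using Suc by (intro Ck_on_SucI[OF assms(1) has_derivative_add[OF Ck_on_has_derivative Ck_on_has_derivative]])
      auto
qed

lemma Ck_on_bilinear:
  assumes B: "bounded_bilinear B" and S: "relopen S" and "Ck_on k S f" "Ck_on k S g"
  shows "Ck_on k S (\<lambda>x. B (f x) (g x))"
  using assms(3,4)
proof (induction k arbitrary: f g)
  case 0
  then show ?case by (simp add: bounded_bilinear.continuous_on[OF B])
next
  case (Suc k)
  have "Ck_on k S (\<lambda>x. B (f x) (fd S g x a) + B (fd S f x a) (g x))" for a
    using Suc.prems[THEN Ck_on_SucD] Suc.prems[THEN Ck_on_fd] by (intro Ck_on_add[OF S] Suc.IH)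
  then show ?case
    using Suc.prems
    by (intro Ck_on_SucI[OF S bounded_bilinear.FDERIV[OF B Ck_on_has_derivative Ck_on_has_derivative]])
qed

lemma Ck_on_sum:
  assumes "relopen S" "finite I" "\<And>i. i \<in> I \<Longrightarrow> Ck_on k S (f i)"
  shows "Ck_on k S (\<lambda>x. \<Sum>i\<in>I. f i x)"
  using assms(2,3) by (induction I rule: finite_induct) (auto intro: Ck_on_const Ck_on_add assms(1))

text \<open>Expanding \<open>Dg(f x)(Df x a)\<close> in a basis expresses the derivative of the composition through
  directional derivatives of \<open>g\<close> in fixed directions, to which the induction hypothesis applies.\<close>

lemma Ck_on_compose:
  fixes f :: "'a::euclidean_space \<Rightarrow> 'b::euclidean_space"
  assumes S: "relopen S" and T: "relopen T" and sub: "f ` S \<subseteq> T"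
    and "Ck_on k S f" "Ck_on k T g"
  shows "Ck_on k S (\<lambda>x. g (f x))"
  using assms(4,5)
proof (induction k arbitrary: g)
  case 0
  then show ?case using sub continuous_on_compose2 by auto
next
  case (Suc k)
  have dg: "g differentiable (at (f x) within T)" if "x \<in> S" for x
    using Suc.prems sub that by (auto simp: differentiable_on_def)
  show ?case
  proof (rule Ck_on_SucI[OF S])
    fix x assume x: "x \<in> S"
    have "(g has_derivative fd T g (f x)) (at (f x) within f ` S)"
      using has_derivative_fd[OF dg[OF x]] sub by (rule has_derivative_subset)
    then show "((\<lambda>x. g (f x)) has_derivative (\<lambda>a. fd T g (f x) (fd S f x a))) (at x within S)"
      using Ck_on_has_derivative[OF Suc.prems(1) x] by (metis has_derivative_in_compose)
  next
    fix a
    have "Ck_on k S (\<lambda>x. \<Sum>i\<in>Basis. (fd S f x a \<bullet> i) *\<^sub>R fd T g (f x) i)"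
      using Suc Ck_on_SucD[of k S f] S
      by (intro Ck_on_sum Ck_on_bilinear[OF bounded_bilinear_scaleR]
          Ck_on_bounded_linear[OF bounded_linear_inner_left]) auto
    then show "Ck_on k S (\<lambda>x. fd T g (f x) (fd S f x a))"
      by (subst Ck_on_cong[where g = "\<lambda>x. \<Sum>i\<in>Basis. (fd S f x a \<bullet> i) *\<^sub>R fd T g (f x) i"])
        (auto intro: fd_expand dg)
  qed
qed

lemma smooth_on_Ck: "smooth_on S f \<Longrightarrow> Ck_on k S f"
  by (simp add: smooth_on_def)

lemma smooth_on_cong:
  "(\<And>x. x \<in> S \<Longrightarrow> f x = g x) \<Longrightarrow> smooth_on S f \<longleftrightarrow> smooth_on S g"
  unfolding smooth_on_def using Ck_on_cong by metis

lemma smooth_on_has_derivative: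
  "smooth_on S f \<Longrightarrow> x \<in> S \<Longrightarrow> (f has_derivative fd S f x) (at x within S)"
  by (meson Ck_on_has_derivative smooth_on_def)

lemma smooth_on_differentiable: "smooth_on S f \<Longrightarrow> x \<in> S \<Longrightarrow> f differentiable (at x within S)"
  using smooth_on_has_derivative differentiableI by blast

lemma smooth_on_fd: "smooth_on S f \<Longrightarrow> smooth_on S (\<lambda>x. fd S f x a)"
  unfolding smooth_on_def using Ck_on_fd by blast

lemma smooth_on_continuous: "smooth_on S f \<Longrightarrow> continuous_on S f"
  unfolding smooth_on_def by (metis Ck_on.simps(1))

lemma smooth_onI:
  assumes "relopen S" "\<And>x. x \<in> S \<Longrightarrow> (f has_derivative D x) (at x within S)"
    and "\<And>a. smooth_on S (\<lambda>x. D x a)"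
  shows "smooth_on S f"
  unfolding smooth_on_def
proof
  fix k
  have "Ck_on (Suc k) S f" using assms by (intro Ck_on_SucI) (auto simp: smooth_on_def)
  then show "Ck_on k S f" by (rule Ck_on_SucD)
qed

lemma smooth_on_const: "relopen S \<Longrightarrow> smooth_on S (\<lambda>_. c)"
  by (simp add: smooth_on_def Ck_on_const)

lemma smooth_on_linear: "bounded_linear L \<Longrightarrow> relopen S \<Longrightarrow> smooth_on S L"
  by (simp add: smooth_on_def Ck_on_linear)

lemma smooth_on_id: "relopen S \<Longrightarrow> smooth_on S (\<lambda>x. x)"
  by (rule smooth_on_linear) (rule bounded_linear_ident)

lemma smooth_on_bounded_linear:
  "bounded_linear L \<Longrightarrow> relopen S \<Longrightarrow> smooth_on S f \<Longrightarrow> smooth_on S (\<lambda>x. L (f x))"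
  by (simp add: smooth_on_def Ck_on_bounded_linear)

lemma smooth_on_add:
  "relopen S \<Longrightarrow> smooth_on S f \<Longrightarrow> smooth_on S g \<Longrightarrow> smooth_on S (\<lambda>x. f x + g x)"
  by (simp add: smooth_on_def Ck_on_add)

lemma smooth_on_sum:
  "relopen S \<Longrightarrow> finite I \<Longrightarrow> (\<And>i. i \<in> I \<Longrightarrow> smooth_on S (f i)) \<Longrightarrow> smooth_on S (\<lambda>x. \<Sum>i\<in>I. f i x)"
  by (simp add: smooth_on_def Ck_on_sum)

lemma smooth_on_mult:
  fixes f g :: "'a::euclidean_space \<Rightarrow> 'b::real_normed_algebra"
  shows "relopen S \<Longrightarrow> smooth_on S f \<Longrightarrow> smooth_on S g \<Longrightarrow> smooth_on S (\<lambda>x. f x * g x)"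
  by (simp add: smooth_on_def Ck_on_bilinear[OF bounded_bilinear_mult])

lemma smooth_on_inner:
  "relopen S \<Longrightarrow> smooth_on S f \<Longrightarrow> smooth_on S (\<lambda>x. f x \<bullet> b)"
  by (rule smooth_on_bounded_linear[OF bounded_linear_inner_left])

lemma smooth_on_compose:
  fixes f :: "'a::euclidean_space \<Rightarrow> 'b::euclidean_space"
  shows "relopen S \<Longrightarrow> relopen T \<Longrightarrow> f ` S \<subseteq> T \<Longrightarrow> smooth_on S f \<Longrightarrow> smooth_on T g
    \<Longrightarrow> smooth_on S (\<lambda>x. g (f x))"
  by (simp add: smooth_on_def Ck_on_compose)

lemma smooth_on_subset:
  "relopen S' \<Longrightarrow> relopen S \<Longrightarrow> S' \<subseteq> S \<Longrightarrow> smooth_on S f \<Longrightarrow> smooth_on S' f"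
  using smooth_on_compose[of S' S "\<lambda>x. x" f] smooth_on_id by auto

lemma fd_compose:
  fixes f :: "'a::euclidean_space \<Rightarrow> 'b::euclidean_space"
  assumes "relopen S" "f ` S \<subseteq> T" "x \<in> S"
    and "f differentiable (at x within S)" "g differentiable (at (f x) within T)"
  shows "fd S (\<lambda>x. g (f x)) x a = fd T g (f x) (fd S f x a)"
proof -
  have "(g has_derivative fd T g (f x)) (at (f x) within f ` S)"
    using has_derivative_fd[OF assms(5)] assms(2) by (rule has_derivative_subset)
  then have "((\<lambda>x. g (f x)) has_derivative (\<lambda>a. fd T g (f x) (fd S f x a))) (at x within S)"
    using has_derivative_fd[OF assms(4)] has_derivative_in_compose by blast
  then show ?thesis using fd_eq assms by metis
qed

lemma fd_openin:
  "openin (top_of_set S) S' \<Longrightarrow> x \<in> S' \<Longrightarrow> fd S' f x = fd S f x"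
  by (simp add: at_within_openin)

lemma Ck_on_local:
  assumes "\<And>x. x \<in> S \<Longrightarrow> \<exists>S'. openin (top_of_set S) S' \<and> x \<in> S' \<and> Ck_on k S' f"
  shows "Ck_on k S f"
  using assms
proof (induction k arbitrary: f)
  case 0
  show ?case unfolding Ck_on.simps continuous_on_eq_continuous_within
  proof
    fix x assume "x \<in> S"
    then obtain S' where S': "openin (top_of_set S) S'" "x \<in> S'" "Ck_on 0 S' f"
      using 0 by blast
    then have "continuous (at x within S') f" by (simp add: continuous_on_eq_continuous_within)
    then show "continuous (at x within S) f"
      using at_within_openin[OF S'(1,2)] by simp
  qed
next
  case (Suc k)
  have "f differentiable_on S"
    unfolding differentiable_on_def
  proof
    fix x assume "x \<in> S"
    then obtain S' where S': "openin (top_of_set S) S'" "x \<in> S'" "Ck_on (Suc k) S' f"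
      using Suc.prems by blast
    then have "f differentiable at x within S'" by (simp add: differentiable_on_def)
    then show "f differentiable at x within S"
      using at_within_openin[OF S'(1,2)] by metis
  qed
  moreover have "Ck_on k S (\<lambda>x. fd S f x a)" for a
  proof (rule Suc.IH)
    fix x assume "x \<in> S"
    then obtain S' where S': "openin (top_of_set S) S'" "x \<in> S'" "Ck_on (Suc k) S' f"
      using Suc.prems by blast
    have "Ck_on k S' (\<lambda>x. fd S' f x a)" using S' by simp
    then have "Ck_on k S' (\<lambda>x. fd S f x a)"
      by (rule Ck_on_cong[THEN iffD1, rotated]) (simp only: fd_openin[OF S'(1)])
    then show "\<exists>S'. openin (top_of_set S) S' \<and> x \<in> S' \<and> Ck_on k S' (\<lambda>x. fd S f x a)"
      using S' by blast
  qed
  ultimately show ?case by simp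
qed

lemma smooth_on_local:
  assumes "\<And>x. x \<in> S \<Longrightarrow> \<exists>S'. openin (top_of_set S) S' \<and> x \<in> S' \<and> smooth_on S' f"
  shows "smooth_on S f"
  unfolding smooth_on_def using Ck_on_local assms by (metis smooth_on_Ck)

text \<open>All exponents are treated at once, because differentiation changes the exponent. The
  exponent \<open>-1/2\<close> is the one that normalises a frame.\<close>

lemma smooth_on_powr: "smooth_on {0<..} (\<lambda>x::real. x powr a)"
  unfolding smooth_on_def
proof
  fix k show "Ck_on k {0<..} (\<lambda>x::real. x powr a)"
  proof (induction k arbitrary: a)
    case 0
    then show ?case by (auto intro!: continuous_intros)
  next
    case (Suc k)
    show ?case
    proof (rule Ck_on_SucI)
      show "((\<lambda>x. x powr a) has_derivative (\<lambda>h. (h * a) * (x powr (a - 1)))) (at x within {0<..})"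
        if "x \<in> {0<..}" for x :: real
        using that by (auto intro!: derivative_eq_intros simp: powr_diff field_simps)
      show "Ck_on k {0<..} (\<lambda>x. b * a * x powr (a - 1))" for b
        by (intro Ck_on_bilinear[OF bounded_bilinear_mult] Ck_on_const Suc relopen_open) auto
    qed (simp add: relopen_open)
  qed
qed

lemma fd_add:
  assumes "relopen S" "x \<in> S" "f differentiable (at x within S)" "g differentiable (at x within S)"
  shows "fd S (\<lambda>x. f x + g x) x a = fd S f x a + fd S g x a"
  using fd_eq[OF assms(1,2) has_derivative_add[OF assms(3,4)[THEN has_derivative_fd]]] by simp

lemma fd_bilinear:
  assumes "bounded_bilinear B"
    "relopen S" "x \<in> S" "f differentiable (at x within S)" "g differentiable (at x within S)"
  shows "fd S (\<lambda>x. B (f x) (g x)) x a = B (f x) (fd S g x a) + B (fd S f x a) (g x)"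
  using fd_eq[OF assms(2,3) bounded_bilinear.FDERIV[OF assms(1) assms(4,5)[THEN has_derivative_fd]]] by simp

lemma fd_bounded_linear:
  assumes "bounded_linear L" "relopen S" "x \<in> S" "f differentiable (at x within S)"
  shows "fd S (\<lambda>x. L (f x)) x a = L (fd S f x a)"
  using fd_eq[OF assms(2,3) bounded_linear.has_derivative[OF assms(1) has_derivative_fd[OF assms(4)]]] by simp

lemma fd_sum:
  assumes "relopen S" "x \<in> S" "\<And>i. i \<in> I \<Longrightarrow> f i differentiable (at x within S)"
  shows "fd S (\<lambda>x. \<Sum>i\<in>I. f i x) x a = (\<Sum>i\<in>I. fd S (f i) x a)"
proof -
  have "((\<lambda>x. \<Sum>i\<in>I. f i x) has_derivative (\<lambda>a. \<Sum>i\<in>I. fd S (f i) x a)) (at x within S)"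
    using assms(3) by (intro has_derivative_sum has_derivative_fd)
  then show ?thesis using fd_eq[OF assms(1,2)] by metis
qed

lemma fd_const: "relopen S \<Longrightarrow> x \<in> S \<Longrightarrow> fd S (\<lambda>_. c) x a = 0"
  using fd_eq[OF _ _ has_derivative_const] by metis

lemma fd_linear_map: "bounded_linear L \<Longrightarrow> relopen S \<Longrightarrow> x \<in> S \<Longrightarrow> fd S L x a = L a"
  using fd_eq[OF _ _ bounded_linear_imp_has_derivative] by metis

lemma fd_id: "relopen S \<Longrightarrow> x \<in> S \<Longrightarrow> fd S (\<lambda>x. x) x a = a"
  by (rule fd_linear_map[OF bounded_linear_ident])

section \<open>Symmetry of second derivatives\<close>

lemma fd_line:
  assumes T: "open T" and "smooth_on T f" "y + s *\<^sub>R a \<in> T"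
  shows "((\<lambda>s. f (y + s *\<^sub>R a)) has_vector_derivative fd T f (y + s *\<^sub>R a) a) (at s within I)"
proof -
  have "(f has_derivative fd T f (y + s *\<^sub>R a)) (at (y + s *\<^sub>R a))"
    using smooth_on_has_derivative[OF assms(2,3)] at_within_open[OF assms(3) T] by simp
  then have f: "(f has_derivative fd T f (y + s *\<^sub>R a))
      (at (y + s *\<^sub>R a) within (\<lambda>s. y + s *\<^sub>R a) ` I)"
    by (rule has_derivative_at_withinI)
  have "((\<lambda>s. y + s *\<^sub>R a) has_derivative (\<lambda>s. s *\<^sub>R a)) (at s within I)"
    by (auto intro!: derivative_eq_intros)
  from has_derivative_in_compose[OF this f]
  have "((\<lambda>s. f (y + s *\<^sub>R a)) has_derivative (\<lambda>h. fd T f (y + s *\<^sub>R a) (h *\<^sub>R a))) (at s within I)" .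
  moreover have "bounded_linear (fd T f (y + s *\<^sub>R a))"
    using f by (rule has_derivative_bounded_linear)
  ultimately show ?thesis
    by (simp add: has_vector_derivative_def linear_simps)
qed

text \<open>Differentiating \<open>f(x + s a + t b) - f(x + t b) = \<integral> D\<^sub>a f(x + \<sigma> a + t b) d\<sigma>\<close> (with \<open>\<sigma>\<close> from 0 to
  \<open>s\<close>) first in \<open>t\<close>, under the integral sign, and then in \<open>s\<close> yields \<open>D\<^sub>a D\<^sub>b f = D\<^sub>b D\<^sub>a f\<close>. Unlike the
  argument with mean values, this works for vector-valued \<open>f\<close> directly. One-sided parameter
  intervals suffice.\<close>

lemma fd_fd_symmetric_open:
  fixes f :: "'a::euclidean_space \<Rightarrow> 'b::banach"
  assumes T: "open T" and f: "smooth_on T f" and x: "x \<in> T"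
  shows "fd T (\<lambda>y. fd T f y a) x b = fd T (\<lambda>y. fd T f y b) x a"
proof -
  have "eventually (\<lambda>z. x + fst z *\<^sub>R a + snd z *\<^sub>R b \<in> T) (nhds (0::real \<times> real))"
  proof -
    have "isCont (\<lambda>z::real \<times> real. x + fst z *\<^sub>R a + snd z *\<^sub>R b) 0"
      by (intro continuous_intros)
    then have "((\<lambda>z. x + fst z *\<^sub>R a + snd z *\<^sub>R b) \<longlongrightarrow> x) (nhds (0::real \<times> real))"
      using tendsto_at_iff_tendsto_nhds[of "\<lambda>z::real \<times> real. x + fst z *\<^sub>R a + snd z *\<^sub>R b" 0]
      unfolding isCont_def fst_zero snd_zero scaleR_zero_left add_0_right by blast
    then show ?thesis using T x by (intro topological_tendstoD) auto
  qed
  then obtain e where e: "e > 0" "\<And>z. dist z (0::real \<times> real) < e \<Longrightarrow> x + fst z *\<^sub>R a + snd z *\<^sub>R b \<in> T"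
    unfolding eventually_nhds_metric by blast
  \<comment> \<open>\<open>2 \<delta> < e\<close> bounds the norm of all \<open>(s, t)\<close> in the square\<close>
  define \<delta> where "\<delta> = e / 3"
  have \<delta>: "\<delta> > 0" using e by (simp add: \<delta>_def)
  have inT: "x + s *\<^sub>R a + t *\<^sub>R b \<in> T" if "s \<in> {0..\<delta>}" "t \<in> {0..\<delta>}" for s t
  proof -
    have "norm (s, t) \<le> norm s + norm t" by (rule norm_Pair_le)
    then have "dist (s, t) 0 < e" using that e by (simp add: \<delta>_def)
    then show ?thesis using e(2)[of "(s, t)"] by simp
  qed
  have inT': "x + s *\<^sub>R a \<in> T" if "s \<in> {0..\<delta>}" for s
    using inT[of s 0] that \<delta> by simp
  have ne: "at (0::real) within {0..\<delta>} \<noteq> bot" using \<delta> by (simp add: trivial_limit_within islimpt_Icc)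
  define g where "g = (\<lambda>s t. fd T f (x + s *\<^sub>R a + t *\<^sub>R b) a)"
  define h where "h = (\<lambda>s t. fd T (\<lambda>y. fd T f y a) (x + s *\<^sub>R a + t *\<^sub>R b) b)"
  have fa: "smooth_on T (\<lambda>y. fd T f y a)" and fb: "smooth_on T (\<lambda>y. fd T f y b)"
    by (rule smooth_on_fd[OF f])+
  have contg: "continuous_on ({0..\<delta>} \<times> {0..\<delta>}) (\<lambda>(t, s). g s t)"
    unfolding g_def case_prod_unfold
    by (rule continuous_on_compose2[OF smooth_on_continuous[OF fa]]) (auto intro!: continuous_intros inT)
  have conth: "continuous_on ({0..\<delta>} \<times> {0..\<delta>}) (\<lambda>(t, s). h s t)"
    unfolding h_def case_prod_unfold
    by (rule continuous_on_compose2[OF smooth_on_continuous[OF smooth_on_fd[OF fa]]])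
      (auto intro!: continuous_intros inT)
  have slice: "continuous_on {0..s} (\<lambda>\<sigma>. k \<sigma> t)"
    if "continuous_on ({0..\<delta>} \<times> {0..\<delta>}) (\<lambda>(t, s). k s t)" "s \<in> {0..\<delta>}" "t \<in> {0..\<delta>}"
    for k :: "real \<Rightarrow> real \<Rightarrow> 'b" and s t
  proof -
    have "continuous_on {0..s} (\<lambda>\<sigma>. (\<lambda>(t, s). k s t) (t, \<sigma>))"
      using that by (intro continuous_on_compose2[OF that(1)]) (auto intro!: continuous_intros)
    then show ?thesis by simp
  qed
  have ftc: "integral {0..s} (\<lambda>\<sigma>. g \<sigma> t) = f (x + s *\<^sub>R a + t *\<^sub>R b) - f (x + t *\<^sub>R b)"
    if s: "s \<in> {0..\<delta>}" and t: "t \<in> {0..\<delta>}" for s t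
  proof -
    have "((\<lambda>\<sigma>. f ((x + t *\<^sub>R b) + \<sigma> *\<^sub>R a)) has_vector_derivative g \<sigma> t) (at \<sigma> within {0..s})"
      if "\<sigma> \<in> {0..s}" for \<sigma>
      using fd_line[OF T f, of "x + t *\<^sub>R b" \<sigma> a] inT[of \<sigma> t] that s t
      by (simp add: g_def algebra_simps)
    then have "((\<lambda>\<sigma>. g \<sigma> t) has_integral f ((x + t *\<^sub>R b) + s *\<^sub>R a) - f ((x + t *\<^sub>R b) + 0 *\<^sub>R a)) {0..s}"
      using s by (intro fundamental_theorem_of_calculus) auto
    then show ?thesis by (simp add: integral_unique algebra_simps)
  qed
  \<comment> \<open>the derivative of \<open>ftc\<close> in \<open>t\<close> at 0\<close>
  have eq: "fd T f (x + s *\<^sub>R a) b = fd T f x b + integral {0..s} (\<lambda>\<sigma>. h \<sigma> 0)"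
    if s: "s \<in> {0..\<delta>}" for s
  proof -
    have "((\<lambda>t. integral (cbox 0 s) (\<lambda>\<sigma>. g \<sigma> t)) has_vector_derivative integral (cbox 0 s) (\<lambda>\<sigma>. h \<sigma> 0))
        (at 0 within {0..\<delta>})"
    proof (rule leibniz_rule_vector_derivative)
      fix t \<sigma> assume "t \<in> {0..\<delta>}" "\<sigma> \<in> cbox 0 s"
      then show "((\<lambda>t. g \<sigma> t) has_vector_derivative h \<sigma> t) (at t within {0..\<delta>})"
        unfolding g_def h_def using s by (intro fd_line[OF T fa]) (auto intro!: inT)
    next
      fix t assume t: "t \<in> {0..\<delta>}"
      show "(\<lambda>\<sigma>. g \<sigma> t) integrable_on cbox 0 s"
        using slice[OF contg s t] by (intro integrable_continuous) simp
    next
      show "continuous_on ({0..\<delta>} \<times> cbox 0 s) (\<lambda>(t, \<sigma>). h \<sigma> t)"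
        using conth s by (elim continuous_on_subset) auto
    qed (use \<delta> in auto)
    then have "((\<lambda>t. integral {0..s} (\<lambda>\<sigma>. g \<sigma> t)) has_vector_derivative
        integral {0..s} (\<lambda>\<sigma>. h \<sigma> 0)) (at 0 within {0..\<delta>})"
      by simp
    then have 1: "((\<lambda>t. f (x + s *\<^sub>R a + t *\<^sub>R b) - f (x + t *\<^sub>R b)) has_vector_derivative
        integral {0..s} (\<lambda>\<sigma>. h \<sigma> 0)) (at 0 within {0..\<delta>})"
      by (rule has_vector_derivative_transform[rotated 2]) (use \<delta> in \<open>auto simp: ftc[OF s]\<close>)
    have "((\<lambda>t. f (x + s *\<^sub>R a + t *\<^sub>R b) - f (x + t *\<^sub>R b)) has_vector_derivative
        fd T f (x + s *\<^sub>R a) b - fd T f x b) (at 0 within {0..\<delta>})"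
      using fd_line[OF T f, of "x + s *\<^sub>R a" 0 b] fd_line[OF T f, of x 0 b] inT'[OF s] x
      by (auto intro!: has_vector_derivative_diff)
    from vector_derivative_unique_within[OF ne 1 this] show ?thesis by simp
  qed
  have "((\<lambda>s. integral {0..s} (\<lambda>\<sigma>. h \<sigma> 0)) has_vector_derivative h 0 0) (at 0 within {0..\<delta>})"
    using \<delta> by (intro integral_has_vector_derivative slice conth) auto
  then have "((\<lambda>s. fd T f x b + integral {0..s} (\<lambda>\<sigma>. h \<sigma> 0)) has_vector_derivative h 0 0) (at 0 within {0..\<delta>})"
    by (auto intro!: derivative_eq_intros)
  then have 1: "((\<lambda>s. fd T f (x + s *\<^sub>R a) b) has_vector_derivative h 0 0) (at 0 within {0..\<delta>})"
    by (rule has_vector_derivative_transform[rotated 2]) (use \<delta> in \<open>auto simp: eq\<close>)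
  have "((\<lambda>s. fd T f (x + s *\<^sub>R a) b) has_vector_derivative fd T (\<lambda>y. fd T f y b) x a) (at 0 within {0..\<delta>})"
    using fd_line[OF T fb, of x 0 a] x by simp
  from vector_derivative_unique_within[OF ne 1 this] show ?thesis by (simp add: h_def)
qed

lemma relopen_subset_closure_interior:
  assumes "relopen S" shows "S \<subseteq> closure (interior S)"
proof -
  obtain U T where U: "convex U" "interior U \<noteq> {}" and T: "open T" "S = U \<inter> T"
    using assms by (auto simp: relopen_def region_def)
  have "closure (interior U) = closure U" using U by (rule convex_closure_interior)
  then have "S \<subseteq> closure (interior U) \<inter> T" using T closure_subset by blast
  also have "\<dots> \<subseteq> closure (interior U \<inter> T)" using T by (metis Int_commute open_Int_closure_subset)
  also have "interior U \<inter> T = interior S" using T by (simp add: interior_open)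
  finally show ?thesis .
qed

text \<open>Both sides are continuous and agree on the interior, which is dense.\<close>

lemma fd_fd_symmetric:
  fixes f :: "'a::euclidean_space \<Rightarrow> 'b::banach"
  assumes S: "relopen S" and f: "smooth_on S f" and x: "x \<in> S"
  shows "fd S (\<lambda>y. fd S f y a) x b = fd S (\<lambda>y. fd S f y b) x a"
proof -
  define T where "T = interior S"
  have T: "open T" "openin (top_of_set S) T" "T \<subseteq> S"
    by (auto simp: T_def interior_subset open_subset)
  define d where "d = (\<lambda>x. fd S (\<lambda>y. fd S f y a) x b - fd S (\<lambda>y. fd S f y b) x a)"
  have fT: "smooth_on T f" using f S T by (auto intro: smooth_on_subset relopen_open)
  have two: "fd S (\<lambda>y. fd S f y a) y b = fd T (\<lambda>y. fd T f y a) y b" if "y \<in> T" for y a b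
  proof -
    have "fd S (\<lambda>y. fd S f y a) y = fd T (\<lambda>y. fd S f y a) y" using fd_openin[OF T(2) that] by metis
    also have "\<dots> = fd T (\<lambda>y. fd T f y a) y"
      by (rule fd_cong[OF _ that]) (simp only: fd_openin[OF T(2)])
    finally show ?thesis by simp
  qed
  have "d y = 0" if "y \<in> T" for y
    using two[OF that, of a b] two[OF that, of b a] fd_fd_symmetric_open[OF T(1) fT that] by (simp add: d_def)
  moreover have "continuous_on S d"
    unfolding d_def by (intro continuous_intros smooth_on_continuous smooth_on_fd f)
  then have "closedin (top_of_set S) {y \<in> S. d y = 0}"
    by (rule continuous_closedin_preimage_constant)
  then obtain C where C: "closed C" "{y \<in> S. d y = 0} = S \<inter> C" by (auto simp: closedin_closed)
  ultimately have "closure T \<subseteq> C" using T by (intro closure_minimal) auto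
  then have "x \<in> C" using relopen_subset_closure_interior[OF S] x by (auto simp: T_def)
  then show ?thesis using C x by (auto simp: d_def)
qed

section \<open>Differentiation under the integral sign\<close>

lemma region_Times:
  assumes "region U" "region V" shows "region (U \<times> V)"
  using assms unfolding region_def by (auto simp: convex_Times interior_Times)

lemma region_Icc: "region {0..1::real}"
  unfolding region_def by simp

lemma region_Times_Icc: "region U \<Longrightarrow> region (U \<times> {0..1::real})"
  by (intro region_Times region_Icc)

text \<open>The Leibniz rule wants the total derivative as a continuous family of bounded linear maps, while
  smoothness controls it one direction at a time; in finite dimension the two are the same.\<close>

lemma integral_has_derivative:
  fixes g :: "'u::euclidean_space \<times> real \<Rightarrow> 'b::banach"
  assumes U: "region U" and g: "smooth_on (U \<times> {0..1}) g" and p: "p \<in> U"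
  shows "((\<lambda>p. integral {0..1} (\<lambda>t. g (p, t))) has_derivative
     (\<lambda>a. integral {0..1} (\<lambda>t. fd (U \<times> {0..1}) g (p, t) (a, 0)))) (at p within U)"
proof -
  let ?S = "U \<times> {0..1::real}"
  define D where "D = (\<lambda>p t. Blinfun (\<lambda>a. fd ?S g (p, t) (a, 0)))"
  have line: "((\<lambda>p. g (p, t)) has_derivative (\<lambda>a. fd ?S g (p, t) (a, 0))) (at p within U)"
    if "p \<in> U" "t \<in> {0..1}" for p t
  proof -
    have "(g has_derivative fd ?S g (p, t)) (at (p, t) within ?S)"
      using that by (intro smooth_on_has_derivative[OF g]) auto
    then have g': "(g has_derivative fd ?S g (p, t)) (at (p, t) within (\<lambda>p. (p, t)) ` U)"
      using that by (auto intro: has_derivative_subset)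
    have "((\<lambda>p. (p, t)) has_derivative (\<lambda>a. (a, 0))) (at p within U)"
      by (auto intro!: derivative_eq_intros)
    from has_derivative_in_compose[OF this g'] show ?thesis .
  qed
  have D: "blinfun_apply (D p t) = (\<lambda>a. fd ?S g (p, t) (a, 0))" if "p \<in> U" "t \<in> {0..1}" for p t
    unfolding D_def using has_derivative_bounded_linear[OF line[OF that]]
    by (rule bounded_linear_Blinfun_apply)
  have contD: "continuous_on ?S (\<lambda>(p, t). D p t)"
    unfolding case_prod_unfold
  proof (rule continuous_on_blinfun_componentwise)
    fix i :: 'u
    have "continuous_on ?S (\<lambda>q. fd ?S g q (i, 0))"
      by (intro smooth_on_continuous smooth_on_fd g)
    then show "continuous_on ?S (\<lambda>q. blinfun_apply (D (fst q) (snd q)) i)"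
      by (rule continuous_on_eq) (auto simp: D)
  qed
  have slice: "continuous_on {0..1} (\<lambda>t. k (p, t))" if "continuous_on ?S k" "p \<in> U"
    for k :: "'u \<times> real \<Rightarrow> 'c::topological_space" and p
    using that(2) by (intro continuous_on_compose2[OF that(1)]) (auto intro!: continuous_intros)
  have "((\<lambda>p. integral (cbox 0 1) (\<lambda>t. g (p, t))) has_derivative
      blinfun_apply (integral (cbox 0 1) (D p))) (at p within U)"
  proof (rule leibniz_rule)
    show "((\<lambda>p. g (p, t)) has_derivative blinfun_apply (D p t)) (at p within U)"
      if "p \<in> U" "t \<in> cbox 0 1" for p t using line D that by simp
    show "(\<lambda>t. g (p, t)) integrable_on cbox 0 1" if "p \<in> U" for p
      using slice[OF smooth_on_continuous[OF g] that] by (intro integrable_continuous) simp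
    show "continuous_on (U \<times> cbox 0 1) (\<lambda>(p, t). D p t)" using contD by simp
  qed (use U p in \<open>auto simp: region_def\<close>)
  moreover have "blinfun_apply (integral {0..1} (D p)) a = integral {0..1} (\<lambda>t. fd ?S g (p, t) (a, 0))" for a
  proof -
    have "continuous_on {0..1} (D p)" using slice[OF contD p] by simp
    then have int: "D p integrable_on {0..1}" by (rule integrable_continuous_real)
    have "blinfun_apply (integral {0..1} (D p)) a = integral {0..1} ((\<lambda>L. blinfun_apply L a) \<circ> D p)"
      using integral_linear[OF int blinfun.bounded_linear_left] by metis
    also have "\<dots> = integral {0..1} (\<lambda>t. fd ?S g (p, t) (a, 0))"
      using D[OF p] by (intro integral_cong) auto
    finally show ?thesis .
  qed
  then have "blinfun_apply (integral (cbox 0 1) (D p)) = (\<lambda>a. integral {0..1} (\<lambda>t. fd ?S g (p, t) (a, 0)))"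
    by auto
  ultimately show ?thesis by simp
qed

lemma smooth_on_integral:
  fixes g :: "'u::euclidean_space \<times> real \<Rightarrow> 'b::banach"
  assumes U: "region U" and "smooth_on (U \<times> {0..1}) g"
  shows "smooth_on U (\<lambda>p. integral {0..1} (\<lambda>t. g (p, t)))"
  unfolding smooth_on_def
proof
  fix k show "Ck_on k U (\<lambda>p. integral {0..1} (\<lambda>t. g (p, t)))"
    using assms(2)
  proof (induction k arbitrary: g)
    case 0
    then show ?case using integral_has_derivative[OF U]
      by (auto intro!: has_derivative_continuous_on)
  next
    case (Suc k)
    show ?case
      using Suc.IH[OF smooth_on_fd[OF Suc.prems]]
      by (intro Ck_on_SucI[OF relopen_region[OF U] integral_has_derivative[OF U Suc.prems]])
  qed
qed

lemma integral_lincomb: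
  fixes h k l :: "real \<Rightarrow> real"
  assumes "continuous_on {0..1} k" "continuous_on {0..1} l"
    and "\<And>t. t \<in> {0..1} \<Longrightarrow> h t = a * k t + b * l t"
  shows "integral {0..1} h = a * integral {0..1} k + b * integral {0..1} l"
proof -
  have "integral {0..1} h = integral {0..1} (\<lambda>t. a * k t + b * l t)"
    using assms(3) by (rule integral_cong)
  also have "\<dots> = integral {0..1} (\<lambda>t. a * k t) + integral {0..1} (\<lambda>t. b * l t)"
    by (intro integral_add integrable_continuous_real continuous_intros assms)
  finally show ?thesis by simp
qed

text \<open>Turns the double integral that defines \<open>\<lambda>\<close> into an integral over a fixed interval with a smooth
  weight, which can be differentiated under the integral sign.\<close>

lemma iterated_integral:
  fixes g :: "real \<Rightarrow> real"
  assumes "continuous_on {0..1} g"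
  shows "integral {0..1} (\<lambda>t. integral {0..t} g) = integral {0..1} (\<lambda>t. (1 - t) * g t)"
proof -
  let ?G = "\<lambda>t. integral {0..t} g"
  have G: "(?G has_vector_derivative g t) (at t within {0..1})" if "t \<in> {0..1}" for t
    using integral_has_vector_derivative[OF assms that] .
  have contG: "continuous_on {0..1} ?G"
    by (rule indefinite_integral_continuous_1[OF integrable_continuous_real[OF assms]])
  have "((\<lambda>t. (1 - t) * g t - ?G t) has_integral ((1 - 1) * ?G 1 - (1 - 0) * ?G 0)) {0..1}"
  proof (rule fundamental_theorem_of_calculus)
    fix t :: real assume t: "t \<in> {0..1}"
    have "((\<lambda>t. 1 - t) has_vector_derivative - 1) (at t within {0..1})"
      by (auto intro!: derivative_eq_intros)
    from bounded_bilinear.has_vector_derivative[OF bounded_bilinear_mult this G[OF t]]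
    show "((\<lambda>t. (1 - t) * ?G t) has_vector_derivative (1 - t) * g t - ?G t) (at t within {0..1})" by simp
  qed simp
  then have "integral {0..1} (\<lambda>t. (1 - t) * g t - ?G t) = 0" by (simp add: integral_unique)
  moreover have "integral {0..1} (\<lambda>t. (1 - t) * g t - ?G t) =
      integral {0..1} (\<lambda>t. (1 - t) * g t) - integral {0..1} ?G"
    using contG by (intro integral_diff integrable_continuous_real continuous_intros assms)
  ultimately show ?thesis by simp
qed

section \<open>Exterior derivatives in coordinates\<close>

text \<open>The exterior derivative of a 1-form commutes with pullback: the second derivatives of \<open>\<phi>\<close> enter
  symmetrically and cancel.\<close>

lemma differential_pullback_coords:
  fixes \<phi> :: "'a::euclidean_space \<Rightarrow> 'b::euclidean_space" and \<theta> :: "'b \<Rightarrow> 'b \<Rightarrow> real"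
  assumes S: "relopen S" and T: "relopen T" and \<phi>: "smooth_on S \<phi>" "\<phi> ` S \<subseteq> T"
    and \<theta>: "\<And>a. smooth_on T (\<theta> a)" "\<And>y. y \<in> T \<Longrightarrow> linear (\<lambda>a. \<theta> a y)" and x: "x \<in> S"
  shows "fd S (\<lambda>y. \<theta> (fd S \<phi> y b) (\<phi> y)) x a - fd S (\<lambda>y. \<theta> (fd S \<phi> y a) (\<phi> y)) x b =
    fd T (\<theta> (fd S \<phi> x b)) (\<phi> x) (fd S \<phi> x a) - fd T (\<theta> (fd S \<phi> x a)) (\<phi> x) (fd S \<phi> x b)"
proof -
  have expand: "\<theta> w y = (\<Sum>i\<in>Basis. (w \<bullet> i) * \<theta> i y)" if "y \<in> T" for w y
  proof -
    interpret linear "\<lambda>a. \<theta> a y" using \<theta>(2) that .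
    have "\<theta> (\<Sum>i\<in>Basis. (w \<bullet> i) *\<^sub>R i) y = (\<Sum>i\<in>Basis. (w \<bullet> i) * \<theta> i y)"
      by (simp add: sum scale)
    then show ?thesis by (simp add: euclidean_representation)
  qed
  have \<phi>x: "\<phi> x \<in> T" using \<phi>(2) x by auto
  have d\<theta>: "\<theta> i differentiable (at y within T)" if "y \<in> T" for i y
    using \<theta>(1) that by (rule smooth_on_differentiable)
  have d\<phi>: "\<phi> differentiable (at x within S)" using \<phi>(1) x by (rule smooth_on_differentiable)
  have comp: "fd S (\<lambda>y. \<theta> i (\<phi> y)) x a = fd T (\<theta> i) (\<phi> x) (fd S \<phi> x a)" for i a
    using S \<phi>(2) x d\<phi> d\<theta>[OF \<phi>x] by (rule fd_compose)
  have sc: "smooth_on S (\<lambda>y. \<theta> i (\<phi> y))" for i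
    using S T \<phi>(2,1) \<theta>(1) by (rule smooth_on_compose)
  have sd: "smooth_on S (\<lambda>y. fd S \<phi> y b \<bullet> i)" for b i
    by (intro smooth_on_inner S smooth_on_fd \<phi>)
  have dd: "fd S (\<lambda>y. fd S \<phi> y b \<bullet> i) x a = fd S (\<lambda>y. fd S \<phi> y b) x a \<bullet> i" for a b i
    by (rule fd_bounded_linear[OF bounded_linear_inner_left S x])
      (rule smooth_on_differentiable[OF smooth_on_fd[OF \<phi>(1)] x])
  have deriv: "fd S (\<lambda>y. \<theta> (fd S \<phi> y b) (\<phi> y)) x a =
      (\<Sum>i\<in>Basis. (fd S \<phi> x b \<bullet> i) * fd T (\<theta> i) (\<phi> x) (fd S \<phi> x a)) +
      (\<Sum>i\<in>Basis. (fd S (\<lambda>y. fd S \<phi> y b) x a \<bullet> i) * \<theta> i (\<phi> x))" for a b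
  proof -
    have "fd S (\<lambda>y. \<theta> (fd S \<phi> y b) (\<phi> y)) x a =
        fd S (\<lambda>y. \<Sum>i\<in>Basis. (fd S \<phi> y b \<bullet> i) * \<theta> i (\<phi> y)) x a"
      using \<phi>(2) by (subst fd_cong[OF expand x]) auto
    also have "\<dots> = (\<Sum>i\<in>Basis. fd S (\<lambda>y. (fd S \<phi> y b \<bullet> i) * \<theta> i (\<phi> y)) x a)"
      by (intro fd_sum S x smooth_on_differentiable smooth_on_mult sc sd)
    also have "\<dots> = (\<Sum>i\<in>Basis. (fd S \<phi> x b \<bullet> i) * fd T (\<theta> i) (\<phi> x) (fd S \<phi> x a) +
        (fd S (\<lambda>y. fd S \<phi> y b) x a \<bullet> i) * \<theta> i (\<phi> x))"
      using fd_bilinear[OF bounded_bilinear_mult S x sd[THEN smooth_on_differentiable, OF x]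
        sc[THEN smooth_on_differentiable, OF x]] by (simp add: comp dd)
    finally show ?thesis by (simp add: sum.distrib)
  qed
  have lin: "fd T (\<theta> w) (\<phi> x) v = (\<Sum>i\<in>Basis. (w \<bullet> i) * fd T (\<theta> i) (\<phi> x) v)" for w v
  proof -
    have "fd T (\<theta> w) (\<phi> x) v = fd T (\<lambda>y. \<Sum>i\<in>Basis. (w \<bullet> i) * \<theta> i y) (\<phi> x) v"
      by (subst fd_cong[OF expand \<phi>x]) auto
    also have "\<dots> = (\<Sum>i\<in>Basis. fd T (\<lambda>y. (w \<bullet> i) * \<theta> i y) (\<phi> x) v)"
      by (intro fd_sum T \<phi>x smooth_on_differentiable smooth_on_mult \<theta> smooth_on_const)
    also have "\<dots> = (\<Sum>i\<in>Basis. (w \<bullet> i) * fd T (\<theta> i) (\<phi> x) v)"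
      using fd_bounded_linear[OF bounded_linear_mult_right T \<phi>x d\<theta>[OF \<phi>x]] by simp
    finally show ?thesis .
  qed
  show ?thesis
    unfolding deriv lin[of "fd S \<phi> x b"] lin[of "fd S \<phi> x a"] fd_fd_symmetric[OF S \<phi>(1) x, of b a]
    by simp
qed

text \<open>The 1-form \<open>Im (cnj u du)\<close> by which connection forms in two unitary frames differ is closed. As
  \<open>|u| = 1\<close>, we have \<open>du = \<i> \<rho> u\<close> with a real 1-form \<open>\<rho>\<close>, so that the product
  \<open>cnj (du(a)) du(b) = \<rho>(a) \<rho>(b)\<close> of first derivatives is real.\<close>

lemma log_derivative_closed_coords:
  fixes u :: "'a::euclidean_space \<Rightarrow> complex"
  assumes S: "relopen S" and u: "smooth_on S u" and unit: "\<And>y. y \<in> S \<Longrightarrow> cmod (u y) = 1"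
    and x: "x \<in> S"
  shows "fd S (\<lambda>y. Im (cnj (u y) * fd S u y b)) x a = fd S (\<lambda>y. Im (cnj (u y) * fd S u y a)) x b"
proof -
  have du: "u differentiable (at x within S)" using u x by (rule smooth_on_differentiable)
  have scnj: "smooth_on S (\<lambda>y. cnj (u y))"
    by (rule smooth_on_bounded_linear[OF bounded_linear_cnj S u])
  have dcnj: "fd S (\<lambda>y. cnj (u y)) x a = cnj (fd S u x a)" for a
    by (rule fd_bounded_linear[OF bounded_linear_cnj S x du])
  note d = smooth_on_differentiable[OF _ x]
  have deriv: "fd S (\<lambda>y. Im (cnj (u y) * fd S u y b)) x a =
      Im (cnj (u x) * fd S (\<lambda>y. fd S u y b) x a + cnj (fd S u x a) * fd S u x b)" for a b
  proof -
    have "fd S (\<lambda>y. Im (cnj (u y) * fd S u y b)) x a = Im (fd S (\<lambda>y. cnj (u y) * fd S u y b) x a)"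
      by (intro fd_bounded_linear bounded_linear_Im S x d smooth_on_mult scnj smooth_on_fd u)
    also have "fd S (\<lambda>y. cnj (u y) * fd S u y b) x a =
        cnj (u x) * fd S (\<lambda>y. fd S u y b) x a + fd S (\<lambda>y. cnj (u y)) x a * fd S u x b"
      by (intro fd_bilinear bounded_bilinear_mult S x d scnj smooth_on_fd u)
    finally show ?thesis by (simp add: dcnj)
  qed
  \<comment> \<open>because \<open>cnj u * u\<close> is constant\<close>
  have im: "Re (cnj (u x) * fd S u x a) = 0" for a
  proof -
    have "cnj (u y) * u y = 1" if "y \<in> S" for y
      using complex_norm_square[of "u y"] unit[OF that] by (simp add: mult.commute)
    then have "fd S (\<lambda>y. cnj (u y) * u y) x a = fd S (\<lambda>_. 1) x a"
      by (subst fd_cong[OF _ x]) auto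
    then have "cnj (u x) * fd S u x a + cnj (fd S u x a) * u x = 0"
      using fd_bilinear[OF bounded_bilinear_mult S x d[OF scnj] du, of a] fd_const[OF S x]
      by (simp add: dcnj)
    then have "Re (cnj (u x) * fd S u x a + cnj (fd S u x a) * u x) = 0" by simp
    then show ?thesis by (simp add: algebra_simps)
  qed
  have "Im (cnj (fd S u x a) * fd S u x b) = 0" for a b
  proof -
    have "u x * cnj (u x) = 1"
      using complex_norm_square[of "u x"] unit[OF x] by simp
    moreover have "cnj (cnj (u x) * fd S u x a) * (cnj (u x) * fd S u x b) =
        (u x * cnj (u x)) * (cnj (fd S u x a) * fd S u x b)"
      by (simp only: complex_cnj_mult complex_cnj_cnj mult_ac)
    ultimately have "cnj (fd S u x a) * fd S u x b = cnj (cnj (u x) * fd S u x a) * (cnj (u x) * fd S u x b)"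
      by simp
    also have "Im \<dots> = 0"
    proof -
      have "Im (cnj P * Q) = 0" if "Re P = 0" "Re Q = 0" for P Q
        using that by simp
      then show ?thesis using im by blast
    qed
    finally show ?thesis .
  qed
  then show ?thesis
    unfolding deriv fd_fd_symmetric[OF S u x, of b a] by simp
qed

text \<open>\<open>d(d\<theta>) = 0\<close>, with a constant factor as it occurs for \<open>\<omega> = \<hbar> dA\<close>.\<close>

lemma exact_closed_coords:
  fixes \<theta> :: "'a::euclidean_space \<Rightarrow> 'a \<Rightarrow> real"
  assumes S: "relopen S" and \<theta>: "\<And>a. smooth_on S (\<theta> a)" and x: "x \<in> S"
    and \<Omega>: "\<And>a b y. y \<in> S \<Longrightarrow> \<Omega> a b y = k * (fd S (\<theta> b) y a - fd S (\<theta> a) y b)"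
  shows "fd S (\<Omega> b c) x a - fd S (\<Omega> a c) x b + fd S (\<Omega> a b) x c = 0"
proof -
  have d: "(\<lambda>y. fd S (\<theta> b) y a) differentiable (at x within S)" for a b
    by (rule smooth_on_differentiable[OF smooth_on_fd[OF \<theta>] x])
  have deriv: "fd S (\<Omega> a b) x c =
      k * (fd S (\<lambda>y. fd S (\<theta> b) y a) x c - fd S (\<lambda>y. fd S (\<theta> a) y b) x c)" for a b c
  proof -
    have "((\<lambda>y. k * (fd S (\<theta> b) y a - fd S (\<theta> a) y b)) has_derivative
        (\<lambda>c. k * (fd S (\<lambda>y. fd S (\<theta> b) y a) x c - fd S (\<lambda>y. fd S (\<theta> a) y b) x c))) (at x within S)"
      by (intro has_derivative_mult_right has_derivative_diff has_derivative_fd d)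
    from fd_eq[OF S x this] show ?thesis by (subst fd_cong[OF \<Omega> x]) auto
  qed
  show ?thesis
    unfolding deriv fd_fd_symmetric[OF S \<theta> x, of b a c] fd_fd_symmetric[OF S \<theta> x, of a c b]
      fd_fd_symmetric[OF S \<theta> x, of c b a]
    by (simp add: algebra_simps)
qed

text \<open>The key computation. Closedness on the vectors \<open>\<partial>\<^sub>t\<close>, \<open>a\<close>, \<open>b\<close> replaces the two derivatives along \<open>U\<close>
  by the derivative of \<open>\<Omega>(a, b)\<close> in \<open>t\<close>; the weight \<open>1 - t\<close> has derivative \<open>-1\<close> and vanishes at
  \<open>t = 1\<close>, so integration by parts leaves the integral of \<open>\<Omega>(a, b)\<close> and its value at \<open>t = 0\<close>.\<close>

lemma fibre_integral_of_closed:
  fixes \<Omega> :: "'u::euclidean_space \<times> real \<Rightarrow> 'u \<times> real \<Rightarrow> 'u \<times> real \<Rightarrow> real"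
  assumes U: "region U" and \<Omega>: "\<And>a b. smooth_on (U \<times> {0..1}) (\<Omega> a b)"
    and closed: "\<And>a b c q. q \<in> U \<times> {0..1} \<Longrightarrow>
      fd (U \<times> {0..1}) (\<Omega> b c) q a - fd (U \<times> {0..1}) (\<Omega> a c) q b + fd (U \<times> {0..1}) (\<Omega> a b) q c = 0"
    and p: "p \<in> U"
  defines "\<beta> \<equiv> \<lambda>a p. integral {0..1} (\<lambda>t. (1 - t) * \<Omega> (0, 1) (a, 0) (p, t))"
  shows "fd U (\<beta> b) p a - fd U (\<beta> a) p b =
    integral {0..1} (\<lambda>t. \<Omega> (a, 0) (b, 0) (p, t)) - \<Omega> (a, 0) (b, 0) (p, 0)"
proof -
  let ?S = "U \<times> {0..1::real}"
  have S: "relopen ?S" by (intro relopen_region region_Times_Icc U)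
  have ssnd: "smooth_on ?S (\<lambda>q. 1 - snd q)"
    using smooth_on_add[OF S smooth_on_const[OF S, of 1] smooth_on_bounded_linear[OF bounded_linear_minus[OF bounded_linear_snd] S smooth_on_id[OF S]]]
    by simp
  have sm: "smooth_on ?S (\<lambda>q. (1 - snd q) * \<Omega> (0, 1) (a, 0) q)" for a
    by (intro smooth_on_mult S ssnd \<Omega>)
  have slice: "continuous_on {0..1} (\<lambda>t. k (p, t))" if "continuous_on ?S k" for k :: "'u \<times> real \<Rightarrow> real"
    using p by (intro continuous_on_compose2[OF that]) (auto intro!: continuous_intros)
  have d\<Omega>: "\<Omega> a b differentiable (at (p, t) within ?S)" if "t \<in> {0..1}" for a b t
    using smooth_on_differentiable[OF \<Omega>] p that by auto
  have deriv: "fd U (\<beta> b) p a = integral {0..1} (\<lambda>t. (1 - t) * fd ?S (\<Omega> (0, 1) (b, 0)) (p, t) (a, 0))" for a b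
  proof -
    have "fd U (\<beta> b) p a =
        integral {0..1} (\<lambda>t. fd ?S (\<lambda>q. (1 - snd q) * \<Omega> (0, 1) (b, 0) q) (p, t) (a, 0))"
      using fd_eq[OF relopen_region[OF U] p integral_has_derivative[OF U sm p, of b]]
      by (simp add: \<beta>_def)
    also have "\<dots> = integral {0..1} (\<lambda>t. (1 - t) * fd ?S (\<Omega> (0, 1) (b, 0)) (p, t) (a, 0))"
    proof (rule integral_cong)
      fix t :: real assume t: "t \<in> {0..1}"
      then have pt: "(p, t) \<in> ?S" using p by simp
      have "((\<lambda>q. 1 - snd q) has_derivative (\<lambda>h. - snd h)) (at (p, t) within ?S)"
        by (auto intro!: derivative_eq_intros)
      then have "fd ?S (\<lambda>q. 1 - snd q) (p, t) = (\<lambda>h. - snd h)"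
        by (rule fd_eq[OF S pt])
      then have "fd ?S (\<lambda>q. 1 - snd q) (p, t) (a, 0) = 0" by simp
      then show "fd ?S (\<lambda>q. (1 - snd q) * \<Omega> (0, 1) (b, 0) q) (p, t) (a, 0) =
          (1 - t) * fd ?S (\<Omega> (0, 1) (b, 0)) (p, t) (a, 0)"
        using fd_bilinear[OF bounded_bilinear_mult S pt smooth_on_differentiable[OF ssnd pt] d\<Omega>[OF t]]
        by simp
    qed
    finally show ?thesis .
  qed
  define w where "w = (\<lambda>t. \<Omega> (a, 0) (b, 0) (p, t))"
  define w' where "w' = (\<lambda>t. fd ?S (\<Omega> (a, 0) (b, 0)) (p, t) (0, 1))"
  have contw: "continuous_on {0..1} w"
    unfolding w_def by (intro slice smooth_on_continuous \<Omega>)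
  have w: "(w has_vector_derivative w' t) (at t within {0..1})" if t: "t \<in> {0..1}" for t
  proof -
    have 1: "(\<Omega> (a, 0) (b, 0) has_derivative fd ?S (\<Omega> (a, 0) (b, 0)) (p, t)) (at (p, t) within (\<lambda>t. (p, t)) ` {0..1})"
      by (rule has_derivative_subset[OF has_derivative_fd[OF d\<Omega>[OF t]]]) (use p in auto)
    have 2: "((\<lambda>t. (p, t)) has_derivative (\<lambda>h. (0, h))) (at t within {0..1})"
      by (auto intro!: derivative_eq_intros)
    have "(w has_derivative (\<lambda>h. fd ?S (\<Omega> (a, 0) (b, 0)) (p, t) (0, h))) (at t within {0..1})"
      unfolding w_def by (rule has_derivative_in_compose[OF 2 1])
    moreover have "fd ?S (\<Omega> (a, 0) (b, 0)) (p, t) (0, h) = h *\<^sub>R w' t" for h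
      using fd_linear[OF d\<Omega>[OF t], of "(a, 0)" "(b, 0)" h "(0, 1)" 0 0] by (simp add: w'_def)
    ultimately show ?thesis by (simp add: has_vector_derivative_def)
  qed
  have "((\<lambda>t. (1 - t) * w' t - w t) has_integral ((1 - 1) * w 1 - (1 - 0) * w 0)) {0..1}"
  proof (rule fundamental_theorem_of_calculus)
    fix t :: real assume t: "t \<in> {0..1}"
    have "((\<lambda>t. 1 - t) has_vector_derivative - 1) (at t within {0..1})"
      by (auto intro!: derivative_eq_intros)
    from bounded_bilinear.has_vector_derivative[OF bounded_bilinear_mult this w[OF t]]
    show "((\<lambda>t. (1 - t) * w t) has_vector_derivative (1 - t) * w' t - w t) (at t within {0..1})" by simp
  qed simp
  moreover have "(w has_integral integral {0..1} w) {0..1}"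
    using contw integrable_continuous_real integrable_integral by blast
  ultimately have "((\<lambda>t. (1 - t) * w' t - w t + w t) has_integral ((1 - 1) * w 1 - (1 - 0) * w 0 + integral {0..1} w)) {0..1}"
    by (rule has_integral_add)
  then have parts: "integral {0..1} (\<lambda>t. (1 - t) * w' t) = integral {0..1} w - w 0"
    by (simp add: integral_unique)
  have "fd U (\<beta> b) p a - fd U (\<beta> a) p b = integral {0..1} (\<lambda>t.
      (1 - t) * fd ?S (\<Omega> (0, 1) (b, 0)) (p, t) (a, 0) - (1 - t) * fd ?S (\<Omega> (0, 1) (a, 0)) (p, t) (b, 0))"
    unfolding deriv
    by (intro integral_diff[symmetric] integrable_continuous_real continuous_intros slice smooth_on_continuous smooth_on_fd \<Omega>)
  also have "\<dots> = integral {0..1} (\<lambda>t. (1 - t) * w' t)"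
  proof (rule integral_cong)
    fix t :: real assume t: "t \<in> {0..1}"
    have "w' t = fd ?S (\<Omega> (0, 1) (b, 0)) (p, t) (a, 0) - fd ?S (\<Omega> (0, 1) (a, 0)) (p, t) (b, 0)"
      using closed[where q = "(p, t)" and a = "(0, 1)" and b = "(a, 0)" and c = "(b, 0)"] p t
      by (simp add: w'_def)
    then show "(1 - t) * fd ?S (\<Omega> (0, 1) (b, 0)) (p, t) (a, 0) - (1 - t) * fd ?S (\<Omega> (0, 1) (a, 0)) (p, t) (b, 0) =
        (1 - t) * w' t" by (simp add: right_diff_distrib)
  qed
  finally show ?thesis unfolding parts by (simp add: w_def)
qed

section \<open>Charted spaces\<close>

text \<open>What manifolds and regions have in common. Bundles and forms are pulled back along maps from a
  region to a manifold as well as between regions, and one notion of space serves both.\<close>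

definition charted :: "('m, 'e::euclidean_space) smooth_space \<Rightarrow> bool" where
  "charted X \<longleftrightarrow>
     (\<forall>c\<in>atlas X. openin (mtop X) (fst c) \<and> relopen (cimg c) \<and>
        homeomorphic_map (subtopology (mtop X) (fst c)) (top_of_set (cimg c)) (snd c)) \<and>
     (\<Union>c\<in>atlas X. fst c) = topspace (mtop X) \<and>
     (\<forall>c\<in>atlas X. \<forall>d\<in>atlas X. smooth_on (snd c ` (fst c \<inter> fst d)) (snd d \<circ> cinv c))"

lemma charted_manifold: "smooth_manifold M \<Longrightarrow> charted M"
  unfolding smooth_manifold_def charted_def by (auto intro: relopen_open)

lemma cinv_std: "y \<in> U \<Longrightarrow> cinv (U, \<lambda>x. x) y = y"
  using inv_into_f_f[of "\<lambda>x. x" U y] by (simp add: cinv_def)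

lemma cimg_std [simp]: "cimg (U, \<lambda>x. x) = U"
  by (simp add: cimg_def)

lemma std_simps [simp]: "mtop (std U) = top_of_set U" "atlas (std U) = {(U, \<lambda>x. x)}"
  by (simp_all add: std_def)

lemma charted_std:
  assumes "region U" shows "charted (std U)"
proof -
  have "relopen U" using assms by (rule relopen_region)
  moreover have "homeomorphic_map (top_of_set U) (top_of_set U) (\<lambda>x. x)"
    using homeomorphic_map_id[of "top_of_set U" "top_of_set U"] by (simp add: id_def)
  moreover have "smooth_on U ((\<lambda>x. x) \<circ> cinv (U, \<lambda>x. x))"
    by (subst smooth_on_cong[where g = "\<lambda>x. x"])
      (auto simp: cinv_std intro!: smooth_on_id relopen_region assms)
  ultimately show ?thesis by (simp add: charted_def subtopology_subtopology)
qed

lemma chart_props: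
  assumes "charted X" "c \<in> atlas X"
  shows chart_openin: "openin (mtop X) (fst c)"
    and chart_relopen: "relopen (cimg c)"
    and chart_homeo: "homeomorphic_map (subtopology (mtop X) (fst c)) (top_of_set (cimg c)) (snd c)"
  using assms by (auto simp: charted_def)

lemma chart_subset: "charted X \<Longrightarrow> c \<in> atlas X \<Longrightarrow> fst c \<subseteq> topspace (mtop X)"
  by (meson chart_openin openin_subset)

lemma cimgI: "x \<in> fst c \<Longrightarrow> snd c x \<in> cimg c"
  by (simp add: cimg_def)

lemma cinv_left:
  assumes "charted X" "c \<in> atlas X" "x \<in> fst c" shows "cinv c (snd c x) = x"
proof -
  have "inj_on (snd c) (topspace (subtopology (mtop X) (fst c)))"
    using homeomorphic_imp_injective_map[OF chart_homeo[OF assms(1,2)]] .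
  then have "inj_on (snd c) (fst c)"
    using chart_subset[OF assms(1,2)] by (simp add: Int_absorb1)
  then show ?thesis using assms(3) by (simp add: cinv_def)
qed

lemma cinv_right: "y \<in> cimg c \<Longrightarrow> snd c (cinv c y) = y"
  unfolding cinv_def cimg_def by (rule f_inv_into_f)

lemma chart_image_openin:
  assumes "charted X" "c \<in> atlas X" "openin (mtop X) W"
  shows "openin (top_of_set (cimg c)) (snd c ` (fst c \<inter> W))"
proof -
  have "openin (subtopology (mtop X) (fst c)) (fst c \<inter> W)"
    using assms(3) by (metis openin_subtopology_Int2)
  moreover have "open_map (subtopology (mtop X) (fst c)) (top_of_set (cimg c)) (snd c)"
    using chart_homeo[OF assms(1,2)] homeomorphic_imp_open_map by blast
  ultimately show ?thesis by (simp add: open_map_def)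
qed

lemma chart_image_relopen:
  "charted X \<Longrightarrow> c \<in> atlas X \<Longrightarrow> openin (mtop X) W \<Longrightarrow> relopen (snd c ` (fst c \<inter> W))"
  using chart_image_openin relopen_openin chart_relopen by metis

lemma fd_chart_image:
  assumes "charted X" "c \<in> atlas X" "openin (mtop X) W" "x \<in> fst c" "x \<in> W"
  shows "at (snd c x) within (snd c ` (fst c \<inter> W)) = at (snd c x) within cimg c"
  using at_within_openin[OF chart_image_openin[OF assms(1-3)]] assms(4,5) by blast

lemma chart_exists:
  assumes "charted X" "x \<in> topspace (mtop X)"
  obtains c where "c \<in> atlas X" "x \<in> fst c"
  using assms unfolding charted_def by blast

lemma smooth_fun_cong:
  assumes "charted X" "\<And>x. x \<in> W \<Longrightarrow> f x = g x"
  shows "smooth_fun X W f \<longleftrightarrow> smooth_fun X W g"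
proof -
  have "smooth_on (snd c ` (fst c \<inter> W)) (f \<circ> cinv c) \<longleftrightarrow> smooth_on (snd c ` (fst c \<inter> W)) (g \<circ> cinv c)"
    if "c \<in> atlas X" for c
    using assms cinv_left[OF assms(1) that] by (intro smooth_on_cong) auto
  then show ?thesis by (auto simp: smooth_fun_def)
qed

lemma smooth_fun_subset:
  assumes "charted X" "openin (mtop X) W" "openin (mtop X) W'" "W' \<subseteq> W" "smooth_fun X W f"
  shows "smooth_fun X W' f"
  unfolding smooth_fun_def
proof
  fix c assume c: "c \<in> atlas X"
  show "smooth_on (snd c ` (fst c \<inter> W')) (f \<circ> cinv c)"
    by (rule smooth_on_subset[of _ "snd c ` (fst c \<inter> W)"])
      (use assms c in \<open>auto simp: smooth_fun_def intro: chart_image_relopen\<close>)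
qed

lemma smooth_fun_local:
  assumes X: "charted X" "openin (mtop X) W"
    and loc: "\<And>x. x \<in> W \<Longrightarrow> \<exists>W'. openin (mtop X) W' \<and> x \<in> W' \<and> W' \<subseteq> W \<and> smooth_fun X W' f"
  shows "smooth_fun X W f"
  unfolding smooth_fun_def
proof
  fix c assume c: "c \<in> atlas X"
  show "smooth_on (snd c ` (fst c \<inter> W)) (f \<circ> cinv c)"
  proof (rule smooth_on_local)
    fix y assume "y \<in> snd c ` (fst c \<inter> W)"
    then obtain x where x: "x \<in> fst c" "x \<in> W" "y = snd c x" by auto
    obtain W' where W': "openin (mtop X) W'" "x \<in> W'" "W' \<subseteq> W" "smooth_fun X W' f"
      using loc[OF x(2)] by blast
    have "openin (top_of_set (cimg c)) (snd c ` (fst c \<inter> W'))"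
      by (rule chart_image_openin[OF X(1) c W'(1)])
    then have "openin (top_of_set (snd c ` (fst c \<inter> W))) (snd c ` (fst c \<inter> W'))"
      by (rule openin_subset_trans) (use W' in \<open>auto simp: cimg_def\<close>)
    then show "\<exists>S'. openin (top_of_set (snd c ` (fst c \<inter> W))) S' \<and> y \<in> S' \<and> smooth_on S' (f \<circ> cinv c)"
      using W' x c by (intro exI[of _ "snd c ` (fst c \<inter> W')"]) (auto simp: smooth_fun_def)
  qed
qed

lemma smooth_fun_compose_chart:
  assumes X: "charted X" and Y: "charted Y" and c: "c \<in> atlas X" and d: "d \<in> atlas Y"
    and f: "smooth_map X Y f" and V: "openin (mtop Y) V"
    and g: "smooth_on (snd d ` (fst d \<inter> V)) (g \<circ> cinv d)"
  shows "smooth_on (snd c ` (fst c \<inter> {x \<in> topspace (mtop X). f x \<in> fst d \<inter> V})) (g \<circ> f \<circ> cinv c)"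
proof -
  have cont: "continuous_map (mtop X) (mtop Y) f" using f by (simp add: smooth_map_def)
  let ?P = "\<lambda>V. {x \<in> topspace (mtop X). f x \<in> V}"
  have open': "openin (mtop X) (?P (fst d \<inter> V))" "openin (mtop X) (?P (fst d))"
    by (intro openin_continuous_map_preimage[OF cont] openin_Int V chart_openin[OF Y d])+
  let ?S = "snd c ` (fst c \<inter> ?P (fst d \<inter> V))"
  have S: "relopen ?S" using chart_image_relopen[OF X c] open' by auto
  have "fst c \<inter> ?P (fst d) = {x \<in> fst c. f x \<in> fst d}" using chart_subset[OF X c] by auto
  then have "smooth_on (snd c ` (fst c \<inter> ?P (fst d))) (snd d \<circ> f \<circ> cinv c)"
    using f c d by (simp add: smooth_map_def)
  then have \<phi>: "smooth_on ?S (snd d \<circ> f \<circ> cinv c)"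
    by (rule smooth_on_subset[OF S _ _, rotated 2])
      (use chart_image_relopen[OF X c open'(2)] in auto)
  have "(snd d \<circ> f \<circ> cinv c) ` ?S \<subseteq> snd d ` (fst d \<inter> V)"
    using cinv_left[OF X c] by auto
  from smooth_on_compose[OF S chart_image_relopen[OF Y d V] this \<phi> g]
  show ?thesis
    by (rule smooth_on_cong[THEN iffD1, rotated]) (auto simp: cinv_left[OF X c] cinv_left[OF Y d])
qed

lemma smooth_fun_compose:
  assumes X: "charted X" and Y: "charted Y" and f: "smooth_map X Y f" and V: "openin (mtop Y) V"
    and g: "smooth_fun Y V g"
  shows "smooth_fun X {x \<in> topspace (mtop X). f x \<in> V} (\<lambda>x. g (f x))"
proof (rule smooth_fun_local[OF X])
  have cont: "continuous_map (mtop X) (mtop Y) f" using f by (simp add: smooth_map_def)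
  show op: "openin (mtop X) {x \<in> topspace (mtop X). f x \<in> V}"
    using openin_continuous_map_preimage[OF cont V] .
  fix x assume x: "x \<in> {x \<in> topspace (mtop X). f x \<in> V}"
  then obtain d where d: "d \<in> atlas Y" "f x \<in> fst d"
    using chart_exists[OF Y, of "f x"] V openin_subset by blast
  let ?W = "{x \<in> topspace (mtop X). f x \<in> fst d \<inter> V}"
  have "openin (mtop X) ?W"
    by (intro openin_continuous_map_preimage[OF cont] openin_Int V chart_openin[OF Y d(1)])
  moreover have "smooth_fun X ?W (\<lambda>x. g (f x))"
    unfolding smooth_fun_def
  proof
    fix c assume c: "c \<in> atlas X"
    have "smooth_on (snd d ` (fst d \<inter> V)) (g \<circ> cinv d)" using g d by (simp add: smooth_fun_def)
    from smooth_fun_compose_chart[OF X Y c d(1) f V this]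
    show "smooth_on (snd c ` (fst c \<inter> ?W)) ((\<lambda>x. g (f x)) \<circ> cinv c)" by (simp add: o_def)
  qed
  ultimately show "\<exists>W'. openin (mtop X) W' \<and> x \<in> W' \<and> W' \<subseteq> {x \<in> topspace (mtop X). f x \<in> V} \<and>
      smooth_fun X W' (\<lambda>x. g (f x))"
    using x d by (intro exI[of _ ?W]) auto
qed

lemma smooth_map_iff:
  assumes X: "charted X" and Y: "charted Y"
  shows "smooth_map X Y f \<longleftrightarrow> continuous_map (mtop X) (mtop Y) f \<and>
    (\<forall>d\<in>atlas Y. smooth_fun X {x \<in> topspace (mtop X). f x \<in> fst d} (\<lambda>x. snd d (f x)))"
proof -
  have "fst c \<inter> {x \<in> topspace (mtop X). f x \<in> fst d} = {x \<in> fst c. f x \<in> fst d}"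
    if "c \<in> atlas X" for c and d :: "('c, 'd) chart"
    using chart_subset[OF X that] by auto
  then show ?thesis unfolding smooth_map_def smooth_fun_def
    by (auto simp: o_def)
qed

lemma smooth_map_continuous: "smooth_map X Y f \<Longrightarrow> continuous_map (mtop X) (mtop Y) f"
  by (simp add: smooth_map_def)

lemma smooth_map_openin:
  "smooth_map X Y f \<Longrightarrow> openin (mtop Y) V \<Longrightarrow> openin (mtop X) {x \<in> topspace (mtop X). f x \<in> V}"
  by (rule openin_continuous_map_preimage[OF smooth_map_continuous])

lemma smooth_map_in: "smooth_map X Y f \<Longrightarrow> x \<in> topspace (mtop X) \<Longrightarrow> f x \<in> topspace (mtop Y)"
  using continuous_map_image_subset_topspace[OF smooth_map_continuous] by blast

lemma smooth_map_compose:
  assumes X: "charted X" and Y: "charted Y" and Z: "charted Z"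
    and f: "smooth_map X Y f" and g: "smooth_map Y Z g"
  shows "smooth_map X Z (g \<circ> f)"
  unfolding smooth_map_iff[OF X Z]
proof (intro conjI ballI)
  show "continuous_map (mtop X) (mtop Z) (g \<circ> f)"
    by (rule continuous_map_compose[OF smooth_map_continuous[OF f] smooth_map_continuous[OF g]])
  fix e assume e: "e \<in> atlas Z"
  have "smooth_fun Y {y \<in> topspace (mtop Y). g y \<in> fst e} (\<lambda>y. snd e (g y))"
    using g e smooth_map_iff[OF Y Z] by blast
  from smooth_fun_compose[OF X Y f smooth_map_openin[OF g chart_openin[OF Z e]] this]
  have "smooth_fun X {x \<in> topspace (mtop X). f x \<in> {y \<in> topspace (mtop Y). g y \<in> fst e}} (\<lambda>x. snd e (g (f x)))" .
  moreover have "{x \<in> topspace (mtop X). f x \<in> {y \<in> topspace (mtop Y). g y \<in> fst e}} =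
      {x \<in> topspace (mtop X). (g \<circ> f) x \<in> fst e}"
    using smooth_map_in[OF f] by auto
  ultimately show "smooth_fun X {x \<in> topspace (mtop X). (g \<circ> f) x \<in> fst e} (\<lambda>x. snd e ((g \<circ> f) x))"
    by simp
qed

lemma smooth_map_id: "charted X \<Longrightarrow> smooth_map X X (\<lambda>x. x)"
proof -
  assume X: "charted X"
  have "{x \<in> fst c. x \<in> fst d} = fst c \<inter> fst d" for c d :: "('a, 'b) chart" by auto
  then show ?thesis
    using X unfolding smooth_map_def charted_def by (auto simp: o_def)
qed

text \<open>Smoothness is required in all charts, but is independent of the chart.\<close>

lemma smooth_fun_in_chart:
  assumes X: "charted X" and c: "c \<in> atlas X" and W: "openin (mtop X) W" "W \<subseteq> fst c"
    and f: "smooth_on (snd c ` W) (f \<circ> cinv c)"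
  shows "smooth_fun X W f"
  unfolding smooth_fun_def
proof
  fix d assume d: "d \<in> atlas X"
  have "fst c \<inter> W = W" using W by auto
  then have "smooth_on (snd c ` (fst c \<inter> W)) (f \<circ> cinv c)" using f by simp
  from smooth_fun_compose_chart[OF X X d c smooth_map_id[OF X] W(1) this]
  have "smooth_on (snd d ` (fst d \<inter> {x \<in> topspace (mtop X). x \<in> fst c \<inter> W})) (f \<circ> cinv d)"
    by (simp add: o_def)
  moreover have "{x \<in> topspace (mtop X). x \<in> fst c \<inter> W} = W"
    using W openin_subset by blast
  ultimately show "smooth_on (snd d ` (fst d \<inter> W)) (f \<circ> cinv d)" by simp
qed

lemma smooth_fun_rep_differentiable:
  assumes X: "charted X" and c: "c \<in> atlas X" and W: "openin (mtop X) W"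
    and f: "smooth_fun X W f" and x: "x \<in> fst c" "x \<in> W"
  shows "(f \<circ> cinv c) differentiable (at (snd c x) within cimg c)"
proof -
  have "smooth_on (snd c ` (fst c \<inter> W)) (f \<circ> cinv c)" using f c by (simp add: smooth_fun_def)
  then have "(f \<circ> cinv c) differentiable (at (snd c x) within (snd c ` (fst c \<inter> W)))"
    by (rule smooth_on_differentiable) (use x in auto)
  then show ?thesis using fd_chart_image[OF X c W x] by simp
qed

lemma smooth_map_rep_differentiable:
  assumes X: "charted X" and Y: "charted Y" and c: "c \<in> atlas X" and d: "d \<in> atlas Y"
    and f: "smooth_map X Y f" and x: "x \<in> fst c" "f x \<in> fst d"
  shows "(snd d \<circ> f \<circ> cinv c) differentiable (at (snd c x) within cimg c)"
proof -
  have "smooth_fun X {x \<in> topspace (mtop X). f x \<in> fst d} (\<lambda>x. snd d (f x))"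
    using f d smooth_map_iff[OF X Y] by blast
  moreover have "x \<in> {x \<in> topspace (mtop X). f x \<in> fst d}" using x chart_subset[OF X c] by auto
  ultimately have "((\<lambda>x. snd d (f x)) \<circ> cinv c) differentiable (at (snd c x) within cimg c)"
    using smooth_fun_rep_differentiable[OF X c smooth_map_openin[OF f chart_openin[OF Y d]]] x by blast
  then show ?thesis by (simp add: o_def)
qed

text \<open>The chain rule through a chart of the intermediate space. For \<open>f\<close> the identity it becomes the
  change of charts, from which the chart independence of all differentials follows.\<close>

lemma rep_chain:
  assumes X: "charted X" and Y: "charted Y" and c: "c \<in> atlas X" and d: "d \<in> atlas Y"
    and f: "smooth_map X Y f" and x: "x \<in> fst c" "f x \<in> fst d"
    and g: "(g \<circ> cinv d) differentiable (at (snd d (f x)) within cimg d)"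
  shows "fd (cimg c) (g \<circ> f \<circ> cinv c) (snd c x) a =
    fd (cimg d) (g \<circ> cinv d) (snd d (f x)) (fd (cimg c) (snd d \<circ> f \<circ> cinv c) (snd c x) a)"
proof -
  let ?W = "{x \<in> topspace (mtop X). f x \<in> fst d}"
  let ?S = "snd c ` (fst c \<inter> ?W)"
  let ?\<phi> = "snd d \<circ> f \<circ> cinv c"
  have W: "openin (mtop X) ?W" using smooth_map_openin[OF f chart_openin[OF Y d]] .
  have xW: "x \<in> ?W" using x chart_subset[OF X c] by auto
  have xS: "snd c x \<in> ?S" using x xW by auto
  have at: "at (snd c x) within ?S = at (snd c x) within cimg c"
    using fd_chart_image[OF X c W x(1) xW] .
  have \<phi>x: "?\<phi> (snd c x) = snd d (f x)" by (simp add: cinv_left[OF X c x(1)])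
  have eq: "(g \<circ> f \<circ> cinv c) y = (g \<circ> cinv d) (?\<phi> y)" if "y \<in> ?S" for y
    using that cinv_left[OF X c] cinv_left[OF Y d] by auto
  have "fd ?S (g \<circ> f \<circ> cinv c) (snd c x) a = fd ?S (\<lambda>y. (g \<circ> cinv d) (?\<phi> y)) (snd c x) a"
    by (subst fd_cong[OF eq xS]) auto
  also have "\<dots> = fd (cimg d) (g \<circ> cinv d) (?\<phi> (snd c x)) (fd ?S ?\<phi> (snd c x) a)"
  proof (rule fd_compose)
    show "relopen ?S" using chart_image_relopen[OF X c W] .
    show "?\<phi> ` ?S \<subseteq> cimg d" using cinv_left[OF X c] by (auto simp: cimg_def)
    show "?\<phi> differentiable (at (snd c x) within ?S)"
      unfolding at by (rule smooth_map_rep_differentiable[OF X Y c d f x])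
    show "(g \<circ> cinv d) differentiable (at (?\<phi> (snd c x)) within cimg d)"
      unfolding \<phi>x by (rule g)
  qed (rule xS)
  finally show ?thesis unfolding at \<phi>x .
qed

lemma rep_change_chart:
  assumes X: "charted X" and c: "c \<in> atlas X" "x \<in> fst c" and d: "d \<in> atlas X" "x \<in> fst d"
    and g: "(g \<circ> cinv d) differentiable (at (snd d x) within cimg d)"
  shows "fd (cimg c) (g \<circ> cinv c) (snd c x) a =
    fd (cimg d) (g \<circ> cinv d) (snd d x) (fd (cimg c) (snd d \<circ> cinv c) (snd c x) a)"
proof -
  have "g \<circ> (\<lambda>x. x) = g" "snd d \<circ> (\<lambda>x. x) = snd d" by (simp_all add: fun_eq_iff)
  then show ?thesis using rep_chain[OF X X c(1) d(1) smooth_map_id[OF X] c(2) d(2) g, of a] by simp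
qed

lemma transition_differentiable:
  assumes X: "charted X" and c: "c \<in> atlas X" "x \<in> fst c" and d: "d \<in> atlas X" "x \<in> fst d"
  shows "(snd d \<circ> cinv c) differentiable (at (snd c x) within cimg c)"
proof -
  have "snd d \<circ> (\<lambda>x. x) = snd d" by (simp add: fun_eq_iff)
  then show ?thesis
    using smooth_map_rep_differentiable[OF X X c(1) d(1) smooth_map_id[OF X] c(2) d(2)] by simp
qed

section \<open>Tangent vectors and differentials\<close>

lemma coord_vec_self:
  assumes X: "charted X" and c: "chart_at X x c"
  shows "coord_vec X c x a c = a"
proof -
  have c': "c \<in> atlas X" "x \<in> fst c" using c by (auto simp: chart_at_def)
  have "fd (cimg c) (snd c \<circ> cinv c) (snd c x) a = fd (cimg c) (\<lambda>y. y) (snd c x) a"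
    by (subst fd_cong[where g = "\<lambda>y. y"]) (auto simp: cinv_right cimgI c')
  also have "\<dots> = a" by (intro fd_id chart_relopen[OF X c'(1)] cimgI c')
  finally show ?thesis using c by (simp add: coord_vec_def)
qed

lemma coord_vec_in_tangent:
  assumes X: "charted X" and c: "chart_at X x c"
  shows "coord_vec X c x a \<in> tangent X x"
  unfolding tangent_def
proof (intro CollectI conjI allI impI)
  fix d assume "\<not> chart_at X x d" then show "coord_vec X c x a d = 0" by (simp add: coord_vec_def)
next
  fix d e assume de: "chart_at X x d \<and> chart_at X x e"
  then show "coord_vec X c x a e = fd (cimg d) (snd e \<circ> cinv d) (snd d x) (coord_vec X c x a d)"
    using rep_change_chart[OF X, of c x d "snd e" a] transition_differentiable[OF X, of d x e] c
    by (simp add: coord_vec_def chart_at_def)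
qed

lemma tangent_transition:
  "v \<in> tangent X x \<Longrightarrow> chart_at X x c \<Longrightarrow> chart_at X x d \<Longrightarrow>
    v d = fd (cimg c) (snd d \<circ> cinv c) (snd c x) (v c)"
  unfolding tangent_def by blast

lemma tangent_eq_coord_vec:
  assumes "chart_at X x c" "v \<in> tangent X x"
  shows "v = coord_vec X c x (v c)"
proof
  fix d show "v d = coord_vec X c x (v c) d"
  proof (cases "chart_at X x d")
    case True
    then show ?thesis using tangent_transition[OF assms(2,1)] by (simp add: coord_vec_def)
  next
    case False
    moreover have "v d = 0" using assms(2) False unfolding tangent_def by blast
    ultimately show ?thesis by (simp add: coord_vec_def)
  qed
qed

lemma coord_vec_tcomb:
  assumes X: "charted X" and c: "chart_at X x c"
  shows "coord_vec X c x (r *\<^sub>R a + s *\<^sub>R b) = tcomb r (coord_vec X c x a) s (coord_vec X c x b)"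
proof
  fix d
  show "coord_vec X c x (r *\<^sub>R a + s *\<^sub>R b) d = tcomb r (coord_vec X c x a) s (coord_vec X c x b) d"
    using fd_linear[OF transition_differentiable[OF X, of c x d], of r a s b] c
    by (simp add: coord_vec_def tcomb_def chart_at_def)
qed

lemma chart_at_exists:
  assumes "charted X" "x \<in> topspace (mtop X)" obtains c where "chart_at X x c"
  using chart_exists[OF assms] by (metis chart_at_def)

lemma tangent_tcomb:
  assumes X: "charted X" and x: "x \<in> topspace (mtop X)" and "v \<in> tangent X x" "w \<in> tangent X x"
  shows "tcomb r v s w \<in> tangent X x"
proof -
  obtain c where c: "chart_at X x c" using chart_at_exists[OF X x] .
  have "tcomb r v s w = coord_vec X c x (r *\<^sub>R v c + s *\<^sub>R w c)"
    unfolding coord_vec_tcomb[OF X c] using tangent_eq_coord_vec[OF c] assms by metis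
  then show ?thesis using coord_vec_in_tangent[OF X c] by simp
qed

text \<open>The differential is defined through a selected chart at \<open>x\<close>; the transformation law of tangent
  vectors makes every chart give the same value.\<close>

lemma tmap_chart:
  assumes X: "charted X" and Y: "charted Y" and f: "smooth_map X Y f"
    and c: "chart_at X x c" and d: "chart_at Y (f x) d" and v: "v \<in> tangent X x"
  shows "tmap X Y f x v d = fd (cimg c) (snd d \<circ> f \<circ> cinv c) (snd c x) (v c)"
proof -
  define e where "e = (SOME c. chart_at X x c)"
  have e: "chart_at X x e" using c unfolding e_def by (rule someI)
  have vc: "v c = fd (cimg e) (snd c \<circ> cinv e) (snd e x) (v e)"
    by (rule tangent_transition[OF v e c])
  have "((snd d \<circ> f) \<circ> cinv c) differentiable (at (snd c x) within cimg c)"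
    using smooth_map_rep_differentiable[OF X Y _ _ f, of c d x] c d by (simp add: chart_at_def o_assoc)
  from rep_change_chart[OF X _ _ _ _ this, of e "v e"] e c
  have "fd (cimg e) (snd d \<circ> f \<circ> cinv e) (snd e x) (v e) = fd (cimg c) (snd d \<circ> f \<circ> cinv c) (snd c x) (v c)"
    unfolding vc by (simp add: chart_at_def)
  then show ?thesis using d by (simp add: tmap_def e_def[symmetric] Let_def)
qed

lemma tmap_eq_coord_vec:
  assumes X: "charted X" and Y: "charted Y" and f: "smooth_map X Y f"
    and c: "chart_at X x c" and d: "chart_at Y (f x) d" and v: "v \<in> tangent X x"
  shows "tmap X Y f x v = coord_vec Y d (f x) (fd (cimg c) (snd d \<circ> f \<circ> cinv c) (snd c x) (v c))"
proof
  fix e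
  show "tmap X Y f x v e = coord_vec Y d (f x) (fd (cimg c) (snd d \<circ> f \<circ> cinv c) (snd c x) (v c)) e"
  proof (cases "chart_at Y (f x) e")
    case True
    have "(snd e \<circ> cinv d) differentiable (at (snd d (f x)) within cimg d)"
      using transition_differentiable[OF Y, of d "f x" e] d True by (simp add: chart_at_def)
    then show ?thesis
      using rep_chain[OF X Y _ _ f, of c d x "snd e" "v c"] c d True tmap_chart[OF X Y f c True v]
      by (simp add: chart_at_def coord_vec_def)
  next
    case False
    then show ?thesis by (simp add: tmap_def coord_vec_def Let_def)
  qed
qed

lemma tmap_in_tangent:
  assumes X: "charted X" and Y: "charted Y" and f: "smooth_map X Y f"
    and x: "x \<in> topspace (mtop X)" and v: "v \<in> tangent X x"
  shows "tmap X Y f x v \<in> tangent Y (f x)"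
proof -
  obtain c where c: "chart_at X x c" using chart_at_exists[OF X x] .
  obtain d where d: "chart_at Y (f x) d" using chart_at_exists[OF Y smooth_map_in[OF f x]] .
  show ?thesis unfolding tmap_eq_coord_vec[OF X Y f c d v] by (rule coord_vec_in_tangent[OF Y d])
qed

lemma tmap_tcomb:
  assumes X: "charted X" and Y: "charted Y" and f: "smooth_map X Y f"
    and x: "x \<in> topspace (mtop X)" and v: "v \<in> tangent X x" "w \<in> tangent X x"
  shows "tmap X Y f x (tcomb r v s w) = tcomb r (tmap X Y f x v) s (tmap X Y f x w)"
proof -
  obtain c where c: "chart_at X x c" using chart_at_exists[OF X x] .
  obtain d where d: "chart_at Y (f x) d" using chart_at_exists[OF Y smooth_map_in[OF f x]] .
  have "(snd d \<circ> f \<circ> cinv c) differentiable (at (snd c x) within cimg c)"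
    using smooth_map_rep_differentiable[OF X Y _ _ f] c d by (simp add: chart_at_def)
  note lin = fd_linear[OF this, of r "v c" s "w c"]
  have vw: "tcomb r v s w c = r *\<^sub>R v c + s *\<^sub>R w c" by (simp add: tcomb_def)
  show ?thesis
    unfolding tmap_eq_coord_vec[OF X Y f c d v(1)] tmap_eq_coord_vec[OF X Y f c d v(2)]
      tmap_eq_coord_vec[OF X Y f c d tangent_tcomb[OF X x v]] vw lin
    by (rule coord_vec_tcomb[OF Y d])
qed

lemma tmap_compose:
  assumes X: "charted X" and Y: "charted Y" and Z: "charted Z"
    and f: "smooth_map X Y f" and g: "smooth_map Y Z g"
    and x: "x \<in> topspace (mtop X)" and v: "v \<in> tangent X x"
  shows "tmap X Z (g \<circ> f) x v = tmap Y Z g (f x) (tmap X Y f x v)"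
proof -
  have y: "f x \<in> topspace (mtop Y)" using smooth_map_in[OF f x] .
  obtain c where c: "chart_at X x c" using chart_at_exists[OF X x] .
  obtain d where d: "chart_at Y (f x) d" using chart_at_exists[OF Y y] .
  obtain e where e: "chart_at Z (g (f x)) e" using chart_at_exists[OF Z smooth_map_in[OF g y]] .
  have fg: "smooth_map X Z (g \<circ> f)" by (rule smooth_map_compose[OF X Y Z f g])
  have w: "tmap X Y f x v \<in> tangent Y (f x)" by (rule tmap_in_tangent[OF X Y f x v])
  have "((snd e \<circ> g) \<circ> cinv d) differentiable (at (snd d (f x)) within cimg d)"
    using smooth_map_rep_differentiable[OF Y Z _ _ g] d e by (simp add: chart_at_def)
  from rep_chain[OF X Y _ _ f _ _ this, of c "v c"] c d
  have "fd (cimg c) (snd e \<circ> (g \<circ> f) \<circ> cinv c) (snd c x) (v c) =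
      fd (cimg d) (snd e \<circ> g \<circ> cinv d) (snd d (f x)) (tmap X Y f x v d)"
    by (simp add: chart_at_def tmap_chart[OF X Y f c d v] o_def)
  then show ?thesis
    using tmap_eq_coord_vec[OF X Z fg c _ v, of e] tmap_eq_coord_vec[OF Y Z g d e w] e by simp
qed

lemma ddir_chart:
  assumes X: "charted X" and W: "openin (mtop X) W" "smooth_fun X W h" "x \<in> W"
    and c: "chart_at X x c" and v: "v \<in> tangent X x"
  shows "ddir X h x v = fd (cimg c) (h \<circ> cinv c) (snd c x) (v c)"
proof -
  define e where "e = (SOME c. chart_at X x c)"
  have e: "chart_at X x e" using c unfolding e_def by (rule someI)
  have vc: "v c = fd (cimg e) (snd c \<circ> cinv e) (snd e x) (v e)"
    by (rule tangent_transition[OF v e c])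
  have "(h \<circ> cinv c) differentiable (at (snd c x) within cimg c)"
    using smooth_fun_rep_differentiable[OF X _ W(1,2) _ W(3)] c by (simp add: chart_at_def)
  from rep_change_chart[OF X _ _ _ _ this, of e "v e"] e c
  have "fd (cimg e) (h \<circ> cinv e) (snd e x) (v e) = fd (cimg c) (h \<circ> cinv c) (snd c x) (v c)"
    unfolding vc by (simp add: chart_at_def)
  then show ?thesis by (simp add: ddir_def e_def[symmetric] Let_def)
qed

lemma ddir_cong:
  assumes X: "charted X" and W: "openin (mtop X) W" "x \<in> W" and eq: "\<And>y. y \<in> W \<Longrightarrow> h y = k y"
  shows "ddir X h x v = ddir X k x v"
proof -
  define c where "c = (SOME c. chart_at X x c)"
  have "x \<in> topspace (mtop X)" using W openin_subset by blast
  then have "\<exists>c. chart_at X x c" using chart_at_exists[OF X] by metis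
  then have "chart_at X x c" unfolding c_def by (rule someI_ex)
  then have c: "c \<in> atlas X" "x \<in> fst c" by (auto simp: chart_at_def)
  have "fd (snd c ` (fst c \<inter> W)) (h \<circ> cinv c) (snd c x) = fd (snd c ` (fst c \<inter> W)) (k \<circ> cinv c) (snd c x)"
    by (rule fd_cong) (use c W eq cinv_left[OF X c(1)] in auto)
  then show ?thesis unfolding fd_chart_image[OF X c(1) W(1) c(2) W(2)] by (simp add: ddir_def c_def[symmetric] Let_def)
qed

lemma ddir_compose:
  assumes X: "charted X" and Y: "charted Y" and f: "smooth_map X Y f"
    and V: "openin (mtop Y) V" "smooth_fun Y V g" "f x \<in> V"
    and x: "x \<in> topspace (mtop X)" and v: "v \<in> tangent X x"
  shows "ddir X (\<lambda>x. g (f x)) x v = ddir Y g (f x) (tmap X Y f x v)"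
proof -
  obtain c where c: "chart_at X x c" using chart_at_exists[OF X x] .
  obtain d where d: "chart_at Y (f x) d" using chart_at_exists[OF Y smooth_map_in[OF f x]] .
  have w: "tmap X Y f x v \<in> tangent Y (f x)" by (rule tmap_in_tangent[OF X Y f x v])
  have 1: "ddir X (\<lambda>x. g (f x)) x v = fd (cimg c) ((\<lambda>x. g (f x)) \<circ> cinv c) (snd c x) (v c)"
    using ddir_chart[OF X smooth_map_openin[OF f V(1)] smooth_fun_compose[OF X Y f V(1,2)] _ c v] x V(3)
    by simp
  have "(g \<circ> cinv d) differentiable (at (snd d (f x)) within cimg d)"
    using smooth_fun_rep_differentiable[OF Y _ V(1,2) _ V(3)] d by (simp add: chart_at_def)
  from rep_chain[OF X Y _ _ f _ _ this, of c "v c"] c d show ?thesis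
    unfolding 1 ddir_chart[OF Y V d w]
    by (simp add: chart_at_def tmap_chart[OF X Y f c d v] o_def)
qed

lemma ddir_tcomb:
  assumes X: "charted X" and W: "openin (mtop X) W" "smooth_fun X W h" "x \<in> W"
    and v: "v \<in> tangent X x" "w \<in> tangent X x"
  shows "ddir X h x (tcomb r v s w) = r *\<^sub>R ddir X h x v + s *\<^sub>R ddir X h x w"
proof -
  have x: "x \<in> topspace (mtop X)" using W openin_subset by blast
  obtain c where c: "chart_at X x c" using chart_at_exists[OF X x] .
  have "(h \<circ> cinv c) differentiable (at (snd c x) within cimg c)"
    using smooth_fun_rep_differentiable[OF X _ W(1,2) _ W(3)] c by (simp add: chart_at_def)
  from fd_linear[OF this] show ?thesis
    by (simp add: ddir_chart[OF X W c] v tangent_tcomb[OF X x v]) (simp add: tcomb_def)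
qed

lemma smooth_fun_const: "charted X \<Longrightarrow> openin (mtop X) W \<Longrightarrow> smooth_fun X W (\<lambda>_. k)"
  by (simp add: smooth_fun_def o_def chart_image_relopen smooth_on_const)

lemma smooth_fun_add:
  "charted X \<Longrightarrow> openin (mtop X) W \<Longrightarrow> smooth_fun X W f \<Longrightarrow> smooth_fun X W g \<Longrightarrow>
    smooth_fun X W (\<lambda>x. f x + g x)"
  by (simp add: smooth_fun_def o_def chart_image_relopen smooth_on_add)

lemma smooth_fun_mult:
  fixes f g :: "'m \<Rightarrow> 'b::real_normed_algebra"
  shows "charted X \<Longrightarrow> openin (mtop X) W \<Longrightarrow> smooth_fun X W f \<Longrightarrow> smooth_fun X W g \<Longrightarrow>
    smooth_fun X W (\<lambda>x. f x * g x)"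
  by (simp add: smooth_fun_def o_def chart_image_relopen smooth_on_mult)

lemma smooth_fun_sum:
  "charted X \<Longrightarrow> openin (mtop X) W \<Longrightarrow> finite I \<Longrightarrow> (\<And>i. i \<in> I \<Longrightarrow> smooth_fun X W (f i)) \<Longrightarrow>
    smooth_fun X W (\<lambda>x. \<Sum>i\<in>I. f i x)"
  by (simp add: smooth_fun_def o_def chart_image_relopen smooth_on_sum)

lemma smooth_fun_bounded_linear:
  assumes L: "bounded_linear L" and X: "charted X" and W: "openin (mtop X) W" and f: "smooth_fun X W f"
  shows "smooth_fun X W (\<lambda>x. L (f x))"
  unfolding smooth_fun_def
proof
  fix c assume c: "c \<in> atlas X"
  then have "smooth_on (snd c ` (fst c \<inter> W)) (f \<circ> cinv c)" using f by (simp add: smooth_fun_def)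
  from smooth_on_bounded_linear[OF L chart_image_relopen[OF X c W] this]
  show "smooth_on (snd c ` (fst c \<inter> W)) ((\<lambda>x. L (f x)) \<circ> cinv c)" by (simp add: o_def)
qed

lemma smooth_fun_powr:
  fixes f :: "'m \<Rightarrow> real"
  assumes X: "charted X" and W: "openin (mtop X) W" and f: "smooth_fun X W f" "\<And>x. x \<in> W \<Longrightarrow> f x > 0"
  shows "smooth_fun X W (\<lambda>x. f x powr a)"
  unfolding smooth_fun_def
proof
  fix c assume c: "c \<in> atlas X"
  have sm: "smooth_on (snd c ` (fst c \<inter> W)) (f \<circ> cinv c)" using f c unfolding smooth_fun_def by blast
  have "(f \<circ> cinv c) ` (snd c ` (fst c \<inter> W)) \<subseteq> {0<..}"
    using f(2) cinv_left[OF X c] by auto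
  from smooth_on_compose[OF chart_image_relopen[OF X c W] relopen_open[OF open_greaterThan] this sm smooth_on_powr]
  have "smooth_on (snd c ` (fst c \<inter> W)) (\<lambda>y. (f \<circ> cinv c) y powr a)" .
  then show "smooth_on (snd c ` (fst c \<inter> W)) ((\<lambda>x. f x powr a) \<circ> cinv c)" by (simp add: o_def)
qed

lemma ddir_rules:
  assumes X: "charted X" and W: "openin (mtop X) W" "x \<in> W" and v: "v \<in> tangent X x"
  shows ddir_const: "ddir X (\<lambda>_. k) x v = 0"
    and ddir_add: "smooth_fun X W f \<Longrightarrow> smooth_fun X W g \<Longrightarrow>
      ddir X (\<lambda>x. f x + g x) x v = ddir X f x v + ddir X g x v"
    and ddir_mult: "smooth_fun X W p \<Longrightarrow> smooth_fun X W q \<Longrightarrow>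
      ddir X (\<lambda>x. p x * q x) x v = p x * ddir X q x v + ddir X p x v * (q x :: 'r::real_normed_algebra)"
    and ddir_bounded_linear: "bounded_linear L \<Longrightarrow> smooth_fun X W f \<Longrightarrow>
      ddir X (\<lambda>x. L (f x)) x v = L (ddir X f x v)"
proof -
  have x: "x \<in> topspace (mtop X)" using W openin_subset by blast
  obtain c where c: "chart_at X x c" using chart_at_exists[OF X x] .
  then have c': "c \<in> atlas X" "x \<in> fst c" by (auto simp: chart_at_def)
  note S = chart_relopen[OF X c'(1)] cimgI[OF c'(2)]
  note d = smooth_fun_rep_differentiable[OF X c'(1) W(1) _ c'(2) W(2)]
  note e = ddir_chart[OF X W(1) _ W(2) c v]
  show "ddir X (\<lambda>_. k) x v = 0"
    using fd_const[OF S, of k] by (simp add: e[OF smooth_fun_const[OF X W(1)]] o_def)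
  show "ddir X (\<lambda>x. f x + g x) x v = ddir X f x v + ddir X g x v"
    if "smooth_fun X W f" "smooth_fun X W g"
    using fd_add[OF S d d, OF that] by (simp add: e smooth_fun_add[OF X W(1)] that o_def)
  show "ddir X (\<lambda>x. p x * q x) x v = p x * ddir X q x v + ddir X p x v * q x"
    if "smooth_fun X W p" "smooth_fun X W q"
    using fd_bilinear[OF bounded_bilinear_mult S d d, OF that] cinv_left[OF X c']
    by (simp add: e smooth_fun_mult[OF X W(1)] that o_def)
  show "ddir X (\<lambda>x. L (f x)) x v = L (ddir X f x v)" if "bounded_linear L" "smooth_fun X W f"
    using fd_bounded_linear[OF that(1) S d[OF that(2)]]
    by (simp add: e smooth_fun_bounded_linear[OF that(1) X W(1)] that o_def)
qed

lemma smooth_fun_std: "smooth_fun (std U) W f \<longleftrightarrow> smooth_on (U \<inter> W) f"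
proof -
  have "smooth_on (U \<inter> W) (f \<circ> cinv (U, \<lambda>x. x)) \<longleftrightarrow> smooth_on (U \<inter> W) f"
    by (rule smooth_on_cong) (simp add: cinv_std)
  then show ?thesis by (simp add: smooth_fun_def)
qed

lemma smooth_map_std:
  assumes "smooth_on U g" "g ` U \<subseteq> V"
  shows "smooth_map (std U) (std V) g"
proof -
  have "{x \<in> U. g x \<in> V} = U" using assms(2) by auto
  moreover have "smooth_on U ((\<lambda>x. x) \<circ> g \<circ> cinv (U, \<lambda>x. x))"
    by (rule smooth_on_cong[THEN iffD1, OF _ assms(1)]) (simp add: cinv_std)
  moreover have "continuous_map (top_of_set U) (top_of_set V) g"
    using smooth_on_continuous[OF assms(1)] assms(2) by (simp add: image_subset_iff_funcset)
  ultimately show ?thesis by (simp add: smooth_map_def)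
qed

lemma smooth_map_std_smooth:
  assumes "smooth_map (std U) (std V) g" shows "smooth_on U g" "g ` U \<subseteq> V"
proof -
  show sub: "g ` U \<subseteq> V" using smooth_map_in[OF assms] by auto
  then have "{x \<in> U. g x \<in> V} = U" by auto
  then have "smooth_on U ((\<lambda>x. x) \<circ> g \<circ> cinv (U, \<lambda>x. x))" using assms by (simp add: smooth_map_def)
  then show "smooth_on U g" by (rule smooth_on_cong[THEN iffD1, rotated]) (simp add: cinv_std)
qed

lemma chart_at_std: "chart_at (std U) p c \<longleftrightarrow> p \<in> U \<and> c = (U, \<lambda>x. x)"
  by (auto simp: chart_at_def)

lemma std_vec_tangent: "region U \<Longrightarrow> p \<in> U \<Longrightarrow> std_vec U p a \<in> tangent (std U) p"
  by (rule coord_vec_in_tangent[OF charted_std]) (auto simp: chart_at_std)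

lemma std_vec_self: "region U \<Longrightarrow> p \<in> U \<Longrightarrow> std_vec U p a (U, \<lambda>x. x) = a"
  by (rule coord_vec_self[OF charted_std]) (auto simp: chart_at_std)

lemma tangent_std:
  "p \<in> U \<Longrightarrow> v \<in> tangent (std U) p \<Longrightarrow> v = std_vec U p (v (U, \<lambda>x. x))"
  by (rule tangent_eq_coord_vec) (auto simp: chart_at_std)

lemma tmap_std:
  assumes U: "region U" and V: "region V" and g: "smooth_map (std U) (std V) g" and p: "p \<in> U"
  shows "tmap (std U) (std V) g p (std_vec U p a) = std_vec V (g p) (fd U g p a)"
proof -
  have gp: "g p \<in> V" using smooth_map_std_smooth(2)[OF g] p by auto
  have "fd U ((\<lambda>x. x) \<circ> g \<circ> cinv (U, \<lambda>x. x)) p = fd U g p"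
    by (rule fd_cong) (auto simp: cinv_std p)
  then show ?thesis
    using tmap_eq_coord_vec[OF charted_std[OF U] charted_std[OF V] g, of p "(U, \<lambda>x. x)" "(V, \<lambda>x. x)"]
      std_vec_tangent[OF U p] p gp by (simp add: chart_at_std std_vec_self[OF U p])
qed

section \<open>Pullback of differential forms\<close>

definition one_form_on :: "('m, 'e::euclidean_space) smooth_space \<Rightarrow> 'm set \<Rightarrow> ('m, 'e) form1 \<Rightarrow> bool" where
  "one_form_on X W A \<longleftrightarrow> (\<forall>x\<in>W. linear_on_set (tangent X x) (A x)) \<and>
     (\<forall>c\<in>atlas X. \<forall>a. smooth_on (snd c ` (fst c \<inter> W)) (coef1 X c A a))"

definition pull_form1 ::
  "('m, 'e::euclidean_space) smooth_space \<Rightarrow> ('n, 'd::euclidean_space) smooth_space \<Rightarrow>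
   ('m \<Rightarrow> 'n) \<Rightarrow> ('n, 'd) form1 \<Rightarrow> ('m, 'e) form1" where
  "pull_form1 X Y f A x v = A (f x) (tmap X Y f x v)"

definition pull_form2 ::
  "('m, 'e::euclidean_space) smooth_space \<Rightarrow> ('n, 'd::euclidean_space) smooth_space \<Rightarrow>
   ('m \<Rightarrow> 'n) \<Rightarrow> ('n, 'd) form2 \<Rightarrow> ('m, 'e) form2" where
  "pull_form2 X Y f K x u v = K (f x) (tmap X Y f x u) (tmap X Y f x v)"

lemma one_form_on_coef1:
  "one_form_on X W A \<Longrightarrow> c \<in> atlas X \<Longrightarrow> smooth_on (snd c ` (fst c \<inter> W)) (coef1 X c A a)"
  unfolding one_form_on_def by blast

lemma one_form_scale:
  assumes X: "charted X" and A: "one_form X A"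
  shows "one_form X (\<lambda>x v. k * A x v)"
  unfolding one_form_def
proof (intro conjI ballI allI)
  show "linear_on_set (tangent X x) (\<lambda>v. k * A x v)" if "x \<in> topspace (mtop X)" for x
    using A that by (simp add: one_form_def linear_on_set_def algebra_simps)
  fix c a assume c: "c \<in> atlas X"
  then have "smooth_on (cimg c) (coef1 X c A a)" using A unfolding one_form_def by blast
  from smooth_on_bounded_linear[OF bounded_linear_mult_right chart_relopen[OF X c] this]
  show "smooth_on (cimg c) (coef1 X c (\<lambda>x v. k * A x v) a)" by (simp add: coef1_def)
qed

lemma one_form_on_subset:
  assumes X: "charted X" and A: "one_form X A" and W: "openin (mtop X) W"
  shows "one_form_on X W A"
  unfolding one_form_on_def
proof (intro conjI ballI allI)
  show "linear_on_set (tangent X x) (A x)" if "x \<in> W" for x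
    using A that openin_subset[OF W] unfolding one_form_def by blast
  fix c a assume c: "c \<in> atlas X"
  then have "smooth_on (cimg c) (coef1 X c A a)" using A unfolding one_form_def by blast
  then show "smooth_on (snd c ` (fst c \<inter> W)) (coef1 X c A a)"
    by (rule smooth_on_subset[OF chart_image_relopen[OF X c W] chart_relopen[OF X c], rotated])
      (auto simp: cimg_def)
qed

text \<open>Smooth vector fields along \<open>f\<close>. Two sources of them are differentials of coordinate fields and
  the tangent vectors to the path space, where \<open>f\<close> is a path.\<close>

definition field_along ::
  "('m, 'e::euclidean_space) smooth_space \<Rightarrow> ('n, 'd::euclidean_space) smooth_space \<Rightarrow>
   ('m \<Rightarrow> 'n) \<Rightarrow> 'm set \<Rightarrow> ('m \<Rightarrow> ('n, 'd) tvec) \<Rightarrow> bool" where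
  "field_along X Y f W v \<longleftrightarrow> (\<forall>x\<in>W. v x \<in> tangent Y (f x)) \<and>
     (\<forall>d\<in>atlas Y. smooth_fun X (W \<inter> {x \<in> topspace (mtop X). f x \<in> fst d}) (\<lambda>x. v x d))"

lemma linear_on_coord_vec:
  assumes X: "charted X" and c: "chart_at X x c" and A: "linear_on_set (tangent X x) A"
  shows "linear (\<lambda>a. A (coord_vec X c x a))"
proof -
  note t = coord_vec_in_tangent[OF X c]
  have comb: "A (coord_vec X c x (r *\<^sub>R a + s *\<^sub>R b)) = r * A (coord_vec X c x a) + s * A (coord_vec X c x b)"
    for r s a b
    unfolding coord_vec_tcomb[OF X c] using A t unfolding linear_on_set_def by blast
  show ?thesis
  proof (rule linearI)
    show "A (coord_vec X c x (a + b)) = A (coord_vec X c x a) + A (coord_vec X c x b)" for a b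
      using comb[of 1 a 1 b] by simp
    show "A (coord_vec X c x (r *\<^sub>R a)) = r *\<^sub>R A (coord_vec X c x a)" for r a
      using comb[of r a 0 0] by simp
  qed
qed

lemma linear_expand:
  fixes L :: "'a::euclidean_space \<Rightarrow> real"
  assumes "linear L" shows "L w = (\<Sum>i\<in>Basis. (w \<bullet> i) * L i)"
proof -
  interpret linear L by fact
  have "L (\<Sum>i\<in>Basis. (w \<bullet> i) *\<^sub>R i) = (\<Sum>i\<in>Basis. (w \<bullet> i) * L i)"
    by (simp add: sum scale)
  then show ?thesis by (simp add: euclidean_representation)
qed

lemma linear_form_expand:
  assumes X: "charted X" and c: "chart_at X x c" and A: "linear_on_set (tangent X x) A"
    and v: "v \<in> tangent X x"
  shows "A v = (\<Sum>i\<in>Basis. (v c \<bullet> i) * A (coord_vec X c x i))"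
  using linear_expand[OF linear_on_coord_vec[OF X c A], of "v c"] tangent_eq_coord_vec[OF c v] by simp

lemma two_formD:
  assumes "two_form X K"
  shows two_form_alternating: "x \<in> topspace (mtop X) \<Longrightarrow> alternating_on_set (tangent X x) (K x)"
    and two_form_coef: "c \<in> atlas X \<Longrightarrow> smooth_on (cimg c) (coef2 X c K a b)"
  using assms unfolding two_form_def by blast+

lemma smooth_fun_coef:
  assumes X: "charted X" and W: "openin (mtop X) W" and c: "c \<in> atlas X"
    and g: "smooth_on (snd c ` (fst c \<inter> W)) (g \<circ> cinv c)"
  shows "smooth_fun X (fst c \<inter> W) g"
  by (rule smooth_fun_in_chart[OF X c]) (use g W chart_openin[OF X c] in auto)

lemma one_form_on_coef:
  assumes X: "charted X" and W: "openin (mtop X) W" and A: "one_form_on X W A" and c: "c \<in> atlas X"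
  shows "smooth_fun X (fst c \<inter> W) (\<lambda>x. A x (coord_vec X c x a))"
  by (rule smooth_fun_coef[OF X W c]) (use A c in \<open>simp add: one_form_on_def coef1_def o_def\<close>)

lemma smooth_fun_ddir:
  assumes X: "charted X" and W: "openin (mtop X) W" and h: "smooth_fun X W h" and c: "c \<in> atlas X"
  shows "smooth_fun X (fst c \<inter> W) (\<lambda>x. ddir X h x (coord_vec X c x a))"
proof (rule smooth_fun_coef[OF X W c])
  have "smooth_on (snd c ` (fst c \<inter> W)) (h \<circ> cinv c)" using h c by (simp add: smooth_fun_def)
  then have "smooth_on (snd c ` (fst c \<inter> W)) (\<lambda>y. fd (snd c ` (fst c \<inter> W)) (h \<circ> cinv c) y a)"
    by (rule smooth_on_fd)
  then show "smooth_on (snd c ` (fst c \<inter> W)) ((\<lambda>x. ddir X h x (coord_vec X c x a)) \<circ> cinv c)"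
  proof (rule smooth_on_cong[THEN iffD1, rotated])
    fix y assume "y \<in> snd c ` (fst c \<inter> W)"
    then obtain x where x: "x \<in> fst c" "x \<in> W" "y = snd c x" by auto
    have cx: "chart_at X x c" using x c by (simp add: chart_at_def)
    show "fd (snd c ` (fst c \<inter> W)) (h \<circ> cinv c) y a = ((\<lambda>x. ddir X h x (coord_vec X c x a)) \<circ> cinv c) y"
      unfolding x(3) fd_chart_image[OF X c W x(1,2)]
      by (simp add: cinv_left[OF X c x(1)] ddir_chart[OF X W h x(2) cx coord_vec_in_tangent[OF X cx]]
          coord_vec_self[OF X cx])
  qed
qed

lemma smooth_fun_one_form_along:
  assumes X: "charted X" and Y: "charted Y" and f: "smooth_map X Y f"
    and V: "openin (mtop Y) V" and A: "one_form_on Y V A"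
    and W: "openin (mtop X) W" "\<And>x. x \<in> W \<Longrightarrow> f x \<in> V" and v: "field_along X Y f W v"
  shows "smooth_fun X W (\<lambda>x. A (f x) (v x))"
proof (rule smooth_fun_local[OF X W(1)])
  fix x assume x: "x \<in> W"
  then obtain d where d: "d \<in> atlas Y" "f x \<in> fst d"
    using chart_exists[OF Y, of "f x"] W(2) V openin_subset by blast
  let ?W = "W \<inter> {x \<in> topspace (mtop X). f x \<in> fst d}"
  have op: "openin (mtop X) ?W"
    by (intro openin_Int W smooth_map_openin[OF f] chart_openin[OF Y d(1)])
  have co: "smooth_fun X ?W (\<lambda>x. A (f x) (coord_vec Y d (f x) i))" for i
  proof -
    have "smooth_fun Y (fst d \<inter> V) (\<lambda>y. A y (coord_vec Y d y i))"
      by (rule smooth_fun_coef[OF Y V d(1)])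
        (use A d in \<open>simp add: one_form_on_def coef1_def o_def\<close>)
    from smooth_fun_compose[OF X Y f openin_Int[OF chart_openin[OF Y d(1)] V] this] show ?thesis
      by (rule smooth_fun_subset[OF X smooth_map_openin[OF f openin_Int[OF chart_openin[OF Y d(1)] V]] op, rotated])
        (use W in auto)
  qed
  have vd: "smooth_fun X ?W (\<lambda>x. v x d)" using v d unfolding field_along_def by blast
  have "smooth_fun X ?W (\<lambda>x. \<Sum>i\<in>Basis. (v x d \<bullet> i) * A (f x) (coord_vec Y d (f x) i))"
    by (intro smooth_fun_sum smooth_fun_mult X op co finite_Basis
        smooth_fun_bounded_linear[OF bounded_linear_inner_left] vd)
  moreover have "A (f x) (v x) = (\<Sum>i\<in>Basis. (v x d \<bullet> i) * A (f x) (coord_vec Y d (f x) i))"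
    if "x \<in> ?W" for x
    using that A v W d by (intro linear_form_expand[OF Y]) (auto simp: chart_at_def one_form_on_def field_along_def)
  ultimately have "smooth_fun X ?W (\<lambda>x. A (f x) (v x))" 
    using smooth_fun_cong[OF X, of ?W "\<lambda>x. A (f x) (v x)"
        "\<lambda>x. \<Sum>i\<in>Basis. (v x d \<bullet> i) * A (f x) (coord_vec Y d (f x) i)"] by blast
  then show "\<exists>W'. openin (mtop X) W' \<and> x \<in> W' \<and> W' \<subseteq> W \<and> smooth_fun X W' (\<lambda>x. A (f x) (v x))"
    using op x d W openin_subset by (intro exI[of _ ?W]) auto
qed

lemma alternating_linear:
  "alternating_on_set T K \<Longrightarrow> u \<in> T \<Longrightarrow> linear_on_set T (K u)"
  "alternating_on_set T K \<Longrightarrow> u \<in> T \<Longrightarrow> linear_on_set T (\<lambda>v. K v u)"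
  by (auto simp: alternating_on_set_def)

lemma smooth_fun_two_form_along:
  assumes X: "charted X" and Y: "charted Y" and f: "smooth_map X Y f" and K: "two_form Y K"
    and W: "openin (mtop X) W" and v: "field_along X Y f W v" and w: "field_along X Y f W w"
  shows "smooth_fun X W (\<lambda>x. K (f x) (v x) (w x))"
proof (rule smooth_fun_local[OF X W])
  fix x assume x: "x \<in> W"
  then have "x \<in> topspace (mtop X)" using W openin_subset by blast
  then obtain d where d: "d \<in> atlas Y" "f x \<in> fst d"
    using chart_exists[OF Y smooth_map_in[OF f]] by metis
  let ?W = "W \<inter> {x \<in> topspace (mtop X). f x \<in> fst d}"
  let ?K = "\<lambda>x i j. K (f x) (coord_vec Y d (f x) i) (coord_vec Y d (f x) j)"
  have dop: "openin (mtop Y) (fst d)" by (rule chart_openin[OF Y d(1)])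
  have op: "openin (mtop X) ?W"
    by (intro openin_Int W smooth_map_openin[OF f] dop)
  have co: "smooth_fun X ?W (\<lambda>x. ?K x i j)" for i j
  proof -
    have "smooth_fun Y (fst d) (\<lambda>y. K y (coord_vec Y d y i) (coord_vec Y d y j))"
      by (rule smooth_fun_in_chart[OF Y d(1) dop order_refl])
        (use K d in \<open>simp add: two_form_def coef2_def o_def cimg_def\<close>)
    from smooth_fun_compose[OF X Y f dop this] show ?thesis
      by (rule smooth_fun_subset[OF X smooth_map_openin[OF f dop] op, rotated]) auto
  qed
  have vd: "smooth_fun X ?W (\<lambda>x. v x d)" "smooth_fun X ?W (\<lambda>x. w x d)"
    using v w d unfolding field_along_def by blast+
  have "smooth_fun X ?W (\<lambda>x. \<Sum>i\<in>Basis. (v x d \<bullet> i) * (\<Sum>j\<in>Basis. (w x d \<bullet> j) * ?K x i j))"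
    by (intro smooth_fun_sum smooth_fun_mult X op co finite_Basis
        smooth_fun_bounded_linear[OF bounded_linear_inner_left] vd)
  moreover have "K (f x) (v x) (w x) = (\<Sum>i\<in>Basis. (v x d \<bullet> i) * (\<Sum>j\<in>Basis. (w x d \<bullet> j) * ?K x i j))"
    if x: "x \<in> ?W" for x
  proof -
    have alt: "alternating_on_set (tangent Y (f x)) (K (f x))"
      using K x smooth_map_in[OF f] unfolding two_form_def by blast
    have dx: "chart_at Y (f x) d" using x d by (simp add: chart_at_def)
    have vw: "v x \<in> tangent Y (f x)" "w x \<in> tangent Y (f x)"
      using v w x unfolding field_along_def by blast+
    have "K (f x) (v x) (w x) = (\<Sum>i\<in>Basis. (v x d \<bullet> i) * K (f x) (coord_vec Y d (f x) i) (w x))"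
      by (rule linear_form_expand[OF Y dx alternating_linear(2)[OF alt vw(2)] vw(1)])
    moreover have "K (f x) (coord_vec Y d (f x) i) (w x) = (\<Sum>j\<in>Basis. (w x d \<bullet> j) * ?K x i j)" for i
      by (rule linear_form_expand[OF Y dx alternating_linear(1)[OF alt coord_vec_in_tangent[OF Y dx]] vw(2)])
    ultimately show ?thesis by simp
  qed
  ultimately have "smooth_fun X ?W (\<lambda>x. K (f x) (v x) (w x))"
    using smooth_fun_cong[OF X, of ?W "\<lambda>x. K (f x) (v x) (w x)"
        "\<lambda>x. \<Sum>i\<in>Basis. (v x d \<bullet> i) * (\<Sum>j\<in>Basis. (w x d \<bullet> j) * ?K x i j)"] by blast
  then show "\<exists>W'. openin (mtop X) W' \<and> x \<in> W' \<and> W' \<subseteq> W \<and> smooth_fun X W' (\<lambda>x. K (f x) (v x) (w x))"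
    using op x d W openin_subset by (intro exI[of _ ?W]) auto
qed

lemma field_along_tmap:
  assumes X: "charted X" and Y: "charted Y" and f: "smooth_map X Y f" and c: "c \<in> atlas X"
    and W: "openin (mtop X) W" "W \<subseteq> fst c"
  shows "field_along X Y f W (\<lambda>x. tmap X Y f x (coord_vec X c x a))"
  unfolding field_along_def
proof (intro conjI ballI)
  fix x assume x: "x \<in> W"
  then have "chart_at X x c" "x \<in> topspace (mtop X)" using c W chart_subset[OF X c] by (auto simp: chart_at_def)
  then show "tmap X Y f x (coord_vec X c x a) \<in> tangent Y (f x)"
    by (intro tmap_in_tangent[OF X Y f] coord_vec_in_tangent[OF X])
next
  fix d assume d: "d \<in> atlas Y"
  let ?P = "{x \<in> topspace (mtop X). f x \<in> fst d}"
  let ?\<phi> = "snd d \<circ> f \<circ> cinv c"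
  have P: "openin (mtop X) ?P" by (intro smooth_map_openin[OF f] chart_openin[OF Y d])
  have WP: "openin (mtop X) (W \<inter> ?P)" by (intro openin_Int W P)
  have P': "fst c \<inter> ?P = {x \<in> fst c. f x \<in> fst d}" using chart_subset[OF X c] by auto
  have sm: "smooth_on (snd c ` (fst c \<inter> ?P)) ?\<phi>"
    unfolding P' using f c d by (simp add: smooth_map_def)
  show "smooth_fun X (W \<inter> ?P) (\<lambda>x. tmap X Y f x (coord_vec X c x a) d)"
  proof (rule smooth_fun_subset[OF X _ WP])
    show op: "openin (mtop X) (fst c \<inter> ?P)" by (intro openin_Int P chart_openin[OF X c])
    show "W \<inter> ?P \<subseteq> fst c \<inter> ?P" using W by auto
    show "smooth_fun X (fst c \<inter> ?P) (\<lambda>x. tmap X Y f x (coord_vec X c x a) d)"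
    proof (rule smooth_fun_in_chart[OF X c op])
      show "smooth_on (snd c ` (fst c \<inter> ?P)) ((\<lambda>x. tmap X Y f x (coord_vec X c x a) d) \<circ> cinv c)"
      proof (rule smooth_on_cong[THEN iffD1, OF _ smooth_on_fd[OF sm, of a]])
        fix y assume "y \<in> snd c ` (fst c \<inter> ?P)"
        then obtain x where x: "x \<in> fst c" "x \<in> ?P" "y = snd c x" by auto
        have cx: "chart_at X x c" and dx: "chart_at Y (f x) d" using x c d by (auto simp: chart_at_def)
        show "fd (snd c ` (fst c \<inter> ?P)) ?\<phi> y a = ((\<lambda>x. tmap X Y f x (coord_vec X c x a) d) \<circ> cinv c) y"
          unfolding x(3) fd_chart_image[OF X c P x(1,2)]
          by (simp add: cinv_left[OF X c x(1)] tmap_chart[OF X Y f cx dx coord_vec_in_tangent[OF X cx]]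
              coord_vec_self[OF X cx])
      qed
    qed auto
  qed
qed

lemma pull_form1_linear:
  assumes X: "charted X" and Y: "charted Y" and f: "smooth_map X Y f" and x: "x \<in> topspace (mtop X)"
    and A: "linear_on_set (tangent Y (f x)) (A (f x))"
  shows "linear_on_set (tangent X x) (pull_form1 X Y f A x)"
  using A unfolding linear_on_set_def pull_form1_def
  by (simp add: tmap_tcomb[OF X Y f x] tmap_in_tangent[OF X Y f x])

lemma one_form_on_pull:
  assumes X: "charted X" and Y: "charted Y" and f: "smooth_map X Y f"
    and V: "openin (mtop Y) V" and A: "one_form_on Y V A"
  shows "one_form_on X {x \<in> topspace (mtop X). f x \<in> V} (pull_form1 X Y f A)"
  unfolding one_form_on_def
proof (intro conjI ballI allI)
  fix x assume "x \<in> {x \<in> topspace (mtop X). f x \<in> V}"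
  then show "linear_on_set (tangent X x) (pull_form1 X Y f A x)"
    using A by (intro pull_form1_linear[OF X Y f]) (auto simp: one_form_on_def)
next
  fix c a assume c: "c \<in> atlas X"
  let ?P = "{x \<in> topspace (mtop X). f x \<in> V}"
  let ?W = "fst c \<inter> ?P"
  have W: "openin (mtop X) ?W" by (intro openin_Int chart_openin[OF X c] smooth_map_openin[OF f V])
  have "smooth_fun X ?W (\<lambda>x. A (f x) (tmap X Y f x (coord_vec X c x a)))"
    by (rule smooth_fun_one_form_along[OF X Y f V A W _ field_along_tmap[OF X Y f c W]]) auto
  then have "smooth_on (snd c ` (fst c \<inter> ?W)) ((\<lambda>x. A (f x) (tmap X Y f x (coord_vec X c x a))) \<circ> cinv c)"
    using c unfolding smooth_fun_def by blast
  moreover have "fst c \<inter> ?W = ?W" by auto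
  ultimately show "smooth_on (snd c ` ?W) (coef1 X c (pull_form1 X Y f A) a)"
    by (simp add: coef1_def pull_form1_def o_def)
qed

lemma two_form_pull:
  assumes X: "charted X" and Y: "charted Y" and f: "smooth_map X Y f" and K: "two_form Y K"
  shows "two_form X (pull_form2 X Y f K)"
  unfolding two_form_def
proof (intro conjI ballI allI)
  fix x assume x: "x \<in> topspace (mtop X)"
  have "alternating_on_set (tangent Y (f x)) (K (f x))"
    using K smooth_map_in[OF f x] unfolding two_form_def by blast
  then show "alternating_on_set (tangent X x) (pull_form2 X Y f K x)"
    unfolding alternating_on_set_def linear_on_set_def pull_form2_def
    by (simp add: tmap_tcomb[OF X Y f x] tmap_in_tangent[OF X Y f x])
next
  fix c a b assume c: "c \<in> atlas X"
  note W = chart_openin[OF X c]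
  have "smooth_fun X (fst c) (\<lambda>x. K (f x) (tmap X Y f x (coord_vec X c x a)) (tmap X Y f x (coord_vec X c x b)))"
    by (intro smooth_fun_two_form_along[OF X Y f K W] field_along_tmap[OF X Y f c W order_refl])
  then have "smooth_on (snd c ` (fst c \<inter> fst c)) 
      ((\<lambda>x. K (f x) (tmap X Y f x (coord_vec X c x a)) (tmap X Y f x (coord_vec X c x b))) \<circ> cinv c)"
    using c unfolding smooth_fun_def by blast
  then show "smooth_on (cimg c) (coef2 X c (pull_form2 X Y f K) a b)"
    by (simp add: coef2_def pull_form2_def o_def cimg_def)
qed

lemma coef1_pull:
  assumes X: "charted X" and Y: "charted Y" and f: "smooth_map X Y f"
    and c: "chart_at X x c" and d: "chart_at Y (f x) d"
  shows "coef1 X c (pull_form1 X Y f A) a (snd c x) =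
    coef1 Y d A (fd (cimg c) (snd d \<circ> f \<circ> cinv c) (snd c x) a) (snd d (f x))"
proof -
  have c': "c \<in> atlas X" "x \<in> fst c" and d': "d \<in> atlas Y" "f x \<in> fst d"
    using c d by (auto simp: chart_at_def)
  show ?thesis
    by (simp add: coef1_def pull_form1_def cinv_left[OF X c'] cinv_left[OF Y d']
        tmap_eq_coord_vec[OF X Y f c d coord_vec_in_tangent[OF X c]] coord_vec_self[OF X c])
qed

lemma ext_d1_pull:
  assumes X: "charted X" and Y: "charted Y" and f: "smooth_map X Y f"
    and V: "openin (mtop Y) V" and A: "one_form_on Y V A" and x: "f x \<in> V"
    and c: "chart_at X x c" and d: "chart_at Y (f x) d"
    and u: "u \<in> tangent X x" and v: "v \<in> tangent X x"
  shows "ext_d1 X c (pull_form1 X Y f A) x u v = ext_d1 Y d A (f x) (tmap X Y f x u) (tmap X Y f x v)"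
proof -
  have c': "c \<in> atlas X" "x \<in> fst c" and d': "d \<in> atlas Y" "f x \<in> fst d"
    using c d by (auto simp: chart_at_def)
  let ?P = "{x \<in> topspace (mtop X). f x \<in> fst d \<inter> V}"
  let ?S = "snd c ` (fst c \<inter> ?P)"
  let ?T = "snd d ` (fst d \<inter> V)"
  let ?\<phi> = "snd d \<circ> f \<circ> cinv c"
  let ?\<theta> = "coef1 Y d A"
  have P: "openin (mtop X) ?P" by (intro smooth_map_openin[OF f] openin_Int chart_openin[OF Y d'(1)] V)
  have xP: "x \<in> ?P" using x d' c' chart_subset[OF X c'(1)] by auto
  have S: "relopen ?S" by (rule chart_image_relopen[OF X c'(1) P])
  have T: "relopen ?T" by (rule chart_image_relopen[OF Y d'(1) V])
  have \<phi>x: "?\<phi> (snd c x) = snd d (f x)" by (simp add: cinv_left[OF X c'])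
  have xS: "snd c x \<in> ?S" using c' xP by auto
  have atS: "at (snd c x) within ?S = at (snd c x) within cimg c"
    by (rule fd_chart_image[OF X c'(1) P c'(2) xP])
  have atT: "at (snd d (f x)) within ?T = at (snd d (f x)) within cimg d"
    by (rule fd_chart_image[OF Y d'(1) V d'(2) x])
  have \<phi>: "smooth_on ?S ?\<phi>"
    by (rule smooth_fun_compose_chart[OF X Y c'(1) d'(1) f V])
      (use smooth_map_id[OF Y] d'(1) in \<open>auto intro!: smooth_on_cong[THEN iffD1, OF _ smooth_on_id[OF T]] simp: cinv_left[OF Y]\<close>)
  have img: "?\<phi> ` ?S \<subseteq> ?T" using cinv_left[OF X c'(1)] by auto
  have \<theta>: "smooth_on ?T (?\<theta> a)" for a using A d' by (simp add: one_form_on_def)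
  have lin: "linear (\<lambda>a. ?\<theta> a y)" if "y \<in> ?T" for y
  proof -
    obtain z where z: "z \<in> fst d" "z \<in> V" "y = snd d z" using \<open>y \<in> ?T\<close> by auto
    have "chart_at Y z d" using z d' by (simp add: chart_at_def)
    then show ?thesis
      using linear_on_coord_vec[OF Y, of z d "A z"] A z cinv_left[OF Y d'(1) z(1)]
      by (simp add: coef1_def one_form_on_def)
  qed
  have coef: "coef1 X c (pull_form1 X Y f A) a y = ?\<theta> (fd ?S ?\<phi> y a) (?\<phi> y)" if "y \<in> ?S" for y a
  proof -
    obtain z where z: "z \<in> fst c" "z \<in> ?P" "y = snd c z" using \<open>y \<in> ?S\<close> by auto
    have "chart_at X z c" "chart_at Y (f z) d" using z c' d' by (auto simp: chart_at_def)
    from coef1_pull[OF X Y f this] show ?thesis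
      unfolding z(3) fd_chart_image[OF X c'(1) P z(1,2)] by (simp add: cinv_left[OF X c'(1) z(1)])
  qed
  have left: "fd (cimg c) (coef1 X c (pull_form1 X Y f A) a) (snd c x) b =
      fd ?S (\<lambda>y. ?\<theta> (fd ?S ?\<phi> y a) (?\<phi> y)) (snd c x) b" for a b
    unfolding atS[symmetric] by (subst fd_cong[OF coef xS]) auto
  have u': "tmap X Y f x u d = fd ?S ?\<phi> (snd c x) (u c)" and v': "tmap X Y f x v d = fd ?S ?\<phi> (snd c x) (v c)"
    unfolding atS by (rule tmap_chart[OF X Y f c d] u v)+
  show ?thesis
    unfolding ext_d1_def left u' v' atT[symmetric]
    using differential_pullback_coords[OF S T \<phi> img \<theta> lin xS, of "v c" "u c"] unfolding \<phi>x by simp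
qed

section \<open>Hermitian lines\<close>

abbreviation herm_line_at :: "('b, 'l) line_bundle \<Rightarrow> 'b \<Rightarrow> bool" where
  "herm_line_at L x \<equiv> hermitian_line (fib L x) (vadd L x) (vscl L x) (herm L x)"

abbreviation nonzero_at :: "('b, 'l) line_bundle \<Rightarrow> 'b \<Rightarrow> 'l \<Rightarrow> bool" where
  "nonzero_at L x e \<equiv> e \<in> fib L x \<and> e \<noteq> vscl L x 0 e"

text \<open>A complex line comes with one basis vector in terms of which its operations are given. Every
  other nonzero vector is a multiple of it and serves as well.\<close>

lemma nonzero_basis:
  assumes L: "herm_line_at L x" and e: "nonzero_at L x e"
  shows nonzero_bij: "bij_betw (\<lambda>z. vscl L x z e) UNIV (fib L x)"
    and vadd_vscl: "vadd L x (vscl L x z e) (vscl L x w e) = vscl L x (z + w) e"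
    and vscl_vscl: "vscl L x z (vscl L x w e) = vscl L x (z * w) e"
proof -
  have "complex_line (fib L x) (vadd L x) (vscl L x)" using L by (simp add: hermitian_line_def)
  then obtain b where b: "bij_betw (\<lambda>z. vscl L x z b) UNIV (fib L x)"
    "\<And>z w. vadd L x (vscl L x z b) (vscl L x w b) = vscl L x (z + w) b"
    "\<And>z w. vscl L x z (vscl L x w b) = vscl L x (z * w) b"
    unfolding complex_line_def by auto
  obtain k where k: "e = vscl L x k b" using b(1) e by (auto simp: bij_betw_def)
  have ze: "vscl L x z e = vscl L x (z * k) b" for z by (simp add: k b)
  have "k \<noteq> 0" using e by (auto simp: k b(3))
  then have "bij_betw (\<lambda>z. z * k) UNIV UNIV"
    by (intro bij_betwI[where g = "\<lambda>z. z / k"]) auto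
  from bij_betw_trans[OF this b(1)] show "bij_betw (\<lambda>z. vscl L x z e) UNIV (fib L x)"
    by (simp add: o_def ze)
  show "vadd L x (vscl L x z e) (vscl L x w e) = vscl L x (z + w) e"
    by (simp add: ze b distrib_right)
  show "vscl L x z (vscl L x w e) = vscl L x (z * w) e"
    by (simp add: ze b mult.assoc)
qed

lemma vscl_in_fib: "herm_line_at L x \<Longrightarrow> nonzero_at L x e \<Longrightarrow> vscl L x z e \<in> fib L x"
  using bij_betw_imp_surj_on[OF nonzero_bij, of L x e] by auto

lemma vscl_eq_iff: "herm_line_at L x \<Longrightarrow> nonzero_at L x e \<Longrightarrow> vscl L x z e = vscl L x w e \<longleftrightarrow> z = w"
  using inj_on_eq_iff[OF bij_betw_imp_inj_on[OF nonzero_bij, of L x e], of z w] by simp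

lemma ratio_vscl: "herm_line_at L x \<Longrightarrow> nonzero_at L x e \<Longrightarrow> ratio L x (vscl L x z e) e = z"
  unfolding ratio_def by (rule the_equality) (auto simp: vscl_eq_iff)

lemma vscl_ratio:
  assumes "herm_line_at L x" "nonzero_at L x e" "a \<in> fib L x" shows "vscl L x (ratio L x a e) e = a"
proof -
  obtain z where "a = vscl L x z e"
    using bij_betw_imp_surj_on[OF nonzero_bij[OF assms(1,2)]] assms(3) by auto
  then show ?thesis by (simp add: ratio_vscl[OF assms(1,2)])
qed

lemma herm_vscl_left:
  "herm_line_at L x \<Longrightarrow> a \<in> fib L x \<Longrightarrow> b \<in> fib L x \<Longrightarrow> herm L x (vscl L x z a) b = z * herm L x a b"
  unfolding hermitian_line_def by blast

lemma herm_vadd: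
  "herm_line_at L x \<Longrightarrow> a \<in> fib L x \<Longrightarrow> b \<in> fib L x \<Longrightarrow> c \<in> fib L x \<Longrightarrow>
    herm L x (vadd L x a b) c = herm L x a c + herm L x b c"
  unfolding hermitian_line_def by blast

lemma herm_sym: "herm_line_at L x \<Longrightarrow> a \<in> fib L x \<Longrightarrow> b \<in> fib L x \<Longrightarrow> herm L x b a = cnj (herm L x a b)"
  unfolding hermitian_line_def by blast

lemma herm_vscl:
  assumes "herm_line_at L x" "nonzero_at L x e"
  shows "herm L x (vscl L x z e) (vscl L x w e) = z * cnj w * herm L x e e"
proof -
  have "herm L x (vscl L x z e) (vscl L x w e) = z * herm L x e (vscl L x w e)"
    using assms vscl_in_fib[OF assms] by (simp add: herm_vscl_left)
  also have "herm L x e (vscl L x w e) = cnj (herm L x (vscl L x w e) e)"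
    using assms vscl_in_fib[OF assms] by (intro herm_sym) auto
  also have "\<dots> = cnj w * cnj (herm L x e e)" using assms by (simp add: herm_vscl_left)
  also have "cnj (herm L x e e) = herm L x e e" using assms by (intro herm_sym[symmetric]) auto
  finally show ?thesis by simp
qed

lemma herm_positive:
  assumes "herm_line_at L x" "nonzero_at L x e"
  shows "Re (herm L x e e) > 0" "herm L x e e = of_real (Re (herm L x e e))"
proof -
  have "Im (herm L x e e) = 0 \<and> Re (herm L x e e) > 0"
    using assms unfolding hermitian_line_def by blast
  then show "Re (herm L x e e) > 0" "herm L x e e = of_real (Re (herm L x e e))"
    by (simp_all add: complex_eq_iff)
qed

lemma unit_nonzero:
  assumes "herm_line_at L x" "e \<in> fib L x" "herm L x e e = 1" shows "nonzero_at L x e"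
  using herm_vscl_left[OF assms(1,2,2), of 0] assms(2,3) by auto

lemma vscl_herm_unit:
  assumes L: "herm_line_at L x" and e: "e \<in> fib L x" "herm L x e e = 1" and a: "a \<in> fib L x"
  shows "vscl L x (herm L x a e) e = a"
proof -
  have nz: "nonzero_at L x e" using unit_nonzero[OF L e] .
  have "herm L x (vscl L x (ratio L x a e) e) e = ratio L x a e * herm L x e e"
    using L e by (simp add: herm_vscl_left)
  then show ?thesis using vscl_ratio[OF L nz a] e by simp
qed

section \<open>Sections of Hermitian line bundles\<close>

lemma bundle_line: "hermitian_line_bundle X L \<Longrightarrow> x \<in> topspace (mtop X) \<Longrightarrow> herm_line_at L x"
  unfolding hermitian_line_bundle_def by blast

lemma bundle_frame:
  assumes "hermitian_line_bundle X L" "(W, e) \<in> frames L"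
  shows frame_openin: "openin (mtop X) W"
    and frame_nonzero: "x \<in> W \<Longrightarrow> nonzero_at L x (e x)"
    and frame_norm: "smooth_fun X W (\<lambda>x. herm L x (e x) (e x))"
  using assms unfolding hermitian_line_bundle_def by blast+

lemma frame_exists:
  assumes "hermitian_line_bundle X L" "x \<in> topspace (mtop X)"
  obtains W e where "(W, e) \<in> frames L" "x \<in> W"
  using assms unfolding hermitian_line_bundle_def by blast

lemma frame_section:
  assumes "hermitian_line_bundle X L" "(W, e) \<in> frames L" shows "smooth_section X L W e"
  unfolding smooth_section_def
proof (intro conjI ballI)
  show "openin (mtop X) W" using frame_openin[OF assms] .
  show "e x \<in> fib L x" if "x \<in> W" for x using frame_nonzero[OF assms that] by simp
  have ratios: "\<forall>(V, b)\<in>frames L. \<forall>(W, e)\<in>frames L. smooth_fun X (V \<inter> W) (\<lambda>x. ratio L x (e x) (b x))"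
    using assms(1) by (simp add: hermitian_line_bundle_def)
  fix F assume "F \<in> frames L"
  then show "case F of (V, b) \<Rightarrow> smooth_fun X (W \<inter> V) (\<lambda>x. ratio L x (e x) (b x))"
    using bspec[OF ratios, of F] assms(2) by (cases F) (auto simp: Int_commute)
qed

lemma section_props:
  assumes "smooth_section X L W s"
  shows section_openin: "openin (mtop X) W"
    and section_in: "x \<in> W \<Longrightarrow> s x \<in> fib L x"
    and section_ratio: "(V, e) \<in> frames L \<Longrightarrow> smooth_fun X (W \<inter> V) (\<lambda>x. ratio L x (s x) (e x))"
  using assms unfolding smooth_section_def by blast+

lemma section_subset:
  assumes X: "charted X" and L: "hermitian_line_bundle X L"
    and s: "smooth_section X L W s" and W': "openin (mtop X) W'" "W' \<subseteq> W"
  shows "smooth_section X L W' s"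
  unfolding smooth_section_def
proof (intro conjI ballI)
  show "s x \<in> fib L x" if "x \<in> W'" for x using section_in[OF s] that W' by auto
  show "case F of (V, e) \<Rightarrow> smooth_fun X (W' \<inter> V) (\<lambda>x. ratio L x (s x) (e x))" if "F \<in> frames L" for F
  proof (cases F)
    case (Pair V e)
    then have F: "(V, e) \<in> frames L" using that by simp
    have V: "openin (mtop X) V" using frame_openin[OF L F] .
    have "smooth_fun X (W' \<inter> V) (\<lambda>x. ratio L x (s x) (e x))"
      by (rule smooth_fun_subset[OF X _ _ _ section_ratio[OF s F]])
        (use V W' section_openin[OF s] in auto)
    then show ?thesis by (simp add: Pair)
  qed
qed (rule W')

lemma section_cong:
  assumes X: "charted X" and L: "hermitian_line_bundle X L"
    and s: "smooth_section X L W s" and eq: "\<And>x. x \<in> W \<Longrightarrow> s x = s' x"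
  shows "smooth_section X L W s'"
  unfolding smooth_section_def
proof (intro conjI ballI)
  show "openin (mtop X) W" using section_openin[OF s] .
  show "s' x \<in> fib L x" if "x \<in> W" for x using section_in[OF s that] eq[OF that] by simp
  show "case F of (V, e) \<Rightarrow> smooth_fun X (W \<inter> V) (\<lambda>x. ratio L x (s' x) (e x))" if "F \<in> frames L" for F
  proof (cases F)
    case (Pair V e)
    then have F: "(V, e) \<in> frames L" using that by simp
    have "smooth_fun X (W \<inter> V) (\<lambda>x. ratio L x (s' x) (e x))"
      by (rule smooth_fun_cong[OF X, THEN iffD1, OF _ section_ratio[OF s F]]) (simp add: eq)
    then show ?thesis by (simp add: Pair)
  qed
qed

lemma section_local:
  assumes X: "charted X" and L: "hermitian_line_bundle X L" and W: "openin (mtop X) W"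
    and loc: "\<And>x. x \<in> W \<Longrightarrow> \<exists>W'. openin (mtop X) W' \<and> x \<in> W' \<and> W' \<subseteq> W \<and> smooth_section X L W' s"
  shows "smooth_section X L W s"
  unfolding smooth_section_def
proof (intro conjI ballI)
  show "s x \<in> fib L x" if x: "x \<in> W" for x
  proof -
    obtain W' where W': "x \<in> W'" "smooth_section X L W' s" using loc[OF x] by blast
    show ?thesis by (rule section_in[OF W'(2,1)])
  qed
  show "case F of (V, e) \<Rightarrow> smooth_fun X (W \<inter> V) (\<lambda>x. ratio L x (s x) (e x))" if "F \<in> frames L" for F
  proof (cases F)
    case (Pair V e)
    then have F: "(V, e) \<in> frames L" using that by simp
    have V: "openin (mtop X) V" using frame_openin[OF L F] .
    have "smooth_fun X (W \<inter> V) (\<lambda>x. ratio L x (s x) (e x))"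
    proof (rule smooth_fun_local[OF X openin_Int[OF W V]])
      fix x assume x: "x \<in> W \<inter> V"
      then obtain W' where W': "openin (mtop X) W'" "x \<in> W'" "W' \<subseteq> W" "smooth_section X L W' s"
        using loc by blast
      then show "\<exists>Q. openin (mtop X) Q \<and> x \<in> Q \<and> Q \<subseteq> W \<inter> V \<and> smooth_fun X Q (\<lambda>x. ratio L x (s x) (e x))"
        using x section_ratio[OF W'(4) F] openin_Int[OF W'(1) V] by (intro exI[of _ "W' \<inter> V"]) auto
    qed
    then show ?thesis by (simp add: Pair)
  qed
qed (rule W)

text \<open>With \<open>s'\<close> a unitary frame this is the smoothness of the coordinate of \<open>s\<close>. The coordinate is then
  \<open>H(s, s')\<close>, which is additive and homogeneous by axiom, unlike the definite description
  \<open>ratio\<close>.\<close>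

lemma smooth_fun_herm:
  assumes X: "charted X" and L: "hermitian_line_bundle X L"
    and s: "smooth_section X L W s" and s': "smooth_section X L W' s'"
  shows "smooth_fun X (W \<inter> W') (\<lambda>x. herm L x (s x) (s' x))"
proof (rule smooth_fun_local[OF X])
  have W: "openin (mtop X) W" "openin (mtop X) W'" using section_openin[OF s] section_openin[OF s'] .
  show "openin (mtop X) (W \<inter> W')" using W by blast
  fix x assume x: "x \<in> W \<inter> W'"
  then have "x \<in> topspace (mtop X)" using W openin_subset by blast
  then obtain V e where F: "(V, e) \<in> frames L" "x \<in> V" using frame_exists[OF L] by metis
  have V: "openin (mtop X) V" using frame_openin[OF L F(1)] .
  let ?Q = "W \<inter> W' \<inter> V"
  have Q: "openin (mtop X) ?Q" using W V by blast
  have 1: "smooth_fun X ?Q (\<lambda>x. ratio L x (s x) (e x))"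
    by (rule smooth_fun_subset[OF X _ Q _ section_ratio[OF s F(1)]]) (use W V in auto)
  have 2: "smooth_fun X ?Q (\<lambda>x. cnj (ratio L x (s' x) (e x)))"
    by (intro smooth_fun_bounded_linear[OF bounded_linear_cnj X Q]
        smooth_fun_subset[OF X _ Q _ section_ratio[OF s' F(1)]]) (use W V in auto)
  have 3: "smooth_fun X ?Q (\<lambda>x. herm L x (e x) (e x))"
    by (rule smooth_fun_subset[OF X V Q _ frame_norm[OF L F(1)]]) auto
  have "smooth_fun X ?Q (\<lambda>x. ratio L x (s x) (e x) * cnj (ratio L x (s' x) (e x)) * herm L x (e x) (e x))"
    by (intro smooth_fun_mult X Q 1 2 3)
  then have "smooth_fun X ?Q (\<lambda>x. herm L x (s x) (s' x))"
  proof (rule smooth_fun_cong[OF X, THEN iffD1, rotated])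
    fix y assume y: "y \<in> ?Q"
    have Ly: "herm_line_at L y" using bundle_line[OF L] y W openin_subset by blast
    have ey: "nonzero_at L y (e y)" using frame_nonzero[OF L F(1)] y by blast
    have "s y \<in> fib L y" "s' y \<in> fib L y" using section_in[OF s] section_in[OF s'] y by blast+
    then show "ratio L y (s y) (e y) * cnj (ratio L y (s' y) (e y)) * herm L y (e y) (e y) = herm L y (s y) (s' y)"
      using herm_vscl[OF Ly ey, of "ratio L y (s y) (e y)" "ratio L y (s' y) (e y)"]
      by (simp add: vscl_ratio[OF Ly ey])
  qed
  then show "\<exists>Q. openin (mtop X) Q \<and> x \<in> Q \<and> Q \<subseteq> W \<inter> W' \<and> smooth_fun X Q (\<lambda>x. herm L x (s x) (s' x))"
    using Q x F by (intro exI[of _ ?Q]) auto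
qed

lemma section_scale:
  assumes X: "charted X" and L: "hermitian_line_bundle X L"
    and s: "smooth_section X L W s" and h: "smooth_fun X W h"
  shows "smooth_section X L W (\<lambda>x. vscl L x (h x) (s x))"
proof -
  have W: "openin (mtop X) W" using section_openin[OF s] .
  have eq: "vscl L x (h x) (s x) = vscl L x (h x * ratio L x (s x) (e x)) (e x)"
      "vscl L x (h x) (s x) \<in> fib L x"
      "ratio L x (vscl L x (h x) (s x)) (e x) = h x * ratio L x (s x) (e x)"
    if F: "(V, e) \<in> frames L" and x: "x \<in> W" "x \<in> V" for V e x
  proof -
    have Lx: "herm_line_at L x" using bundle_line[OF L] x W openin_subset by blast
    have ex: "nonzero_at L x (e x)" using frame_nonzero[OF L F x(2)] .
    show 1: "vscl L x (h x) (s x) = vscl L x (h x * ratio L x (s x) (e x)) (e x)"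
      using vscl_vscl[OF Lx ex, of "h x" "ratio L x (s x) (e x)"] vscl_ratio[OF Lx ex section_in[OF s x(1)]] by simp
    show "vscl L x (h x) (s x) \<in> fib L x" unfolding 1 using vscl_in_fib[OF Lx ex] .
    show "ratio L x (vscl L x (h x) (s x)) (e x) = h x * ratio L x (s x) (e x)"
      unfolding 1 by (rule ratio_vscl[OF Lx ex])
  qed
  show ?thesis
    unfolding smooth_section_def
  proof (intro conjI ballI)
    fix x assume x: "x \<in> W"
    then have "x \<in> topspace (mtop X)" using W openin_subset by blast
    then obtain V e where "(V, e) \<in> frames L" "x \<in> V" using frame_exists[OF L] by metis
    then show "vscl L x (h x) (s x) \<in> fib L x" using eq(2) x by blast
  next
    fix F assume "F \<in> frames L"
    moreover obtain V e where "F = (V, e)" by (cases F)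
    ultimately have F: "F = (V, e)" "(V, e) \<in> frames L" by simp_all
    have V: "openin (mtop X) V" using frame_openin[OF L F(2)] .
    have "smooth_fun X (W \<inter> V) (\<lambda>x. h x * ratio L x (s x) (e x))"
      by (intro smooth_fun_mult X openin_Int W V section_ratio[OF s F(2)] smooth_fun_subset[OF X W _ _ h]) auto
    then have "smooth_fun X (W \<inter> V) (\<lambda>x. ratio L x (vscl L x (h x) (s x)) (e x))"
      by (rule smooth_fun_cong[OF X, THEN iffD1, rotated]) (use eq(3)[OF F(2)] in auto)
    then show "case F of (V, e) \<Rightarrow> smooth_fun X (W \<inter> V) (\<lambda>x. ratio L x (vscl L x (h x) (s x)) (e x))"
      by (simp add: F)
  qed (rule W)
qed

lemma unitary_frame_props:
  assumes "unitary_frame X L W e"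
  shows unitary_section: "smooth_section X L W e"
    and unitary_openin: "openin (mtop X) W"
    and unitary_in: "x \<in> W \<Longrightarrow> e x \<in> fib L x"
    and unitary_norm: "x \<in> W \<Longrightarrow> herm L x (e x) (e x) = 1"
proof -
  show s: "smooth_section X L W e" using assms by (simp add: unitary_frame_def)
  show "openin (mtop X) W" using section_openin[OF s] .
  show "e x \<in> fib L x" if "x \<in> W" using section_in[OF s that] .
  show "herm L x (e x) (e x) = 1" if "x \<in> W" using assms that by (simp add: unitary_frame_def)
qed

lemma section_in_unitary_frame:
  assumes X: "charted X" and L: "hermitian_line_bundle X L" and e: "unitary_frame X L W e"
    and W': "openin (mtop X) W'" "W' \<subseteq> W" and h: "smooth_fun X W' h"
    and s: "\<And>x. x \<in> W' \<Longrightarrow> s x = vscl L x (h x) (e x)"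
  shows "smooth_section X L W' s"
  by (rule section_cong[OF X L section_scale[OF X L section_subset[OF X L unitary_section[OF e] W'] h]])
    (simp add: s)

section \<open>Local connection forms\<close>

text \<open>The connection is \<open>d - \<i> A\<close> in the unitary frame \<open>e\<close>: the section \<open>s = h e\<close> has the coordinate
  \<open>h = H(s, e)\<close> and the derivative \<open>(dh - \<i> A h) e\<close>.\<close>

definition conn_form ::
  "('b, 'e::euclidean_space) smooth_space \<Rightarrow> ('b, 'l) line_bundle \<Rightarrow> ('b, 'e, 'l) conn \<Rightarrow>
   'b set \<Rightarrow> ('b \<Rightarrow> 'l) \<Rightarrow> ('b, 'e) form1 \<Rightarrow> bool" where
  "conn_form X L D W e A \<longleftrightarrow> unitary_frame X L W e \<and> one_form_on X W A \<and>
     (\<forall>W' s. smooth_section X L W' s \<longrightarrow> (\<forall>x\<in>W \<inter> W'. \<forall>v\<in>tangent X x.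
        D s x v = vscl L x (ddir X (\<lambda>y. herm L y (s y) (e y)) x v -
          \<i> * of_real (A x v) * herm L x (s x) (e x)) (e x)))"

lemma conn_formD:
  assumes "conn_form X L D W e A"
  shows conn_form_frame: "unitary_frame X L W e"
    and conn_form_one_form: "one_form_on X W A"
    and conn_form_eq: "smooth_section X L W' s \<Longrightarrow> x \<in> W \<Longrightarrow> x \<in> W' \<Longrightarrow> v \<in> tangent X x \<Longrightarrow>
      D s x v = vscl L x (ddir X (\<lambda>y. herm L y (s y) (e y)) x v -
          \<i> * of_real (A x v) * herm L x (s x) (e x)) (e x)"
  using assms unfolding conn_form_def by blast+

text \<open>Divide a frame by its norm.\<close>

lemma unitary_frame_exists:
  assumes X: "charted X" and L: "hermitian_line_bundle X L" and x: "x \<in> topspace (mtop X)"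
  obtains W e where "unitary_frame X L W e" "x \<in> W"
proof -
  obtain W b where F: "(W, b) \<in> frames L" "x \<in> W" using frame_exists[OF L x] .
  have W: "openin (mtop X) W" using frame_openin[OF L F(1)] .
  define n where "n = (\<lambda>y. Re (herm L y (b y) (b y)))"
  define r where "r = (\<lambda>y. complex_of_real (n y powr (- 1 / 2)))"
  define e where "e = (\<lambda>y. vscl L y (r y) (b y))"
  have Ly: "herm_line_at L y" if "y \<in> W" for y using bundle_line[OF L] that W openin_subset by blast
  have n: "n y > 0" "herm L y (b y) (b y) = of_real (n y)" if "y \<in> W" for y
    using herm_positive[OF Ly[OF that] frame_nonzero[OF L F(1) that]] by (simp_all add: n_def)
  have "smooth_fun X W n"
    unfolding n_def by (intro smooth_fun_bounded_linear[OF bounded_linear_Re X W] frame_norm[OF L F(1)])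
  then have "smooth_fun X W r"
    unfolding r_def
    by (intro smooth_fun_bounded_linear[OF bounded_linear_of_real X W] smooth_fun_powr[OF X W _ n(1)])
  then have "smooth_section X L W e"
    unfolding e_def by (rule section_scale[OF X L frame_section[OF L F(1)]])
  moreover have "herm L y (e y) (e y) = 1" if y: "y \<in> W" for y
  proof -
    have "n y powr (- 1 / 2) * n y powr (- 1 / 2) = n y powr - 1"
      by (subst powr_add[symmetric]) simp
    then have "n y powr (- 1 / 2) * n y powr (- 1 / 2) * n y = 1"
      using n(1)[OF y] by (simp add: powr_neg_one)
    then have "r y * cnj (r y) * of_real (n y) = 1"
      by (simp add: r_def flip: of_real_mult)
    then show ?thesis
      using herm_vscl[OF Ly[OF y] frame_nonzero[OF L F(1) y], of "r y" "r y"] n(2)[OF y] by (simp add: e_def)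
  qed
  ultimately have "unitary_frame X L W e" by (simp add: unitary_frame_def)
  then show ?thesis using that F by blast
qed

lemma connectionD:
  assumes D: "is_connection X L D" and s: "smooth_section X L W s" and x: "x \<in> W" and v: "v \<in> tangent X x"
  shows connection_in: "D s x v \<in> fib L x"
    and connection_linear: "w \<in> tangent X x \<Longrightarrow> D s x (tcomb a v b w) =
          vadd L x (vscl L x (of_real a) (D s x v)) (vscl L x (of_real b) (D s x w))"
    and connection_smooth: "c \<in> atlas X \<Longrightarrow> smooth_section X L (W \<inter> fst c) (\<lambda>x. D s x (coord_vec X c x k))"
    and connection_local: "smooth_section X L W s' \<Longrightarrow> \<forall>x\<in>W. s x = s' x \<Longrightarrow> D s x v = D s' x v"
    and connection_leibniz: "smooth_fun X W f \<Longrightarrow> D (\<lambda>y. vscl L y (f y) (s y)) x v =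
             vadd L x (vscl L x (ddir X f x v) (s x)) (vscl L x (f x) (D s x v))"
  using D[unfolded is_connection_def, rule_format, OF s] x v by blast+

text \<open>In a unitary frame, \<open>De = k e\<close> with \<open>k + cnj k = d H(e, e) = 0\<close>, so \<open>k = - \<i> A\<close> with \<open>A\<close> real. The
  value on other sections follows from the Leibniz rule.\<close>

lemma conn_form_exists:
  assumes X: "charted X" and L: "hermitian_line_bundle X L" and D: "hermitian_connection X L D"
    and x: "x \<in> topspace (mtop X)"
  obtains W e A where "conn_form X L D W e A" "x \<in> W"
proof -
  obtain W e where e: "unitary_frame X L W e" and xW: "x \<in> W" using unitary_frame_exists[OF X L x] .
  have es: "smooth_section X L W e" and W: "openin (mtop X) W"
    using unitary_section[OF e] unitary_openin[OF e] .
  have conn: "is_connection X L D" using D by (simp add: hermitian_connection_def)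
  have Ly: "herm_line_at L y" if "y \<in> W" for y using bundle_line[OF L] that W openin_subset by blast
  have unit: "e y \<in> fib L y" "herm L y (e y) (e y) = 1" if "y \<in> W" for y
    using unitary_in[OF e that] unitary_norm[OF e that] .
  have nz: "nonzero_at L y (e y)" if "y \<in> W" for y
    using unit_nonzero[OF Ly[OF that] unit[OF that]] .
  define k where "k = (\<lambda>y v. herm L y (D e y v) (e y))"
  define A where "A = (\<lambda>y v. - Im (k y v))"
  have De: "D e y v = vscl L y (k y v) (e y)" if "y \<in> W" "v \<in> tangent X y" for y v
    using vscl_herm_unit[OF Ly unit connection_in[OF conn es]] that by (simp add: k_def)
  have k: "k y v = - \<i> * of_real (A y v)" if y: "y \<in> W" and v: "v \<in> tangent X y" for y v
  proof -
    have in': "D e y v \<in> fib L y" using connection_in[OF conn es y v] .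
    have "ddir X (\<lambda>z. herm L z (e z) (e z)) y v = herm L y (D e y v) (e y) + herm L y (e y) (D e y v)"
      using D es y v unfolding hermitian_connection_def by blast
    also have "herm L y (e y) (D e y v) = cnj (k y v)"
      unfolding k_def using herm_sym[OF Ly[OF y] in' unit(1)[OF y]] .
    also have "ddir X (\<lambda>z. herm L z (e z) (e z)) y v = ddir X (\<lambda>_. 1) y v"
      by (rule ddir_cong[OF X W y]) (simp add: unit)
    also have "\<dots> = 0" by (rule ddir_const[OF X W y v])
    finally have "Re (k y v) = 0" by (simp add: k_def complex_eq_iff)
    then show ?thesis by (simp add: A_def complex_eq_iff)
  qed
  have "one_form_on X W A"
    unfolding one_form_on_def
  proof (intro conjI ballI allI)
    fix y assume y: "y \<in> W"
    show "linear_on_set (tangent X y) (A y)"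
      unfolding linear_on_set_def
    proof (intro ballI allI)
      fix v w and a b :: real assume v: "v \<in> tangent X y" "w \<in> tangent X y"
      have "y \<in> topspace (mtop X)" using y W openin_subset by blast
      then have t: "tcomb a v b w \<in> tangent X y" using tangent_tcomb[OF X _ v] by blast
      have "vscl L y (k y (tcomb a v b w)) (e y) = vscl L y (of_real a * k y v + of_real b * k y w) (e y)"
        using connection_linear[OF conn es y v(1,2), of a b]
        unfolding De[OF y v(1)] De[OF y v(2)] De[OF y t] vscl_vscl[OF Ly[OF y] nz[OF y]]
          vadd_vscl[OF Ly[OF y] nz[OF y]] .
      then have "k y (tcomb a v b w) = of_real a * k y v + of_real b * k y w"
        using vscl_eq_iff[OF Ly[OF y] nz[OF y]] by blast
      then show "A y (tcomb a v b w) = a * A y v + b * A y w"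
        by (simp add: A_def algebra_simps)
    qed
  next
    fix c a assume c: "c \<in> atlas X"
    have cW: "openin (mtop X) (W \<inter> fst c)" using W chart_openin[OF X c] by blast
    show "smooth_on (snd c ` (fst c \<inter> W)) (coef1 X c A a)"
    \<comment> \<open>\<open>connection_smooth\<close> can only be used in the presence of a point and a tangent vector\<close>
    proof (cases "W \<inter> fst c = {}")
      case True
      then have "snd c ` (fst c \<inter> W) = {}" by auto
      then show ?thesis using smooth_on_local[of "{}" "coef1 X c A a"] by simp
    next
      case False
      then obtain z where z: "z \<in> W" "z \<in> fst c" by auto
      have "chart_at X z c" using z c by (simp add: chart_at_def)
      then have "coord_vec X c z a \<in> tangent X z" by (rule coord_vec_in_tangent[OF X])
      from connection_smooth[OF conn es z(1) this c, of a]
      have "smooth_fun X (W \<inter> fst c \<inter> W) (\<lambda>y. k y (coord_vec X c y a))"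
        unfolding k_def by (rule smooth_fun_herm[OF X L _ es])
      moreover have "openin (mtop X) (W \<inter> fst c \<inter> W)" using cW W by blast
      ultimately have "smooth_fun X (W \<inter> fst c \<inter> W) (\<lambda>y. A y (coord_vec X c y a))"
        unfolding A_def
        by (intro smooth_fun_bounded_linear[OF bounded_linear_minus[OF bounded_linear_Im] X])
      then have "smooth_on (snd c ` (fst c \<inter> (W \<inter> fst c \<inter> W))) ((\<lambda>y. A y (coord_vec X c y a)) \<circ> cinv c)"
        using c by (simp add: smooth_fun_def)
      moreover have "fst c \<inter> (W \<inter> fst c \<inter> W) = fst c \<inter> W" by auto
      ultimately show ?thesis by (simp add: coef1_def o_def)
    qed
  qed
  moreover have "D s y v = vscl L y (ddir X (\<lambda>y. herm L y (s y) (e y)) y v -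
          \<i> * of_real (A y v) * herm L y (s y) (e y)) (e y)"
    if s: "smooth_section X L W' s" and y: "y \<in> W" "y \<in> W'" and v: "v \<in> tangent X y" for W' s y v
  proof -
    let ?h = "\<lambda>y. herm L y (s y) (e y)"
    have h: "smooth_fun X (W' \<inter> W) ?h" by (rule smooth_fun_herm[OF X L s es])
    have Q: "openin (mtop X) (W' \<inter> W)" using section_openin[OF s] W by blast
    have eQ: "smooth_section X L (W' \<inter> W) e" by (rule section_subset[OF X L es Q]) simp
    have sQ: "smooth_section X L (W' \<inter> W) s" by (rule section_subset[OF X L s Q]) simp
    have yQ: "y \<in> W' \<inter> W" using y by simp
    have eq: "\<forall>z\<in>W' \<inter> W. s z = vscl L z (?h z) (e z)"
      using vscl_herm_unit[OF Ly unit section_in[OF s]] by simp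
    have "D s y v = D (\<lambda>z. vscl L z (?h z) (e z)) y v"
      by (rule connection_local[OF conn sQ yQ v section_scale[OF X L eQ h] eq])
    also have "\<dots> = vadd L y (vscl L y (ddir X ?h y v) (e y)) (vscl L y (?h y) (D e y v))"
      by (rule connection_leibniz[OF conn eQ yQ v h])
    also have "\<dots> = vscl L y (ddir X ?h y v - \<i> * of_real (A y v) * ?h y) (e y)"
      unfolding De[OF y(1) v] vscl_vscl[OF Ly[OF y(1)] nz[OF y(1)]] vadd_vscl[OF Ly[OF y(1)] nz[OF y(1)]] k[OF y(1) v]
      by (simp add: algebra_simps)
    finally show ?thesis .
  qed
  ultimately have "conn_form X L D W e A" unfolding conn_form_def using e by blast
  then show ?thesis using that xW by blast
qed

text \<open>All axioms are local and hold for \<open>d - \<i> A\<close>; compatibility with the metric holds because \<open>A\<close> is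
  real.\<close>

lemma hermitian_connection_of_conn_forms:
  assumes X: "charted X" and L: "hermitian_line_bundle X L"
    and D: "\<And>x. x \<in> topspace (mtop X) \<Longrightarrow> \<exists>W e A. x \<in> W \<and> conn_form X L D W e A"
  shows "hermitian_connection X L D"
proof -
  have line: "herm_line_at L x" if "smooth_section X L W s" "x \<in> W" for W s x
    using bundle_line[OF L] section_openin[OF that(1)] openin_subset that(2) by blast
  have top: "x \<in> topspace (mtop X)" if "smooth_section X L W s" "x \<in> W" for W s x
    using section_openin[OF that(1)] openin_subset that(2) by blast
  have conn: "is_connection X L D"
    unfolding is_connection_def
  proof (intro allI impI conjI ballI)
    fix W s x v
    assume s: "smooth_section X L W s" and x: "x \<in> W" and v: "v \<in> tangent X x"
    obtain V e A where xV: "x \<in> V" and E: "conn_form X L D V e A" using D[OF top[OF s x]] by blast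
    note e = conn_form_frame[OF E]
    have Lx: "herm_line_at L x" using line[OF s x] .
    note unit = unitary_in[OF e xV] unitary_norm[OF e xV]
    note nz = unit_nonzero[OF Lx unit]
    have V: "openin (mtop X) V" using unitary_openin[OF e] .
    have W: "openin (mtop X) W" using section_openin[OF s] .
    have Q: "openin (mtop X) (W \<inter> V)" "x \<in> W \<inter> V" using W V x xV by auto
    let ?h = "\<lambda>y. herm L y (s y) (e y)"
    have h: "smooth_fun X (W \<inter> V) ?h" by (rule smooth_fun_herm[OF X L s unitary_section[OF e]])
    have sx: "s x = vscl L x (?h x) (e x)" using vscl_herm_unit[OF Lx unit section_in[OF s x]] by simp
    note Ds = conn_form_eq[OF E s xV x]
    have A: "linear_on_set (tangent X x) (A x)" using conn_form_one_form[OF E] xV unfolding one_form_on_def by blast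
    show "D s x v \<in> fib L x" unfolding Ds[OF v] by (rule vscl_in_fib[OF Lx nz])
    show "D s x (tcomb a v b w) = vadd L x (vscl L x (of_real a) (D s x v)) (vscl L x (of_real b) (D s x w))"
      if w: "w \<in> tangent X x" for w a b
    proof -
      have t: "tcomb a v b w \<in> tangent X x" by (rule tangent_tcomb[OF X top[OF s x] v w])
      have "A x (tcomb a v b w) = a * A x v + b * A x w"
        using A v w unfolding linear_on_set_def by blast
      then show ?thesis
        unfolding Ds[OF v] Ds[OF w] Ds[OF t] vscl_vscl[OF Lx nz] vadd_vscl[OF Lx nz]
          ddir_tcomb[OF X Q(1) h Q(2) v w]
        by (simp add: scaleR_conv_of_real algebra_simps)
    qed
    show "D s x v = D s' x v" if s': "smooth_section X L W s'" and eq: "\<forall>x\<in>W. s x = s' x" for s'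
    proof -
      have "ddir X ?h x v = ddir X (\<lambda>y. herm L y (s' y) (e y)) x v"
        by (rule ddir_cong[OF X W x]) (use eq in simp)
      then show ?thesis
        unfolding Ds[OF v] conn_form_eq[OF E s' xV x v] using eq x by simp
    qed
    show "D (\<lambda>y. vadd L y (s y) (s' y)) x v = vadd L x (D s x v) (D s' x v)"
      if s': "smooth_section X L W s'" for s'
    proof -
      let ?h' = "\<lambda>y. herm L y (s' y) (e y)"
      let ?t = "\<lambda>y. vadd L y (s y) (s' y)"
      have h': "smooth_fun X (W \<inter> V) ?h'" by (rule smooth_fun_herm[OF X L s' unitary_section[OF e]])
      have ht: "herm L y (?t y) (e y) = ?h y + ?h' y" if "y \<in> W \<inter> V" for y
        using herm_vadd[OF line[OF s] section_in[OF s] section_in[OF s'] unitary_in[OF e]] that by blast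
      have t_eq: "?t y = vscl L y (?h y + ?h' y) (e y)" if y: "y \<in> W \<inter> V" for y
      proof -
        have Ly: "herm_line_at L y" using line[OF s] y by blast
        have u: "e y \<in> fib L y" "herm L y (e y) (e y) = 1" using unitary_in[OF e] unitary_norm[OF e] y by blast+
        show ?thesis
          using vadd_vscl[OF Ly unit_nonzero[OF Ly u], of "?h y" "?h' y"]
            vscl_herm_unit[OF Ly u section_in[OF s]] vscl_herm_unit[OF Ly u section_in[OF s']] y by simp
      qed
      have t: "smooth_section X L (W \<inter> V) ?t"
        by (rule section_in_unitary_frame[OF X L e Q(1) _ smooth_fun_add[OF X Q(1) h h'] t_eq]) auto
      have "ddir X (\<lambda>y. herm L y (?t y) (e y)) x v = ddir X (\<lambda>y. ?h y + ?h' y) x v"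
        by (rule ddir_cong[OF X Q ht])
      also have "\<dots> = ddir X ?h x v + ddir X ?h' x v"
        by (rule ddir_add[OF X Q v h h'])
      finally show ?thesis
        unfolding Ds[OF v] conn_form_eq[OF E s' xV x v] vadd_vscl[OF Lx nz]
          conn_form_eq[OF E t xV Q(2) v] ht[OF Q(2)]
        by (simp add: algebra_simps)
    qed
    show "D (\<lambda>y. vscl L y (f y) (s y)) x v =
        vadd L x (vscl L x (ddir X f x v) (s x)) (vscl L x (f x) (D s x v))"
      if f: "smooth_fun X W f" for f :: "'a \<Rightarrow> complex"
    proof -
      let ?t = "\<lambda>y. vscl L y (f y) (s y)"
      have t: "smooth_section X L W ?t" by (rule section_scale[OF X L s f])
      have fQ: "smooth_fun X (W \<inter> V) f" by (rule smooth_fun_subset[OF X W Q(1) _ f]) simp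
      have ht: "herm L y (?t y) (e y) = f y * ?h y" if "y \<in> W \<inter> V" for y
        using herm_vscl_left[OF line[OF s] section_in[OF s] unitary_in[OF e]] that by blast
      have "ddir X (\<lambda>y. herm L y (?t y) (e y)) x v = ddir X (\<lambda>y. f y * ?h y) x v"
        by (rule ddir_cong[OF X Q ht])
      also have "\<dots> = f x * ddir X ?h x v + ddir X f x v * ?h x"
        by (rule ddir_mult[OF X Q v fQ h])
      finally have d: "ddir X (\<lambda>y. herm L y (?t y) (e y)) x v = f x * ddir X ?h x v + ddir X f x v * ?h x" .
      show ?thesis
        unfolding Ds[OF v] conn_form_eq[OF E t xV x v] ht[OF Q(2)] d
        by (subst (3) sx) (simp add: vadd_vscl[OF Lx nz] vscl_vscl[OF Lx nz] algebra_simps)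
    qed
  next
    fix W s c a
    assume s: "smooth_section X L W s" and c: "c \<in> atlas X"
    have W: "openin (mtop X) (W \<inter> fst c)" using section_openin[OF s] chart_openin[OF X c] by blast
    show "smooth_section X L (W \<inter> fst c) (\<lambda>x. D s x (coord_vec X c x a))"
    proof (rule section_local[OF X L W])
      fix x assume x: "x \<in> W \<inter> fst c"
      obtain V e A where xV: "x \<in> V" and E: "conn_form X L D V e A" using D[OF top[OF s, of x]] x by blast
      note e = conn_form_frame[OF E]
      have V: "openin (mtop X) V" using unitary_openin[OF e] .
      let ?Q = "fst c \<inter> (W \<inter> V)"
      let ?h = "\<lambda>y. herm L y (s y) (e y)"
      have WV: "openin (mtop X) (W \<inter> V)" using section_openin[OF s] V by blast
      have Q: "openin (mtop X) ?Q" using WV chart_openin[OF X c] by blast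
      have h: "smooth_fun X (W \<inter> V) ?h" by (rule smooth_fun_herm[OF X L s unitary_section[OF e]])
      have hQ: "smooth_fun X ?Q ?h" by (rule smooth_fun_subset[OF X WV Q _ h]) blast
      have AQ: "smooth_fun X ?Q (\<lambda>y. A y (coord_vec X c y a))"
        by (rule smooth_fun_subset[OF X _ Q _ one_form_on_coef[OF X V conn_form_one_form[OF E] c]])
          (use V chart_openin[OF X c] in auto)
      have "smooth_fun X ?Q (\<lambda>y. ddir X ?h y (coord_vec X c y a) +
          (- \<i>) * (of_real (A y (coord_vec X c y a)) * ?h y))"
        by (intro smooth_fun_add smooth_fun_mult X Q smooth_fun_const hQ
            smooth_fun_bounded_linear[OF bounded_linear_of_real] AQ smooth_fun_ddir[OF X WV h c])
      then have "smooth_section X L ?Q (\<lambda>x. D s x (coord_vec X c x a))"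
      proof (rule section_in_unitary_frame[OF X L e Q, rotated])
        fix y assume y: "y \<in> ?Q"
        then have "coord_vec X c y a \<in> tangent X y"
          using c by (intro coord_vec_in_tangent[OF X]) (simp add: chart_at_def)
        from conn_form_eq[OF E s _ _ this] y
        show "D s y (coord_vec X c y a) = vscl L y (ddir X ?h y (coord_vec X c y a) +
          (- \<i>) * (of_real (A y (coord_vec X c y a)) * ?h y)) (e y)"
          by (simp add: mult.assoc)
      qed auto
      then show "\<exists>W'. openin (mtop X) W' \<and> x \<in> W' \<and> W' \<subseteq> W \<inter> fst c \<and>
          smooth_section X L W' (\<lambda>x. D s x (coord_vec X c x a))"
        using Q x xV by (intro exI[of _ ?Q]) auto
    qed
  qed
  moreover have "ddir X (\<lambda>y. herm L y (s y) (s' y)) x v = herm L x (D s x v) (s' x) + herm L x (s x) (D s' x v)"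
    if s: "smooth_section X L W s" and s': "smooth_section X L W s'" and x: "x \<in> W" and v: "v \<in> tangent X x"
    for W s s' x v
  proof -
    obtain V e A where xV: "x \<in> V" and E: "conn_form X L D V e A" using D[OF top[OF s x]] by blast
    note e = conn_form_frame[OF E]
    have Lx: "herm_line_at L x" using line[OF s x] .
    note unit = unitary_in[OF e xV] unitary_norm[OF e xV]
    note nz = unit_nonzero[OF Lx unit]
    have Q: "openin (mtop X) (W \<inter> V)" "x \<in> W \<inter> V"
      using section_openin[OF s] unitary_openin[OF e] x xV by auto
    let ?h = "\<lambda>y. herm L y (s y) (e y)"
    let ?h' = "\<lambda>y. herm L y (s' y) (e y)"
    have h: "smooth_fun X (W \<inter> V) ?h" by (rule smooth_fun_herm[OF X L s unitary_section[OF e]])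
    have h': "smooth_fun X (W \<inter> V) ?h'" by (rule smooth_fun_herm[OF X L s' unitary_section[OF e]])
    have ch': "smooth_fun X (W \<inter> V) (\<lambda>y. cnj (?h' y))"
      by (rule smooth_fun_bounded_linear[OF bounded_linear_cnj X Q(1) h'])
    have prod: "herm L y (s y) (s' y) = ?h y * cnj (?h' y)" if y: "y \<in> W \<inter> V" for y
    proof -
      have Ly: "herm_line_at L y" using line[OF s] y by blast
      have u: "e y \<in> fib L y" "herm L y (e y) (e y) = 1" using unitary_in[OF e] unitary_norm[OF e] y by blast+
      show ?thesis
        using herm_vscl[OF Ly unit_nonzero[OF Ly u], of "?h y" "?h' y"]
          vscl_herm_unit[OF Ly u section_in[OF s]] vscl_herm_unit[OF Ly u section_in[OF s']] y u by simp
    qed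
    have sx: "s x = vscl L x (?h x) (e x)" "s' x = vscl L x (?h' x) (e x)"
      using vscl_herm_unit[OF Lx unit] section_in[OF s x] section_in[OF s' x] by simp_all
    have "ddir X (\<lambda>y. herm L y (s y) (s' y)) x v = ddir X (\<lambda>y. ?h y * cnj (?h' y)) x v"
      by (rule ddir_cong[OF X Q prod])
    also have "\<dots> = ?h x * ddir X (\<lambda>y. cnj (?h' y)) x v + ddir X ?h x v * cnj (?h' x)"
      by (rule ddir_mult[OF X Q v h ch'])
    also have "ddir X (\<lambda>y. cnj (?h' y)) x v = cnj (ddir X ?h' x v)"
      by (rule ddir_bounded_linear[OF X Q v bounded_linear_cnj h'])
    also have "?h x * cnj (ddir X ?h' x v) + ddir X ?h x v * cnj (?h' x) =
        herm L x (D s x v) (s' x) + herm L x (s x) (D s' x v)"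
    proof -
      have 1: "herm L x (D s x v) (s' x) = (ddir X ?h x v - \<i> * of_real (A x v) * ?h x) * cnj (?h' x)"
        unfolding conn_form_eq[OF E s xV x v] using herm_vscl[OF Lx nz, of _ "?h' x"] sx(2) unit by simp
      have 2: "herm L x (s x) (D s' x v) = ?h x * cnj (ddir X ?h' x v - \<i> * of_real (A x v) * ?h' x)"
        unfolding conn_form_eq[OF E s' xV x v] using herm_vscl[OF Lx nz, of "?h x"] sx(1) unit by simp
      show ?thesis unfolding 1 2 by (simp add: algebra_simps)
    qed
    finally show ?thesis .
  qed
  ultimately show ?thesis unfolding hermitian_connection_def by blast
qed

lemma conn_form_minus:
  assumes X: "charted X" and L: "hermitian_line_bundle X L" and E: "conn_form X L D W e A"
    and B: "one_form_on X W B"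
  shows "conn_form X L (conn_minus_form L D B) W e (\<lambda>x v. A x v + B x v)"
  unfolding conn_form_def
proof (intro conjI allI impI ballI)
  note e = conn_form_frame[OF E]
  have W: "openin (mtop X) W" by (rule unitary_openin[OF e])
  show "unitary_frame X L W e" by (rule e)
  show "one_form_on X W (\<lambda>x v. A x v + B x v)"
    unfolding one_form_on_def
  proof (intro conjI ballI allI)
    fix x assume "x \<in> W"
    then show "linear_on_set (tangent X x) (\<lambda>v. A x v + B x v)"
      using conn_form_one_form[OF E] B by (simp add: one_form_on_def linear_on_set_def algebra_simps)
  next
    fix c a assume c: "c \<in> atlas X"
    have "smooth_on (snd c ` (fst c \<inter> W)) (\<lambda>y. coef1 X c A a y + coef1 X c B a y)"
      using conn_form_one_form[OF E] B c
      by (intro smooth_on_add chart_image_relopen[OF X c W]) (auto simp: one_form_on_def)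
    then show "smooth_on (snd c ` (fst c \<inter> W)) (coef1 X c (\<lambda>x v. A x v + B x v) a)"
      by (simp add: coef1_def)
  qed
  fix W' s x v
  assume s: "smooth_section X L W' s" and "x \<in> W \<inter> W'" and v: "v \<in> tangent X x"
  then have x: "x \<in> W" "x \<in> W'" by auto
  have Lx: "herm_line_at L x" using bundle_line[OF L] W x(1) openin_subset by blast
  note unit = unitary_in[OF e x(1)] unitary_norm[OF e x(1)]
  note nz = unit_nonzero[OF Lx unit]
  have sx: "s x = vscl L x (herm L x (s x) (e x)) (e x)"
    using vscl_herm_unit[OF Lx unit section_in[OF s x(2)]] by simp
  have "vscl L x z (s x) = vscl L x (z * herm L x (s x) (e x)) (e x)" for z
    using vscl_vscl[OF Lx nz, of z "herm L x (s x) (e x)"] sx by simp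
  then show "conn_minus_form L D B s x v = vscl L x (ddir X (\<lambda>y. herm L y (s y) (e y)) x v -
      \<i> * of_real (A x v + B x v) * herm L x (s x) (e x)) (e x)"
    unfolding conn_minus_form_def conn_form_eq[OF E s x v]
    by (simp add: vadd_vscl[OF Lx nz] algebra_simps)
qed

section \<open>Pullback of bundles and connections\<close>

lemma pull_bundle_simps [simp]:
  "fib (pull_bundle S f L) x = fib L (f x)"
  "vadd (pull_bundle S f L) x = vadd L (f x)"
  "vscl (pull_bundle S f L) x = vscl L (f x)"
  "herm (pull_bundle S f L) x = herm L (f x)"
  "ratio (pull_bundle S f L) x = ratio L (f x)"
  by (simp_all add: pull_bundle_def ratio_def fun_eq_iff)

lemma pull_frames:
  "frames (pull_bundle S f L) = (\<lambda>(W, e). ({x \<in> S. f x \<in> W}, \<lambda>x. e (f x))) ` frames L"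
  by (simp add: pull_bundle_def o_def)

lemma hermitian_line_bundle_pull:
  assumes X: "charted X" and Y: "charted Y" and f: "smooth_map X Y f" and L: "hermitian_line_bundle Y L"
  shows "hermitian_line_bundle X (pull_bundle (topspace (mtop X)) f L)"
  unfolding hermitian_line_bundle_def
proof (intro conjI ballI)
  let ?P = "\<lambda>W. {x \<in> topspace (mtop X). f x \<in> W}"
  let ?L = "pull_bundle (topspace (mtop X)) f L"
  show "herm_line_at ?L x" if "x \<in> topspace (mtop X)" for x
    using bundle_line[OF L smooth_map_in[OF f that]] by simp
  have "(\<Union>(W, e)\<in>frames ?L. W) = ?P (\<Union>(W, e)\<in>frames L. W)"
    unfolding pull_frames by auto
  also have "(\<Union>(W, e)\<in>frames L. W) = topspace (mtop Y)" using L by (simp add: hermitian_line_bundle_def)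
  finally show "(\<Union>(W, e)\<in>frames ?L. W) = topspace (mtop X)" using smooth_map_in[OF f] by auto
  fix F assume "F \<in> frames ?L"
  then obtain W e where F: "F = (?P W, \<lambda>x. e (f x))" "(W, e) \<in> frames L" unfolding pull_frames by auto
  have W: "openin (mtop Y) W" using frame_openin[OF L F(2)] .
  have "openin (mtop X) (?P W)" using smooth_map_openin[OF f W] .
  moreover have "nonzero_at ?L x (e (f x))" if "x \<in> ?P W" for x
    using frame_nonzero[OF L F(2)] that by simp
  moreover have "smooth_fun X (?P W) (\<lambda>x. herm ?L x (e (f x)) (e (f x)))"
    using smooth_fun_compose[OF X Y f W frame_norm[OF L F(2)]] by simp
  ultimately show "case F of (W, e) \<Rightarrow> openin (mtop X) W \<and> (\<forall>x\<in>W. nonzero_at ?L x (e x)) \<and>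
      smooth_fun X W (\<lambda>x. herm ?L x (e x) (e x))"
    by (simp add: F(1))
  have "case F' of (W', e') \<Rightarrow> smooth_fun X (?P W \<inter> W') (\<lambda>x. ratio ?L x (e' x) (e (f x)))"
    if "F' \<in> frames ?L" for F'
  proof -
  from that
  obtain W' e' where F': "F' = (?P W', \<lambda>x. e' (f x))" "(W', e') \<in> frames L" unfolding pull_frames by auto
  have "smooth_fun Y (W \<inter> W') (\<lambda>x. ratio L x (e' x) (e x))"
    using section_ratio[OF frame_section[OF L F'(2)] F(2)] by (simp add: Int_commute)
  from smooth_fun_compose[OF X Y f openin_Int[OF W frame_openin[OF L F'(2)]] this]
  have "smooth_fun X (?P (W \<inter> W')) (\<lambda>x. ratio L (f x) (e' (f x)) (e (f x)))" .
  moreover have "?P (W \<inter> W') = ?P W \<inter> ?P W'" by auto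
  ultimately show ?thesis by (simp add: F'(1))
  qed
  then show "case F of (W, e) \<Rightarrow> \<forall>(W', e')\<in>frames ?L. smooth_fun X (W \<inter> W') (\<lambda>x. ratio ?L x (e' x) (e x))"
    unfolding F(1) prod.case by blast
qed

lemma smooth_section_pull:
  assumes X: "charted X" and Y: "charted Y" and f: "smooth_map X Y f"
    and L: "hermitian_line_bundle Y L" and s: "smooth_section Y L W s"
  shows "smooth_section X (pull_bundle (topspace (mtop X)) f L) {x \<in> topspace (mtop X). f x \<in> W} (\<lambda>x. s (f x))"
  unfolding smooth_section_def
proof (intro conjI ballI)
  let ?P = "\<lambda>W. {x \<in> topspace (mtop X). f x \<in> W}"
  let ?L = "pull_bundle (topspace (mtop X)) f L"
  have W: "openin (mtop Y) W" using section_openin[OF s] .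
  show "openin (mtop X) (?P W)" by (rule smooth_map_openin[OF f W])
  show "s (f x) \<in> fib ?L x" if "x \<in> ?P W" for x using section_in[OF s] that by simp
  fix F assume "F \<in> frames ?L"
  then obtain V e where F: "F = (?P V, \<lambda>x. e (f x))" "(V, e) \<in> frames L" unfolding pull_frames by auto
  from smooth_fun_compose[OF X Y f openin_Int[OF W frame_openin[OF L F(2)]] section_ratio[OF s F(2)]]
  have "smooth_fun X (?P (W \<inter> V)) (\<lambda>x. ratio L (f x) (s (f x)) (e (f x)))" .
  moreover have "?P (W \<inter> V) = ?P W \<inter> ?P V" by auto
  ultimately show "case F of (V, e) \<Rightarrow> smooth_fun X (?P W \<inter> V) (\<lambda>x. ratio ?L x (s (f x)) (e x))"
    by (simp add: F(1))
qed

text \<open>The pulled back connection is defined through a selected frame \<open>b\<close> of \<open>L\<close>. Writing \<open>b = g e\<close>, a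
  section with coordinate \<open>h\<close> in \<open>b\<close> has coordinate \<open>h g\<close> in \<open>e\<close>, and the product rule for \<open>h g\<close>
  removes \<open>b\<close> from the result.\<close>

lemma conn_form_pull:
  assumes X: "charted X" and Y: "charted Y" and f: "smooth_map X Y f"
    and L: "hermitian_line_bundle Y L" and E: "conn_form Y L D W e A"
  shows "conn_form X (pull_bundle (topspace (mtop X)) f L) (pull_conn X Y f L D)
    {x \<in> topspace (mtop X). f x \<in> W} (\<lambda>x. e (f x)) (pull_form1 X Y f A)"
  unfolding conn_form_def
proof (intro conjI allI impI ballI)
  let ?P = "\<lambda>W. {x \<in> topspace (mtop X). f x \<in> W}"
  let ?L = "pull_bundle (topspace (mtop X)) f L"
  note e = conn_form_frame[OF E]
  have W: "openin (mtop Y) W" by (rule unitary_openin[OF e])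
  have PL: "hermitian_line_bundle X ?L" by (rule hermitian_line_bundle_pull[OF X Y f L])
  show "unitary_frame X ?L (?P W) (\<lambda>x. e (f x))"
    using smooth_section_pull[OF X Y f L unitary_section[OF e]] unitary_norm[OF e] by (simp add: unitary_frame_def)
  show "one_form_on X (?P W) (pull_form1 X Y f A)"
    by (rule one_form_on_pull[OF X Y f W conn_form_one_form[OF E]])
  fix W' s x v
  assume s: "smooth_section X ?L W' s" and "x \<in> ?P W \<inter> W'" and v: "v \<in> tangent X x"
  then have x: "x \<in> topspace (mtop X)" "f x \<in> W" "x \<in> W'" by auto
  define F where "F = (SOME F. F \<in> frames L \<and> f x \<in> fst F)"
  have "\<exists>F. F \<in> frames L \<and> f x \<in> fst F"
    using frame_exists[OF L smooth_map_in[OF f x(1)]] by (metis fst_conv)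
  then have "F \<in> frames L \<and> f x \<in> fst F" unfolding F_def by (rule someI_ex)
  then obtain V b where Vb: "F = (V, b)" "(V, b) \<in> frames L" "f x \<in> V" by (cases F) auto
  have V: "openin (mtop Y) V" by (rule frame_openin[OF L Vb(2)])
  have b: "smooth_section Y L V b" by (rule frame_section[OF L Vb(2)])
  define g where "g = (\<lambda>y. herm L y (b y) (e y))"
  define h where "h = (\<lambda>y. ratio L (f y) (s y) (b (f y)))"
  let ?w = "tmap X Y f x v"
  have w: "?w \<in> tangent Y (f x)" by (rule tmap_in_tangent[OF X Y f x(1) v])
  have g: "smooth_fun Y (V \<inter> W) g" unfolding g_def by (rule smooth_fun_herm[OF Y L b unitary_section[OF e]])
  have VW: "openin (mtop Y) (V \<inter> W)" using V W by blast
  have W': "openin (mtop X) W'" by (rule section_openin[OF s])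
  have "(?P V, \<lambda>x. b (f x)) \<in> frames ?L" unfolding pull_frames using Vb(2) by force
  from section_ratio[OF s this] have h: "smooth_fun X (W' \<inter> ?P V) h" by (simp add: h_def)
  let ?Q = "W' \<inter> ?P (V \<inter> W)"
  have Q: "openin (mtop X) ?Q" "x \<in> ?Q"
    using W' smooth_map_openin[OF f VW] x Vb(3) by auto
  have hQ: "smooth_fun X ?Q h"
    by (rule smooth_fun_subset[OF X _ Q(1) _ h]) (use W' smooth_map_openin[OF f V] in auto)
  have gQ: "smooth_fun X ?Q (\<lambda>y. g (f y))"
    by (rule smooth_fun_subset[OF X smooth_map_openin[OF f VW] Q(1) _ smooth_fun_compose[OF X Y f VW g]]) auto
  have Ly: "herm_line_at L (f y)" if "y \<in> ?Q" for y using bundle_line[OF L smooth_map_in[OF f]] that by simp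
  have bf: "b (f y) = vscl L (f y) (g (f y)) (e (f y))" if "y \<in> ?Q" for y
    using vscl_herm_unit[OF Ly[OF that] unitary_in[OF e] unitary_norm[OF e] section_in[OF b]] that
    by (simp add: g_def)
  have eq: "herm L (f y) (s y) (e (f y)) = h y * g (f y)" if y: "y \<in> ?Q" for y
  proof -
    have "s y \<in> fib L (f y)" using section_in[OF s, of y] y by simp
    then have "s y = vscl L (f y) (h y) (b (f y))"
      using vscl_ratio[OF Ly[OF y] frame_nonzero[OF L Vb(2)]] y by (simp add: h_def)
    then show ?thesis
      using herm_vscl_left[OF Ly[OF y] section_in[OF b] unitary_in[OF e]] y by (simp add: g_def)
  qed
  have "ddir X (\<lambda>y. herm ?L y (s y) (e (f y))) x v = ddir X (\<lambda>y. h y * g (f y)) x v"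
    by (rule ddir_cong[OF X Q]) (simp add: eq)
  also have "\<dots> = h x * ddir X (\<lambda>y. g (f y)) x v + ddir X h x v * g (f x)"
    by (rule ddir_mult[OF X Q v hQ gQ])
  also have "ddir X (\<lambda>y. g (f y)) x v = ddir Y g (f x) ?w"
    by (rule ddir_compose[OF X Y f VW g _ x(1) v]) (use x Vb in auto)
  finally have dd: "ddir X (\<lambda>y. herm ?L y (s y) (e (f y))) x v =
      h x * ddir Y g (f x) ?w + ddir X h x v * g (f x)" .
  have Db: "D b (f x) ?w = vscl L (f x) (ddir Y g (f x) ?w - \<i> * of_real (A (f x) ?w) * g (f x)) (e (f x))"
    unfolding g_def by (rule conn_form_eq[OF E b x(2) Vb(3) w])
  note nz = unit_nonzero[OF Ly[OF Q(2)] unitary_in[OF e x(2)] unitary_norm[OF e x(2)]]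
  have "pull_conn X Y f L D s x v = vadd L (f x) (vscl L (f x) (ddir X h x v) (b (f x)))
      (vscl L (f x) (h x) (D b (f x) ?w))"
    unfolding pull_conn_def F_def[symmetric] Vb(1) by (simp add: h_def)
  also have "\<dots> = vscl L (f x) (ddir X (\<lambda>y. herm ?L y (s y) (e (f y))) x v -
      \<i> * of_real (A (f x) ?w) * herm L (f x) (s x) (e (f x))) (e (f x))"
    unfolding Db bf[OF Q(2)] vscl_vscl[OF Ly[OF Q(2)] nz] vadd_vscl[OF Ly[OF Q(2)] nz] dd eq[OF Q(2)]
    by (simp add: algebra_simps)
  finally show "pull_conn X Y f L D s x v = vscl ?L x (ddir X (\<lambda>y. herm ?L y (s y) (e (f y))) x v -
      \<i> * of_real (pull_form1 X Y f A x v) * herm ?L x (s x) (e (f x))) (e (f x))"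
    by (simp add: pull_form1_def)
qed

section \<open>Curvature from local connection forms\<close>

lemma curvature_of_conn_form:
  assumes X: "charted X" and E: "conn_form X L D W e A" and K: "has_curvature X L D K"
    and L: "hermitian_line_bundle X L"
    and x: "x \<in> W" and c: "chart_at X x c" and u: "u \<in> tangent X x" and v: "v \<in> tangent X x"
  shows "K x u v = ext_d1 X c A x u v"
proof -
  note e = conn_form_frame[OF E]
  have "D e y w = vscl L y (- \<i> * of_real (A y w)) (e y)" if y: "y \<in> W" and w: "w \<in> tangent X y" for y w
  proof -
    have "ddir X (\<lambda>z. herm L z (e z) (e z)) y w = ddir X (\<lambda>_. 1) y w"
      by (rule ddir_cong[OF X unitary_openin[OF e] y]) (rule unitary_norm[OF e])
    also have "\<dots> = 0" by (rule ddir_const[OF X unitary_openin[OF e] y w])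
    finally show ?thesis
      using conn_form_eq[OF E unitary_section[OF e] y y w] unitary_norm[OF e y] by simp
  qed
  then show ?thesis using K e x c u v unfolding has_curvature_def by blast
qed

text \<open>If \<open>e' = u e\<close> is any unitary frame with \<open>De' = - \<i> A' e'\<close>, then \<open>A' = A - Im (cnj u du)\<close>, which has
  the same differential as \<open>A\<close>.\<close>

lemma has_curvature_of_conn_forms:
  assumes X: "charted X" and L: "hermitian_line_bundle X L"
    and loc: "\<And>x. x \<in> topspace (mtop X) \<Longrightarrow> \<exists>W e A. x \<in> W \<and> conn_form X L D W e A \<and>
      (\<forall>c. chart_at X x c \<longrightarrow> (\<forall>u\<in>tangent X x. \<forall>v\<in>tangent X x. K x u v = ext_d1 X c A x u v))"
  shows "has_curvature X L D K"
  unfolding has_curvature_def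
proof (intro allI impI ballI, elim conjE)
  fix W' e' A' x c v w
  assume e': "unitary_frame X L W' e'"
    and De': "\<forall>x\<in>W'. \<forall>v\<in>tangent X x. D e' x v = vscl L x (- \<i> * of_real (A' x v)) (e' x)"
    and x': "x \<in> W'" and cx: "chart_at X x c" and v: "v \<in> tangent X x" and w: "w \<in> tangent X x"
  have W': "openin (mtop X) W'" by (rule unitary_openin[OF e'])
  have "x \<in> topspace (mtop X)" using x' W' openin_subset by blast
  from loc[OF this] obtain W e A where x: "x \<in> W" and E: "conn_form X L D W e A"
    and "\<forall>c. chart_at X x c \<longrightarrow> (\<forall>u\<in>tangent X x. \<forall>v\<in>tangent X x. K x u v = ext_d1 X c A x u v)"
    by (elim exE conjE)
  then have KA: "K x v w = ext_d1 X c A x v w" using cx v w by blast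
  note e = conn_form_frame[OF E]
  have W: "openin (mtop X) W" by (rule unitary_openin[OF e])
  let ?Q = "W' \<inter> W"
  have Q: "openin (mtop X) ?Q" "x \<in> ?Q" using W W' x x' by auto
  define u where "u = (\<lambda>y. herm L y (e' y) (e y))"
  have u: "smooth_fun X ?Q u" unfolding u_def by (rule smooth_fun_herm[OF X L unitary_section[OF e'] unitary_section[OF e]])
  have Ly: "herm_line_at L y" if "y \<in> ?Q" for y using bundle_line[OF L] that Q(1) openin_subset by blast
  have unit: "e y \<in> fib L y" "herm L y (e y) (e y) = 1" "e' y \<in> fib L y" "herm L y (e' y) (e' y) = 1"
    if "y \<in> ?Q" for y
    using that unitary_in[OF e] unitary_norm[OF e] unitary_in[OF e'] unitary_norm[OF e'] by blast+
  have e'u: "e' y = vscl L y (u y) (e y)" if "y \<in> ?Q" for y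
    using vscl_herm_unit[OF Ly[OF that] unit(1-3)[OF that]] by (simp add: u_def)
  have nz: "nonzero_at L y (e y)" if "y \<in> ?Q" for y using unit_nonzero[OF Ly[OF that] unit(1,2)[OF that]] .
  have uu: "u y * cnj (u y) = 1" if y: "y \<in> ?Q" for y
    using herm_vscl[OF Ly[OF y] nz[OF y], of "u y" "u y"] unit[OF y] e'u[OF y] by simp
  have A': "A' y z = A y z - Im (cnj (u y) * ddir X u y z)" if y: "y \<in> ?Q" and z: "z \<in> tangent X y" for y z
  proof -
    have "vscl L y (- \<i> * of_real (A' y z) * u y) (e y) = D e' y z"
      using De' y z e'u[OF y] vscl_vscl[OF Ly[OF y] nz[OF y], of "- \<i> * of_real (A' y z)" "u y"] by simp
    also have "\<dots> = vscl L y (ddir X u y z - \<i> * of_real (A y z) * u y) (e y)"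
      using conn_form_eq[OF E unitary_section[OF e'] _ _ z] y by (simp add: u_def)
    finally have "- \<i> * of_real (A' y z) * u y = ddir X u y z - \<i> * of_real (A y z) * u y"
      using vscl_eq_iff[OF Ly[OF y] nz[OF y]] by blast
    then have "- \<i> * of_real (A' y z) * (u y * cnj (u y)) =
        cnj (u y) * ddir X u y z - \<i> * of_real (A y z) * (u y * cnj (u y))"
      by (metis (no_types, opaque_lifting) left_diff_distrib mult.assoc mult.commute)
    then have "- \<i> * of_real (A' y z) = cnj (u y) * ddir X u y z - \<i> * of_real (A y z)"
      unfolding uu[OF y] by simp
    then have "Im (- \<i> * of_real (A' y z)) = Im (cnj (u y) * ddir X u y z - \<i> * of_real (A y z))" by simp
    then show ?thesis by simp
  qed
  have c: "c \<in> atlas X" "x \<in> fst c" using cx by (auto simp: chart_at_def)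
  let ?S = "snd c ` (fst c \<inter> ?Q)"
  let ?u = "u \<circ> cinv c"
  have S: "relopen ?S" by (rule chart_image_relopen[OF X c(1) Q(1)])
  have xS: "snd c x \<in> ?S" using c Q by blast
  have at: "at (snd c x) within ?S = at (snd c x) within cimg c" by (rule fd_chart_image[OF X c(1) Q(1) c(2) Q(2)])
  have us: "smooth_on ?S ?u" using u c by (simp add: smooth_fun_def)
  have un: "cmod (?u y) = 1" if "y \<in> ?S" for y
  proof -
    have "u (cinv c y) * cnj (u (cinv c y)) = 1" using uu that cinv_left[OF X c(1)] by auto
    then have "(cmod (u (cinv c y)))\<^sup>2 = 1" by (metis complex_norm_square of_real_eq_1_iff)
    then show ?thesis by (simp add: power2_eq_1_iff) (metis norm_ge_zero not_one_le_zero neg_0_le_iff_le)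
  qed
  have AS: "smooth_on ?S (coef1 X c A a)" for a
    by (rule smooth_on_subset[OF S chart_image_relopen[OF X c(1) W]])
      (use conn_form_one_form[OF E] c in \<open>auto simp: one_form_on_def\<close>)
  let ?l = "\<lambda>a y. Im (cnj (?u y) * fd ?S ?u y a)"
  have ls: "smooth_on ?S (\<lambda>y. - ?l a y)" for a
    by (intro smooth_on_bounded_linear[OF bounded_linear_minus[OF bounded_linear_Im] S] smooth_on_mult S
        smooth_on_bounded_linear[OF bounded_linear_cnj S us] smooth_on_fd us)
  have ls': "smooth_on ?S (\<lambda>y. ?l a y)" for a
    by (intro smooth_on_bounded_linear[OF bounded_linear_Im S] smooth_on_mult S
        smooth_on_bounded_linear[OF bounded_linear_cnj S us] smooth_on_fd us)
  have coef: "coef1 X c A' a y = coef1 X c A a y + - ?l a y" if "y \<in> ?S" for a y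
  proof -
    obtain z where z: "z \<in> fst c" "z \<in> ?Q" "y = snd c z" using \<open>y \<in> ?S\<close> by auto
    have cz: "chart_at X z c" using z c by (simp add: chart_at_def)
    show ?thesis
      unfolding z(3) fd_chart_image[OF X c(1) Q(1) z(1,2)]
      using A'[OF z(2) coord_vec_in_tangent[OF X cz]]
        ddir_chart[OF X Q(1) u z(2) cz coord_vec_in_tangent[OF X cz]]
      by (simp add: coef1_def cinv_left[OF X c(1) z(1)] coord_vec_self[OF X cz])
  qed
  have d: "fd (cimg c) (coef1 X c A' a) (snd c x) b =
      fd (cimg c) (coef1 X c A a) (snd c x) b - fd ?S (?l a) (snd c x) b" for a b
  proof -
    have "fd ?S (coef1 X c A' a) (snd c x) b = fd ?S (\<lambda>y. coef1 X c A a y + - ?l a y) (snd c x) b"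
      by (subst fd_cong[OF coef xS]) auto
    also have "\<dots> = fd ?S (coef1 X c A a) (snd c x) b + fd ?S (\<lambda>y. - ?l a y) (snd c x) b"
      by (intro fd_add S xS smooth_on_differentiable[OF AS] smooth_on_differentiable[OF ls])
    also have "fd ?S (\<lambda>y. - ?l a y) (snd c x) b = - fd ?S (?l a) (snd c x) b"
      by (intro fd_bounded_linear[OF bounded_linear_minus[OF bounded_linear_ident]] S xS
          smooth_on_differentiable[OF ls'])
    finally show ?thesis unfolding at by simp
  qed
  show "K x v w = ext_d1 X c A' x v w"
    unfolding KA ext_d1_def d
    using log_derivative_closed_coords[OF S us un xS, where a = "v c" and b = "w c"] by linarith
qed

section \<open>Plots of the path space\<close>

lemma plot_props:
  assumes "plot M U \<alpha>"
  shows plot_region: "region U"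
    and plot_paths: "p \<in> U \<Longrightarrow> \<alpha> p \<in> paths M"
    and plot_smooth: "smooth_map (std (U \<times> {0..1})) M (case_prod \<alpha>)"
  using assms by (simp_all add: plot_def)

lemma smooth_map_slice:
  fixes U :: "'u::euclidean_space set"
  assumes U: "region U" and t: "t \<in> {0..1::real}"
  shows "smooth_map (std U) (std (U \<times> {0..1})) (\<lambda>p. (p, t))"
    and "p \<in> U \<Longrightarrow> fd U (\<lambda>p. (p, t)) p a = (a, 0)"
proof -
  have d: "((\<lambda>p. (p, t)) has_derivative (\<lambda>a. (a, 0))) (at p within U)" for p
    by (auto intro!: derivative_eq_intros)
  show "smooth_map (std U) (std (U \<times> {0..1})) (\<lambda>p. (p, t))"
    by (rule smooth_map_std[OF smooth_onI[OF relopen_region[OF U] d smooth_on_const[OF relopen_region[OF U]]]])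
      (use t in auto)
  show "fd U (\<lambda>p. (p, t)) p a = (a, 0)" if "p \<in> U"
    using fd_eq[OF relopen_region[OF U] that d] by simp
qed

lemma smooth_map_path_slice:
  fixes U :: "'u::euclidean_space set"
  assumes U: "region U" and p: "p \<in> U"
  shows "smooth_map (std {0..1::real}) (std (U \<times> {0..1})) (\<lambda>t. (p, t))"
    and "t \<in> {0..1::real} \<Longrightarrow> fd {0..1} (\<lambda>t. (p, t)) t 1 = (0, 1)"
proof -
  have d: "((\<lambda>t. (p, t)) has_derivative (\<lambda>h. (0, h))) (at t within {0..1})" for t :: real
    by (auto intro!: derivative_eq_intros)
  note I = relopen_region[OF region_Icc]
  show "smooth_map (std {0..1::real}) (std (U \<times> {0..1})) (\<lambda>t. (p, t))"
    by (rule smooth_map_std[OF smooth_onI[where D = "\<lambda>_ h. (0, h)"]])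
      (use I d smooth_on_const[OF I] p in auto)
  show "fd {0..1} (\<lambda>t. (p, t)) t 1 = (0, 1)" if "t \<in> {0..1::real}"
    using fd_eq[OF I that d] by simp
qed

text \<open>The partial maps of \<open>(p, t) \<mapsto> \<alpha> p t\<close> are \<open>ev\<^sub>t \<circ> \<alpha>\<close> and the paths \<open>\<alpha> p\<close>. Therefore the
  differential of this one map on \<open>U \<times> [0, 1]\<close> contains both the tangent vectors of the plot
  (\<open>plot_tmap_std_vec\<close>) and the velocities of its paths (\<open>velocity_plot\<close>).\<close>

lemma ev_plot_eq: "ev t \<circ> \<alpha> = case_prod \<alpha> \<circ> (\<lambda>p. (p, t))"
  by (simp add: fun_eq_iff ev_def)

lemma smooth_map_ev_plot:
  assumes M: "charted M" and \<alpha>: "plot M U \<alpha>" and t: "t \<in> {0..1}"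
  shows "smooth_map (std U) M (ev t \<circ> \<alpha>)"
  unfolding ev_plot_eq
  using plot_region[OF \<alpha>]
  by (intro smooth_map_compose[OF charted_std charted_std M smooth_map_slice(1) plot_smooth[OF \<alpha>]] region_Times_Icc t)

lemma plot_tmap_std_vec:
  assumes M: "charted M" and \<alpha>: "plot M U \<alpha>" and t: "t \<in> {0..1}" and p: "p \<in> U"
  shows "tmap (std U) M (ev t \<circ> \<alpha>) p (std_vec U p a) =
    tmap (std (U \<times> {0..1})) M (case_prod \<alpha>) (p, t) (std_vec (U \<times> {0..1}) (p, t) (a, 0))"
proof -
  note U = plot_region[OF \<alpha>] and UI = region_Times_Icc[OF plot_region[OF \<alpha>]]
  have "tmap (std U) M (ev t \<circ> \<alpha>) p (std_vec U p a) =
      tmap (std (U \<times> {0..1})) M (case_prod \<alpha>) (p, t)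
        (tmap (std U) (std (U \<times> {0..1})) (\<lambda>p. (p, t)) p (std_vec U p a))"
    unfolding ev_plot_eq
    by (rule tmap_compose[OF charted_std[OF U] charted_std[OF UI] M smooth_map_slice(1)[OF U t] plot_smooth[OF \<alpha>]])
      (use p std_vec_tangent[OF U p] in auto)
  then show ?thesis
    unfolding tmap_std[OF U UI smooth_map_slice(1)[OF U t] p] smooth_map_slice(2)[OF U t p] .
qed

lemma velocity_plot:
  assumes M: "charted M" and \<alpha>: "plot M U \<alpha>" and t: "t \<in> {0..1}" and p: "p \<in> U"
  shows "velocity M (\<alpha> p) t =
    tmap (std (U \<times> {0..1})) M (case_prod \<alpha>) (p, t) (std_vec (U \<times> {0..1}) (p, t) (0, 1))"
proof -
  note U = plot_region[OF \<alpha>] and UI = region_Times_Icc[OF plot_region[OF \<alpha>]]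
  have eq: "\<alpha> p = case_prod \<alpha> \<circ> (\<lambda>t. (p, t))" by (simp add: fun_eq_iff)
  have "velocity M (\<alpha> p) t =
      tmap (std (U \<times> {0..1})) M (case_prod \<alpha>) (p, t)
        (tmap (std {0..1}) (std (U \<times> {0..1})) (\<lambda>t. (p, t)) t (std_vec {0..1} t 1))"
    unfolding velocity_def
    by (subst eq, rule tmap_compose[OF charted_std[OF region_Icc] charted_std[OF UI] M
          smooth_map_path_slice(1)[OF U p] plot_smooth[OF \<alpha>]])
      (use t std_vec_tangent[OF region_Icc t] in auto)
  then show ?thesis
    unfolding tmap_std[OF region_Icc UI smooth_map_path_slice(1)[OF U p] t] smooth_map_path_slice(2)[OF U p t] .
qed

lemma plot_reparametrise:
  fixes U :: "'u::euclidean_space set" and V :: "'v::euclidean_space set"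
  assumes M: "charted M" and \<alpha>: "plot M U \<alpha>" and V: "region V" and g: "smooth_map (std V) (std U) g"
  shows "plot M V (\<alpha> \<circ> g)"
  unfolding plot_def
proof (intro conjI ballI)
  have sub: "g ` V \<subseteq> U" and gs: "smooth_on V g" using smooth_map_std_smooth[OF g] by auto
  show "region V" by (rule V)
  show "(\<alpha> \<circ> g) q \<in> paths M" if "q \<in> V" for q using plot_paths[OF \<alpha>] sub that by auto
  have VI: "region (V \<times> {0..1::real})" by (rule region_Times_Icc[OF V])
  note R = relopen_region[OF VI]
  have "smooth_on (V \<times> {0..1::real}) (\<lambda>q. g (fst q))"
    by (rule smooth_on_compose[OF R relopen_region[OF V] _ smooth_on_linear[OF bounded_linear_fst R] gs]) auto
  from smooth_on_bounded_linear[OF bounded_linear_Pair[OF bounded_linear_ident bounded_linear_zero] R this]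
  have "smooth_on (V \<times> {0..1::real}) (\<lambda>q. (g (fst q), 0) + (0, snd q))"
    by (rule smooth_on_add[OF R _ smooth_on_linear[OF bounded_linear_Pair[OF bounded_linear_zero bounded_linear_snd] R]])
  then have "smooth_on (V \<times> {0..1::real}) (\<lambda>q. (g (fst q), snd q))" by simp
  then have h: "smooth_map (std (V \<times> {0..1::real})) (std (U \<times> {0..1})) (\<lambda>q. (g (fst q), snd q))"
    by (rule smooth_map_std) (use sub in auto)
  have "smooth_map (std (V \<times> {0..1})) M (case_prod \<alpha> \<circ> (\<lambda>q. (g (fst q), snd q)))"
    by (rule smooth_map_compose[OF charted_std[OF VI] charted_std[OF region_Times_Icc[OF plot_region[OF \<alpha>]]] M
          h plot_smooth[OF \<alpha>]])
  then show "smooth_map (std (V \<times> {0..1})) M (\<lambda>(q, t). (\<alpha> \<circ> g) q t)"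
    by (simp add: o_def case_prod_unfold)
qed

lemma plot_tmap_reparametrise:
  assumes M: "charted M" and \<alpha>: "plot M U \<alpha>" and V: "region V" and g: "smooth_map (std V) (std U) g"
    and q: "q \<in> V" and w: "w \<in> tangent (std V) q"
  shows "plot_tmap M V (\<alpha> \<circ> g) q w = plot_tmap M U \<alpha> (g q) (tmap (std V) (std U) g q w)"
proof -
  have "tmap (std V) M (ev t \<circ> (\<alpha> \<circ> g)) q w = tmap (std U) M (ev t \<circ> \<alpha>) (g q) (tmap (std V) (std U) g q w)"
    if t: "t \<in> {0..1}" for t
    unfolding o_assoc
    by (rule tmap_compose[OF charted_std[OF V] charted_std[OF plot_region[OF \<alpha>]] M g smooth_map_ev_plot[OF M \<alpha> t]])
      (use q w in auto)
  then show ?thesis unfolding plot_tmap_def by (intro restrict_ext)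
qed

text \<open>The 2-form \<open>\<Omega>\<close> on \<open>U \<times> [0, 1]\<close> that \<open>\<omega>\<close> induces along \<open>(p, t) \<mapsto> \<alpha> p t\<close>, on constant vector
  fields.\<close>

definition plot_coef ::
  "('m, 'e::euclidean_space) smooth_space \<Rightarrow> ('m, 'e) form2 \<Rightarrow> 'u::euclidean_space set \<Rightarrow>
   ('u \<Rightarrow> real \<Rightarrow> 'm) \<Rightarrow> 'u \<times> real \<Rightarrow> 'u \<times> real \<Rightarrow> 'u \<times> real \<Rightarrow> real" where
  "plot_coef M \<omega> U \<alpha> a b q = pull_form2 (std (U \<times> {0..1})) M (case_prod \<alpha>) \<omega> q
     (std_vec (U \<times> {0..1}) q a) (std_vec (U \<times> {0..1}) q b)"

lemma plot_two_form:
  assumes "charted M" "plot M U \<alpha>" "two_form M \<omega>"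
  shows "two_form (std (U \<times> {0..1})) (pull_form2 (std (U \<times> {0..1})) M (case_prod \<alpha>) \<omega>)"
  using assms plot_region[OF assms(2)]
  by (intro two_form_pull charted_std region_Times_Icc plot_smooth)

lemma smooth_on_plot_coef:
  assumes M: "charted M" and \<alpha>: "plot M U \<alpha>" and \<omega>: "two_form M \<omega>"
  shows "smooth_on (U \<times> {0..1}) (plot_coef M \<omega> U \<alpha> a b)"
proof -
  let ?K = "pull_form2 (std (U \<times> {0..1})) M (case_prod \<alpha>) \<omega>"
  let ?c = "(U \<times> {0..1::real}, \<lambda>x. x)"
  have "smooth_on (U \<times> {0..1}) (coef2 (std (U \<times> {0..1})) ?c ?K a b)"
    using two_form_coef[OF plot_two_form[OF M \<alpha> \<omega>], of ?c] by simp
  then show ?thesis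
    by (rule smooth_on_cong[THEN iffD1, rotated]) (simp add: coef2_def plot_coef_def cinv_std)
qed

lemma plot_coef_linear:
  assumes M: "charted M" and \<alpha>: "plot M U \<alpha>" and \<omega>: "two_form M \<omega>" and q: "q \<in> U \<times> {0..1}"
  shows "linear (\<lambda>b. plot_coef M \<omega> U \<alpha> a b q)" "linear (\<lambda>a. plot_coef M \<omega> U \<alpha> a b q)"
    and "plot_coef M \<omega> U \<alpha> a a q = 0"
proof -
  note UI = region_Times_Icc[OF plot_region[OF \<alpha>]]
  have c: "chart_at (std (U \<times> {0..1})) q (U \<times> {0..1}, \<lambda>x. x)" using q by (simp add: chart_at_std)
  have alt: "alternating_on_set (tangent (std (U \<times> {0..1})) q) (pull_form2 (std (U \<times> {0..1})) M (case_prod \<alpha>) \<omega> q)"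
    by (rule two_form_alternating[OF plot_two_form[OF M \<alpha> \<omega>]]) (use q in simp)
  note t = std_vec_tangent[OF UI q]
  show "linear (\<lambda>b. plot_coef M \<omega> U \<alpha> a b q)"
    unfolding plot_coef_def by (rule linear_on_coord_vec[OF charted_std[OF UI] c alternating_linear(1)[OF alt t]])
  show "linear (\<lambda>a. plot_coef M \<omega> U \<alpha> a b q)"
    unfolding plot_coef_def by (rule linear_on_coord_vec[OF charted_std[OF UI] c alternating_linear(2)[OF alt t]])
  show "plot_coef M \<omega> U \<alpha> a a q = 0"
    unfolding plot_coef_def using alt t by (simp add: alternating_on_set_def)
qed

lemma continuous_on_path_slice:
  assumes "continuous_on (U \<times> {0..1}) k" "p \<in> U" shows "continuous_on {0..1::real} (\<lambda>t. k (p, t))"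
  by (rule continuous_on_compose2[OF assms(1)]) (use assms(2) in \<open>auto intro!: continuous_intros\<close>)

lemma plot_coef_continuous:
  assumes "charted M" "plot M U \<alpha>" "two_form M \<omega>" "p \<in> U"
  shows "continuous_on {0..1} (\<lambda>t. plot_coef M \<omega> U \<alpha> a b (p, t))"
  by (rule continuous_on_path_slice[OF smooth_on_continuous[OF smooth_on_plot_coef[OF assms(1-3)]] assms(4)])

lemma plot_pull_omega_tilde:
  assumes M: "charted M" and \<alpha>: "plot M U \<alpha>" and p: "p \<in> U"
    and u: "u \<in> tangent (std U) p" and v: "v \<in> tangent (std U) p"
  shows "plot_pull2 M U \<alpha> (omega_tilde \<omega>) p u v =
    integral {0..1} (\<lambda>t. plot_coef M \<omega> U \<alpha> (u (U, \<lambda>x. x), 0) (v (U, \<lambda>x. x), 0) (p, t))"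
  unfolding plot_pull2_def omega_tilde_def
proof (rule integral_cong)
  fix t :: real assume t: "t \<in> {0..1}"
  have "plot_tmap M U \<alpha> p w t = tmap (std (U \<times> {0..1})) M (case_prod \<alpha>) (p, t)
      (std_vec (U \<times> {0..1}) (p, t) (w (U, \<lambda>x. x), 0))" if "w \<in> tangent (std U) p" for w
    using plot_tmap_std_vec[OF M \<alpha> t p, of "w (U, \<lambda>x. x)"] tangent_std[OF p that] t
    by (simp add: plot_tmap_def)
  then show "\<omega> (\<alpha> p t) (d_ev t (plot_tmap M U \<alpha> p u)) (d_ev t (plot_tmap M U \<alpha> p v)) =
      plot_coef M \<omega> U \<alpha> (u (U, \<lambda>x. x), 0) (v (U, \<lambda>x. x), 0) (p, t)"
    using u v by (simp add: d_ev_def plot_coef_def pull_form2_def)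
qed

lemma plot_pull_lambda_form:
  assumes M: "charted M" and \<alpha>: "plot M U \<alpha>" and \<omega>: "two_form M \<omega>" and p: "p \<in> U"
    and u: "u \<in> tangent (std U) p"
  shows "plot_pull1 M U \<alpha> (lambda_form M \<omega>) p u =
    integral {0..1} (\<lambda>t. (1 - t) * plot_coef M \<omega> U \<alpha> (0, 1) (u (U, \<lambda>x. x), 0) (p, t))"
proof -
  have "plot_pull1 M U \<alpha> (lambda_form M \<omega>) p u = integral {0..1} (\<lambda>t. integral {0..t} (\<lambda>\<tau>.
      plot_coef M \<omega> U \<alpha> (0, 1) (u (U, \<lambda>x. x), 0) (p, \<tau>)))"
    unfolding plot_pull1_def lambda_form_def
  proof (intro integral_cong)
    fix t \<tau> :: real assume "t \<in> {0..1}" "\<tau> \<in> {0..t}"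
    then have \<tau>: "\<tau> \<in> {0..1}" by simp
    have "plot_tmap M U \<alpha> p u \<tau> = tmap (std (U \<times> {0..1})) M (case_prod \<alpha>) (p, \<tau>)
        (std_vec (U \<times> {0..1}) (p, \<tau>) (u (U, \<lambda>x. x), 0))"
      using plot_tmap_std_vec[OF M \<alpha> \<tau> p, of "u (U, \<lambda>x. x)"] tangent_std[OF p u] \<tau>
      by (simp add: plot_tmap_def)
    then show "\<omega> (\<alpha> p \<tau>) (velocity M (\<alpha> p) \<tau>) (d_ev \<tau> (plot_tmap M U \<alpha> p u)) =
        plot_coef M \<omega> U \<alpha> (0, 1) (u (U, \<lambda>x. x), 0) (p, \<tau>)"
      by (simp add: d_ev_def plot_coef_def pull_form2_def velocity_plot[OF M \<alpha> \<tau> p])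
  qed
  then show ?thesis
    using iterated_integral[OF plot_coef_continuous[OF M \<alpha> \<omega> p]] by simp
qed

section \<open>The forms on the path space\<close>

lemma path_smooth: "\<gamma> \<in> paths M \<Longrightarrow> smooth_map (std {0..1}) M \<gamma>"
  by (simp add: paths_def)

lemma path_in: "\<gamma> \<in> paths M \<Longrightarrow> t \<in> {0..1} \<Longrightarrow> \<gamma> t \<in> topspace (mtop M)"
  using smooth_map_in[OF path_smooth, of \<gamma> M t] by simp

lemma field_along_path:
  assumes "v \<in> path_tangent M \<gamma>" shows "field_along (std {0..1}) M \<gamma> {0..1} v"
proof -
  have "{0..1} \<inter> ({0..1} \<inter> {t. 0 \<le> t \<and> t \<le> 1 \<and> \<gamma> t \<in> S}) = {t \<in> {0..1}. \<gamma> t \<in> S}" for S by auto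
  then show ?thesis using assms
    by (simp add: field_along_def path_tangent_def smooth_fun_std)
qed

lemma velocity_field_along:
  assumes M: "charted M" and \<gamma>: "\<gamma> \<in> paths M"
  shows "field_along (std {0..1}) M \<gamma> {0..1} (velocity M \<gamma>)"
  unfolding velocity_def
  by (rule field_along_tmap[OF charted_std[OF region_Icc] M path_smooth[OF \<gamma>]]) auto

lemma continuous_on_form_along_path:
  assumes M: "charted M" and \<omega>: "two_form M \<omega>" and \<gamma>: "\<gamma> \<in> paths M"
    and v: "field_along (std {0..1}) M \<gamma> {0..1} v" and w: "field_along (std {0..1}) M \<gamma> {0..1} w"
  shows "continuous_on {0..1} (\<lambda>t. \<omega> (\<gamma> t) (v t) (w t))"
proof -
  have "smooth_fun (std {0..1}) {0..1} (\<lambda>t. \<omega> (\<gamma> t) (v t) (w t))"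
    by (rule smooth_fun_two_form_along[OF charted_std[OF region_Icc] M path_smooth[OF \<gamma>] \<omega> _ v w]) simp
  then show ?thesis by (auto simp: smooth_fun_std dest: smooth_on_continuous)
qed

lemma path_one_form_lambda:
  assumes M: "charted M" and \<omega>: "two_form M \<omega>"
  shows "path_one_form TYPE('u::euclidean_space) M (lambda_form M \<omega>)"
  unfolding path_one_form_def
proof (intro conjI ballI allI impI)
  fix \<gamma> v w and a b :: real
  assume \<gamma>: "\<gamma> \<in> paths M" and v: "v \<in> path_tangent M \<gamma>" and w: "w \<in> path_tangent M \<gamma>"
  let ?g = "\<lambda>v t. \<omega> (\<gamma> t) (velocity M \<gamma> t) (d_ev t v)"
  have cont: "continuous_on {0..1} (?g v)" if "v \<in> path_tangent M \<gamma>" for v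
    unfolding d_ev_def
    by (rule continuous_on_form_along_path[OF M \<omega> \<gamma> velocity_field_along[OF M \<gamma>] field_along_path[OF that]])
  have lin: "?g (path_comb a v b w) t = a * ?g v t + b * ?g w t" if t: "t \<in> {0..1}" for t
  proof -
    have "alternating_on_set (tangent M (\<gamma> t)) (\<omega> (\<gamma> t))"
      using \<omega> path_in[OF \<gamma> t] by (simp add: two_form_def)
    moreover have "velocity M \<gamma> t \<in> tangent M (\<gamma> t)"
      using velocity_field_along[OF M \<gamma>] t by (simp add: field_along_def)
    ultimately have "linear_on_set (tangent M (\<gamma> t)) (\<omega> (\<gamma> t) (velocity M \<gamma> t))"
      by (rule alternating_linear)
    moreover have "v t \<in> tangent M (\<gamma> t)" "w t \<in> tangent M (\<gamma> t)"
      using v w t by (auto simp: path_tangent_def)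
    ultimately show ?thesis using t by (simp add: linear_on_set_def d_ev_def path_comb_def)
  qed
  have "continuous_on {0..1} (\<lambda>t. a * ?g v t + b * ?g w t)"
    by (intro continuous_intros cont v w)
  then have "continuous_on {0..1} (?g (path_comb a v b w))"
    by (rule continuous_on_eq) (simp add: lin)
  then have "lambda_form M \<omega> \<gamma> (path_comb a v b w) =
      integral {0..1} (\<lambda>t. (1 - t) * ?g (path_comb a v b w) t)"
    unfolding lambda_form_def by (rule iterated_integral)
  also have "\<dots> = a * integral {0..1} (\<lambda>t. (1 - t) * ?g v t) + b * integral {0..1} (\<lambda>t. (1 - t) * ?g w t)"
    by (intro integral_lincomb continuous_intros cont v w) (simp add: lin algebra_simps)
  also have "\<dots> = a * lambda_form M \<omega> \<gamma> v + b * lambda_form M \<omega> \<gamma> w"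
    unfolding lambda_form_def iterated_integral[OF cont[OF v]] iterated_integral[OF cont[OF w]] by simp
  finally show "lambda_form M \<omega> \<gamma> (path_comb a v b w) = a * lambda_form M \<omega> \<gamma> v + b * lambda_form M \<omega> \<gamma> w" .
next
  fix U :: "'u set" and \<alpha> assume \<alpha>: "plot M U \<alpha>"
  note U = plot_region[OF \<alpha>]
  let ?c = "(U, \<lambda>x. x)" and ?\<Omega> = "plot_coef M \<omega> U \<alpha>"
  show "one_form (std U) (plot_pull1 M U \<alpha> (lambda_form M \<omega>))"
    unfolding one_form_def linear_on_set_def
  proof (intro conjI ballI allI)
    fix p u v and a b :: real
    assume "p \<in> topspace (mtop (std U))" and u: "u \<in> tangent (std U) p" and v: "v \<in> tangent (std U) p"
    then have p: "p \<in> U" by simp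
    have t: "tcomb a u b v \<in> tangent (std U) p"
      by (rule tangent_tcomb[OF charted_std[OF U] _ u v]) (simp add: p)
    have lin: "?\<Omega> (0, 1) (tcomb a u b v ?c, 0) (p, t) = a * ?\<Omega> (0, 1) (u ?c, 0) (p, t) + b * ?\<Omega> (0, 1) (v ?c, 0) (p, t)"
      if "t \<in> {0..1}" for t
    proof -
      interpret linear "\<lambda>b. ?\<Omega> (0, 1) b (p, t)"
        by (rule plot_coef_linear[OF M \<alpha> \<omega>]) (use p that in simp)
      have "(tcomb a u b v ?c, 0) = a *\<^sub>R (u ?c, 0) + b *\<^sub>R (v ?c, 0::real)" by (simp add: tcomb_def)
      then show ?thesis by (simp only: add scale) simp
    qed
    show "plot_pull1 M U \<alpha> (lambda_form M \<omega>) p (tcomb a u b v) =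
        a * plot_pull1 M U \<alpha> (lambda_form M \<omega>) p u + b * plot_pull1 M U \<alpha> (lambda_form M \<omega>) p v"
      unfolding plot_pull_lambda_form[OF M \<alpha> \<omega> p t] plot_pull_lambda_form[OF M \<alpha> \<omega> p u]
        plot_pull_lambda_form[OF M \<alpha> \<omega> p v]
      by (intro integral_lincomb continuous_intros plot_coef_continuous[OF M \<alpha> \<omega> p])
        (simp add: lin algebra_simps)
  next
    fix c and a :: 'u assume "c \<in> atlas (std U)"
    then have c: "c = ?c" by simp
    have UI: "relopen (U \<times> {0..1::real})" by (intro relopen_region region_Times_Icc U)
    have "smooth_on (U \<times> {0..1::real}) (\<lambda>q. 1 + - snd q)"
      by (intro smooth_on_add UI smooth_on_const smooth_on_linear bounded_linear_minus bounded_linear_snd)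
    then have "smooth_on (U \<times> {0..1}) (\<lambda>q. (1 + - snd q) * ?\<Omega> (0, 1) (a, 0) q)"
      by (intro smooth_on_mult UI smooth_on_plot_coef[OF M \<alpha> \<omega>])
    from smooth_on_integral[OF U this]
    show "smooth_on (cimg c) (coef1 (std U) c (plot_pull1 M U \<alpha> (lambda_form M \<omega>)) a)"
      unfolding c cimg_std
      by (rule smooth_on_cong[THEN iffD1, rotated])
        (simp add: coef1_def cinv_std plot_pull_lambda_form[OF M \<alpha> \<omega>] std_vec_tangent[OF U] std_vec_self[OF U])
  qed
qed

lemma path_two_form_omega_tilde:
  assumes M: "charted M" and \<omega>: "two_form M \<omega>"
  shows "path_two_form TYPE('u::euclidean_space) M (omega_tilde \<omega>)"
  unfolding path_two_form_def
proof (rule conjI, intro ballI allI)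
  fix \<gamma> u assume \<gamma>: "\<gamma> \<in> paths M" and u: "u \<in> path_tangent M \<gamma>"
  let ?g = "\<lambda>v w t. \<omega> (\<gamma> t) (d_ev t v) (d_ev t w)"
  have cont: "continuous_on {0..1} (?g v w)" if "v \<in> path_tangent M \<gamma>" "w \<in> path_tangent M \<gamma>" for v w
    unfolding d_ev_def
    by (rule continuous_on_form_along_path[OF M \<omega> \<gamma>]) (intro field_along_path that)+
  have alt: "alternating_on_set (tangent M (\<gamma> t)) (\<omega> (\<gamma> t))" if "t \<in> {0..1}" for t
    using \<omega> path_in[OF \<gamma> that] by (simp add: two_form_def)
  have tan: "v t \<in> tangent M (\<gamma> t)" if "v \<in> path_tangent M \<gamma>" "t \<in> {0..1}" for v t
    using that by (simp add: path_tangent_def)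
  have "omega_tilde \<omega> \<gamma> u u = integral {0..1} (\<lambda>t::real. 0)"
    unfolding omega_tilde_def
    by (rule integral_cong) (use alt tan u in \<open>simp add: alternating_on_set_def d_ev_def\<close>)
  then have zero: "omega_tilde \<omega> \<gamma> u u = 0" by simp
  have "omega_tilde \<omega> \<gamma> u (path_comb a v b w) = a * omega_tilde \<omega> \<gamma> u v + b * omega_tilde \<omega> \<gamma> u w"
    and "omega_tilde \<omega> \<gamma> (path_comb a v b w) u = a * omega_tilde \<omega> \<gamma> v u + b * omega_tilde \<omega> \<gamma> w u"
    if v: "v \<in> path_tangent M \<gamma>" and w: "w \<in> path_tangent M \<gamma>" for v w a b
  proof -
    show "omega_tilde \<omega> \<gamma> u (path_comb a v b w) = a * omega_tilde \<omega> \<gamma> u v + b * omega_tilde \<omega> \<gamma> u w"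
      unfolding omega_tilde_def
    proof (rule integral_lincomb[OF cont[OF u v] cont[OF u w]])
      fix t :: real assume t: "t \<in> {0..1}"
      show "?g u (path_comb a v b w) t = a * ?g u v t + b * ?g u w t"
        using alternating_linear(1)[OF alt[OF t] tan[OF u t]] tan[OF v t] tan[OF w t] t
        by (simp add: linear_on_set_def d_ev_def path_comb_def)
    qed
    show "omega_tilde \<omega> \<gamma> (path_comb a v b w) u = a * omega_tilde \<omega> \<gamma> v u + b * omega_tilde \<omega> \<gamma> w u"
      unfolding omega_tilde_def
    proof (rule integral_lincomb[OF cont[OF v u] cont[OF w u]])
      fix t :: real assume t: "t \<in> {0..1}"
      show "?g (path_comb a v b w) u t = a * ?g v u t + b * ?g w u t"
        using alternating_linear(2)[OF alt[OF t] tan[OF u t]] tan[OF v t] tan[OF w t] t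
        by (simp add: linear_on_set_def d_ev_def path_comb_def)
    qed
  qed
  then show "omega_tilde \<omega> \<gamma> u u = 0 \<and> (\<forall>v\<in>path_tangent M \<gamma>. \<forall>w\<in>path_tangent M \<gamma>. \<forall>a b.
      omega_tilde \<omega> \<gamma> u (path_comb a v b w) = a * omega_tilde \<omega> \<gamma> u v + b * omega_tilde \<omega> \<gamma> u w \<and>
      omega_tilde \<omega> \<gamma> (path_comb a v b w) u = a * omega_tilde \<omega> \<gamma> v u + b * omega_tilde \<omega> \<gamma> w u)"
    using zero by blast
next
  show "\<forall>(U :: 'u set) \<alpha>. plot M U \<alpha> \<longrightarrow> two_form (std U) (plot_pull2 M U \<alpha> (omega_tilde \<omega>))"
  proof (intro allI impI)
    fix U :: "'u set" and \<alpha> assume \<alpha>: "plot M U \<alpha>"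
    note U = plot_region[OF \<alpha>]
    let ?c = "(U, \<lambda>x. x)" and ?\<Omega> = "plot_coef M \<omega> U \<alpha>" and ?K = "plot_pull2 M U \<alpha> (omega_tilde \<omega>)"
    show "two_form (std U) ?K"
      unfolding two_form_def
    proof (intro conjI ballI allI)
      fix p assume "p \<in> topspace (mtop (std U))"
      then have p: "p \<in> U" by simp
      note K = plot_pull_omega_tilde[OF M \<alpha> p]
      note cont = plot_coef_continuous[OF M \<alpha> \<omega> p]
      show "alternating_on_set (tangent (std U) p) (?K p)"
        unfolding alternating_on_set_def linear_on_set_def
      proof (intro ballI conjI allI)
        fix u assume u: "u \<in> tangent (std U) p"
        have "?K p u u = integral {0..1} (\<lambda>t::real. 0)"
          unfolding K[OF u u] by (rule integral_cong) (use plot_coef_linear(3)[OF M \<alpha> \<omega>] p in simp)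
        then show "?K p u u = 0" by simp
        fix v w and a b :: real assume v: "v \<in> tangent (std U) p" and w: "w \<in> tangent (std U) p"
        have t: "tcomb a v b w \<in> tangent (std U) p"
          by (rule tangent_tcomb[OF charted_std[OF U] _ v w]) (simp add: p)
        have tc: "(tcomb a v b w ?c, 0) = a *\<^sub>R (v ?c, 0) + b *\<^sub>R (w ?c, 0::real)" by (simp add: tcomb_def)
        have 1: "?\<Omega> z (tcomb a v b w ?c, 0) (p, t) = a * ?\<Omega> z (v ?c, 0) (p, t) + b * ?\<Omega> z (w ?c, 0) (p, t)"
          if "t \<in> {0..1}" for t z
        proof -
          interpret linear "\<lambda>b. ?\<Omega> z b (p, t)"
            by (rule plot_coef_linear[OF M \<alpha> \<omega>]) (use p that in simp)
          show ?thesis unfolding tc by (simp only: add scale) simp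
        qed
        have 2: "?\<Omega> (tcomb a v b w ?c, 0) z (p, t) = a * ?\<Omega> (v ?c, 0) z (p, t) + b * ?\<Omega> (w ?c, 0) z (p, t)"
          if "t \<in> {0..1}" for t z
        proof -
          interpret linear "\<lambda>b. ?\<Omega> b z (p, t)"
            by (rule plot_coef_linear[OF M \<alpha> \<omega>]) (use p that in simp)
          show ?thesis unfolding tc by (simp only: add scale) simp
        qed
        show "?K p u (tcomb a v b w) = a * ?K p u v + b * ?K p u w"
          unfolding K[OF u t] K[OF u v] K[OF u w] by (rule integral_lincomb[OF cont cont 1])
        show "?K p (tcomb a v b w) u = a * ?K p v u + b * ?K p w u"
          unfolding K[OF t u] K[OF v u] K[OF w u] by (rule integral_lincomb[OF cont cont 2])
      qed
    next
      fix c and a b :: 'u assume "c \<in> atlas (std U)"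
      then have c: "c = ?c" by simp
      from smooth_on_integral[OF U smooth_on_plot_coef[OF M \<alpha> \<omega>]]
      show "smooth_on (cimg c) (coef2 (std U) c ?K a b)"
        unfolding c cimg_std
        by (rule smooth_on_cong[THEN iffD1, rotated])
          (simp add: coef2_def cinv_std plot_pull_omega_tilde[OF M \<alpha>] std_vec_tangent[OF U] std_vec_self[OF U])
    qed
  qed
qed

section \<open>The pulled back bundle and its connection\<close>

lemma pull_bundle_pull:
  assumes "g ` V \<subseteq> U" shows "pull_bundle V g (pull_bundle U f L) = pull_bundle V (f \<circ> g) L"
proof -
  have "{x \<in> V. g x \<in> {y \<in> U. f y \<in> W}} = {x \<in> V. (f \<circ> g) x \<in> W}" for W
    using assms by auto
  then show ?thesis
    by (simp add: pull_bundle_def image_image case_prod_unfold o_assoc)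
qed

lemma plot_ev_bundle:
  assumes "plot M U \<alpha>"
  shows "pull_bundle U \<alpha> (ev_bundle M t L) = pull_bundle U (ev t \<circ> \<alpha>) L"
  unfolding ev_bundle_def by (rule pull_bundle_pull) (use plot_paths[OF assms] in auto)

lemma hermitian_plot_bundle:
  assumes M: "charted M" and L: "hermitian_line_bundle M L" and \<alpha>: "plot M U \<alpha>" and t: "t \<in> {0..1}"
  shows "hermitian_line_bundle (std U) (pull_bundle U \<alpha> (ev_bundle M t L))"
  using hermitian_line_bundle_pull[OF charted_std[OF plot_region[OF \<alpha>]] M smooth_map_ev_plot[OF M \<alpha> t] L]
  by (simp add: plot_ev_bundle[OF \<alpha>])

text \<open>The connection form on the plot \<open>\<alpha>\<close>, where \<open>A\<close> is a connection form of \<open>\<nabla>\<close>.\<close>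

definition nabla_form ::
  "real \<Rightarrow> ('m, 'e::euclidean_space) smooth_space \<Rightarrow> ('m, 'e) form2 \<Rightarrow> ('m, 'e) form1 \<Rightarrow>
   'u::euclidean_space set \<Rightarrow> ('u \<Rightarrow> real \<Rightarrow> 'm) \<Rightarrow> ('u, 'u) form1" where
  "nabla_form hb M \<omega> A U \<alpha> p u = pull_form1 (std U) M (ev 0 \<circ> \<alpha>) A p u +
     plot_pull1 M U \<alpha> (\<lambda>\<gamma> v. inverse hb * lambda_form M \<omega> \<gamma> v) p u"

lemma plot_pull1_scale: "plot_pull1 M U \<alpha> (\<lambda>\<gamma> v. k * A \<gamma> v) = (\<lambda>p u. k * plot_pull1 M U \<alpha> A p u)"
  by (simp add: plot_pull1_def fun_eq_iff)

lemma one_form_plot_lambda: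
  fixes U :: "'u::euclidean_space set"
  assumes M: "charted M" and \<omega>: "two_form M \<omega>" and \<alpha>: "plot M U \<alpha>"
  shows "one_form (std U) (plot_pull1 M U \<alpha> (lambda_form M \<omega>))"
  using path_one_form_lambda[OF M \<omega>, where 'u = 'u] \<alpha> unfolding path_one_form_def by blast

lemma nabla_tilde_conn_form:
  fixes U :: "'u::euclidean_space set"
  assumes M: "charted M" and \<omega>: "two_form M \<omega>" and L: "hermitian_line_bundle M L"
    and \<alpha>: "plot M U \<alpha>" and E: "conn_form M L D W e A"
  shows "conn_form (std U) (pull_bundle U \<alpha> (ev_bundle M 0 L)) (nabla_tilde hb M \<omega> L D U \<alpha>)
    {p \<in> U. \<alpha> p 0 \<in> W} (\<lambda>p. e (\<alpha> p 0)) (nabla_form hb M \<omega> A U \<alpha>)"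
proof -
  note U = plot_region[OF \<alpha>]
  note X = charted_std[OF U]
  have 0: "(0::real) \<in> {0..1}" by simp
  note f = smooth_map_ev_plot[OF M \<alpha> 0]
  have P: "{p \<in> topspace (mtop (std U)). (ev 0 \<circ> \<alpha>) p \<in> W} = {p \<in> U. \<alpha> p 0 \<in> W}"
    by (simp add: ev_def)
  have W: "openin (mtop M) W" by (rule unitary_openin[OF conn_form_frame[OF E]])
  have op: "openin (mtop (std U)) {p \<in> U. \<alpha> p 0 \<in> W}" using smooth_map_openin[OF f W] unfolding P .
  have E': "conn_form (std U) (pull_bundle U \<alpha> (ev_bundle M 0 L)) (ev_conn M 0 L D U \<alpha>)
      {p \<in> U. \<alpha> p 0 \<in> W} (\<lambda>p. e (\<alpha> p 0)) (pull_form1 (std U) M (ev 0 \<circ> \<alpha>) A)"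
    using conn_form_pull[OF X M f L E] unfolding P by (simp add: plot_ev_bundle[OF \<alpha>] ev_conn_def ev_def)
  have B: "one_form_on (std U) {p \<in> U. \<alpha> p 0 \<in> W} (plot_pull1 M U \<alpha> (\<lambda>\<gamma> v. inverse hb * lambda_form M \<omega> \<gamma> v))"
    unfolding plot_pull1_scale
    by (rule one_form_on_subset[OF X one_form_scale[OF X one_form_plot_lambda[OF M \<omega> \<alpha>]] op])
  from conn_form_minus[OF X hermitian_plot_bundle[OF M L \<alpha> 0] E' B]
  show ?thesis
    unfolding nabla_tilde_def path_conn_minus_form_def nabla_form_def[abs_def] .
qed

lemma nabla_tilde_local:
  assumes M: "charted M" and L: "hermitian_line_bundle M L" and D: "hermitian_connection M L D"
    and \<alpha>: "plot M U \<alpha>" and p: "p \<in> U"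
  obtains W e A where "conn_form M L D W e A" "\<alpha> p 0 \<in> W"
proof -
  have "\<alpha> p 0 \<in> topspace (mtop M)" by (rule path_in[OF plot_paths[OF \<alpha> p]]) simp
  from conn_form_exists[OF M L D this] show ?thesis using that by metis
qed

lemma path_hermitian_connection_nabla_tilde:
  assumes M: "charted M" and \<omega>: "two_form M \<omega>" and L: "hermitian_line_bundle M L"
    and D: "hermitian_connection M L D"
  shows "path_hermitian_connection M (ev_bundle M 0 L)
    (nabla_tilde hb M \<omega> L D :: ('u::euclidean_space, 'm, 'l) path_conn)"
  unfolding path_hermitian_connection_def
proof (intro allI impI)
  fix U :: "'u set" and \<alpha> assume \<alpha>: "plot M U \<alpha>"
  show "hermitian_connection (std U) (pull_bundle U \<alpha> (ev_bundle M 0 L)) (nabla_tilde hb M \<omega> L D U \<alpha>)"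
  proof (rule hermitian_connection_of_conn_forms)
    show "charted (std U)" by (rule charted_std[OF plot_region[OF \<alpha>]])
    show "hermitian_line_bundle (std U) (pull_bundle U \<alpha> (ev_bundle M 0 L))"
      by (rule hermitian_plot_bundle[OF M L \<alpha>]) simp
    fix p assume "p \<in> topspace (mtop (std U))"
    then have p: "p \<in> U" by simp
    obtain W e A where E: "conn_form M L D W e A" "\<alpha> p 0 \<in> W" using nabla_tilde_local[OF M L D \<alpha> p] .
    have "p \<in> {p \<in> U. \<alpha> p 0 \<in> W}" using p E(2) by simp
    from conjI[OF this nabla_tilde_conn_form[OF M \<omega> L \<alpha> E(1), where hb = hb]]
    show "\<exists>W e A. p \<in> W \<and>
        conn_form (std U) (pull_bundle U \<alpha> (ev_bundle M 0 L)) (nabla_tilde hb M \<omega> L D U \<alpha>) W e A"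
      by (intro exI)
  qed
qed

lemma nabla_form_reparametrise:
  assumes M: "charted M" and \<alpha>: "plot M U \<alpha>" and V: "region V" and g: "smooth_map (std V) (std U) g"
    and q: "q \<in> V" and w: "w \<in> tangent (std V) q"
  shows "nabla_form hb M \<omega> A V (\<alpha> \<circ> g) q w =
    pull_form1 (std V) (std U) g (nabla_form hb M \<omega> A U \<alpha>) q w"
proof -
  have "tmap (std V) M (ev 0 \<circ> (\<alpha> \<circ> g)) q w = tmap (std U) M (ev 0 \<circ> \<alpha>) (g q) (tmap (std V) (std U) g q w)"
    unfolding o_assoc
    by (rule tmap_compose[OF charted_std[OF V] charted_std[OF plot_region[OF \<alpha>]] M g smooth_map_ev_plot[OF M \<alpha>]])
      (use q w in auto)
  then show ?thesis
    by (simp add: nabla_form_def pull_form1_def plot_pull1_def plot_tmap_reparametrise[OF M \<alpha> V g q w] ev_def)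
qed

text \<open>Around any point both connections have the same form in the same frame, by
  \<open>nabla_form_reparametrise\<close>.\<close>

lemma path_conn_compatible_nabla_tilde:
  assumes M: "charted M" and \<omega>: "two_form M \<omega>" and L: "hermitian_line_bundle M L"
    and D: "hermitian_connection M L D"
  shows "path_conn_compatible M (ev_bundle M 0 L)
    (nabla_tilde hb M \<omega> L D :: ('u::euclidean_space, 'm, 'l) path_conn)
    (nabla_tilde hb M \<omega> L D :: ('v::euclidean_space, 'm, 'l) path_conn)"
  unfolding path_conn_compatible_def
proof (intro allI impI ballI, elim conjE)
  fix U :: "'u set" and \<alpha> and V :: "'v set" and g W' s q w
  assume \<alpha>: "plot M U \<alpha>" and V: "region V" and g: "smooth_map (std V) (std U) g"
    and s: "smooth_section (std V) (pull_bundle V (\<alpha> \<circ> g) (ev_bundle M 0 L)) W' s"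
    and q: "q \<in> W'" and w: "w \<in> tangent (std V) q"
  let ?E = "ev_bundle M 0 L"
  have sub: "g ` V \<subseteq> U" using smooth_map_std_smooth[OF g] by auto
  have qV: "q \<in> V" using openin_subset[OF section_openin[OF s]] q by auto
  have gq: "g q \<in> U" using sub qV by auto
  have \<alpha>g: "plot M V (\<alpha> \<circ> g)" by (rule plot_reparametrise[OF M \<alpha> V g])
  have eq: "pull_bundle V g (pull_bundle U \<alpha> ?E) = pull_bundle V (\<alpha> \<circ> g) ?E"
    by (rule pull_bundle_pull[OF sub])
  obtain W e A where E: "conn_form M L D W e A" and inW: "\<alpha> (g q) 0 \<in> W"
    using nabla_tilde_local[OF M L D \<alpha> gq] .
  note left = nabla_tilde_conn_form[OF M \<omega> L \<alpha>g E, where hb = hb]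
  have LU: "hermitian_line_bundle (std U) (pull_bundle U \<alpha> ?E)"
    by (rule hermitian_plot_bundle[OF M L \<alpha>]) simp
  have right: "conn_form (std V) (pull_bundle V (\<alpha> \<circ> g) ?E)
      (pull_conn (std V) (std U) g (pull_bundle U \<alpha> ?E) (nabla_tilde hb M \<omega> L D U \<alpha>))
      {x \<in> V. g x \<in> {p \<in> U. \<alpha> p 0 \<in> W}} (\<lambda>x. e (\<alpha> (g x) 0))
      (pull_form1 (std V) (std U) g (nabla_form hb M \<omega> A U \<alpha>))"
    using conn_form_pull[OF charted_std[OF V] charted_std[OF plot_region[OF \<alpha>]] g LU
        nabla_tilde_conn_form[OF M \<omega> L \<alpha> E, where hb = hb]]
    by (simp add: eq)
  have 1: "q \<in> {p \<in> V. (\<alpha> \<circ> g) p 0 \<in> W}" using qV inW by simp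
  have 2: "q \<in> {x \<in> V. g x \<in> {p \<in> U. \<alpha> p 0 \<in> W}}" using qV gq inW by simp
  show "nabla_tilde hb M \<omega> L D V (\<alpha> \<circ> g) s q w =
      pull_conn (std V) (std U) g (pull_bundle U \<alpha> ?E) (nabla_tilde hb M \<omega> L D U \<alpha>) s q w"
    unfolding conn_form_eq[OF left s 1 q w] conn_form_eq[OF right s 2 q w]
      nabla_form_reparametrise[OF M \<alpha> V g qV w]
    by simp
qed

section \<open>The differential of lambda and the curvature on the path space\<close>

text \<open>Around \<open>q\<close> the curvature assumption says \<open>\<omega> = \<hbar> dA\<close>, hence \<open>\<Omega>\<close> is \<open>\<hbar>\<close> times the differential of the
  pullback of \<open>A\<close>, and exact forms are closed.\<close>

lemma plot_coef_closed:
  fixes U :: "'u::euclidean_space set"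
  assumes M: "charted M" and \<omega>: "two_form M \<omega>" and L: "hermitian_line_bundle M L"
    and D: "hermitian_connection M L D" and hb: "hb > 0"
    and K: "has_curvature M L D (\<lambda>x u v. inverse hb * \<omega> x u v)"
    and \<alpha>: "plot M U \<alpha>" and q: "q \<in> U \<times> {0..1}"
  shows "fd (U \<times> {0..1}) (plot_coef M \<omega> U \<alpha> b c) q a - fd (U \<times> {0..1}) (plot_coef M \<omega> U \<alpha> a c) q b +
    fd (U \<times> {0..1}) (plot_coef M \<omega> U \<alpha> a b) q c = 0"
proof -
  let ?S = "U \<times> {0..1::real}" and ?F = "case_prod \<alpha>"
  note UI = region_Times_Icc[OF plot_region[OF \<alpha>]]
  note X = charted_std[OF UI] and F = plot_smooth[OF \<alpha>]
  have "?F q \<in> topspace (mtop M)" using smooth_map_in[OF F] q by simp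
  then obtain W e A where E: "conn_form M L D W e A" and qW: "?F q \<in> W"
    using conn_form_exists[OF M L D] by metis
  have W: "openin (mtop M) W" by (rule unitary_openin[OF conn_form_frame[OF E]])
  note A = conn_form_one_form[OF E]
  let ?T = "{q \<in> ?S. ?F q \<in> W}" and ?c = "(?S, \<lambda>x. x)"
  have T: "openin (top_of_set ?S) ?T" using smooth_map_openin[OF F W] by simp
  have RT: "relopen ?T" by (rule relopen_openin[OF relopen_region[OF UI] T])
  have qT: "q \<in> ?T" using q qW by simp
  define \<theta> where "\<theta> = coef1 (std ?S) ?c (pull_form1 (std ?S) M ?F A)"
  have \<theta>: "smooth_on ?T (\<theta> a)" for a
  proof -
    have "smooth_on (snd ?c ` (fst ?c \<inter> {q \<in> topspace (mtop (std ?S)). ?F q \<in> W})) (\<theta> a)"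
      unfolding \<theta>_def using one_form_on_coef1[OF one_form_on_pull[OF X M F W A], of ?c a] by simp
    moreover have "snd ?c ` (fst ?c \<inter> {q \<in> topspace (mtop (std ?S)). ?F q \<in> W}) = ?T" by auto
    ultimately show ?thesis by simp
  qed
  have at: "at y within ?T = at y within ?S" if "y \<in> ?T" for y
    by (rule at_within_openin[OF T that])
  have \<Omega>: "plot_coef M \<omega> U \<alpha> a b y = hb * (fd ?T (\<theta> b) y a - fd ?T (\<theta> a) y b)" if y: "y \<in> ?T" for a b y
  proof -
    have yS: "y \<in> ?S" using y by simp
    have cy: "chart_at (std ?S) y ?c" using yS by (simp add: chart_at_std)
    have Fy: "?F y \<in> W" using y by simp
    have "?F y \<in> topspace (mtop M)" using Fy W openin_subset by blast
    then obtain d where d: "chart_at M (?F y) d" using chart_at_exists[OF M] by metis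
    let ?a = "std_vec ?S y a" and ?b = "std_vec ?S y b"
    have t: "?a \<in> tangent (std ?S) y" "?b \<in> tangent (std ?S) y" by (rule std_vec_tangent[OF UI yS])+
    have yt: "y \<in> topspace (mtop (std ?S))" using yS by simp
    have "inverse hb * \<omega> (?F y) (tmap (std ?S) M ?F y ?a) (tmap (std ?S) M ?F y ?b) =
        ext_d1 M d A (?F y) (tmap (std ?S) M ?F y ?a) (tmap (std ?S) M ?F y ?b)"
      by (rule curvature_of_conn_form[OF M E K L Fy d]) (intro tmap_in_tangent[OF X M F yt] t)+
    also have "\<dots> = ext_d1 (std ?S) ?c (pull_form1 (std ?S) M ?F A) y ?a ?b"
      by (rule ext_d1_pull[OF X M F W A Fy cy d t, symmetric])
    also have "\<dots> = fd ?T (\<theta> b) y a - fd ?T (\<theta> a) y b"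
      unfolding ext_d1_def at[OF y] \<theta>_def by (simp only: std_vec_self[OF UI yS] cimg_std snd_conv)
    finally show ?thesis using hb by (simp add: plot_coef_def pull_form2_def field_simps)
  qed
  show ?thesis
    using exact_closed_coords[OF RT \<theta> qT \<Omega>, of b c a] unfolding at[OF qT] .
qed

text \<open>The identity \<open>d\<lambda> = \<omega>~ - ev\<^sub>0\<^sup>*\<omega>\<close> on a plot.\<close>

lemma ext_d1_lambda:
  fixes U :: "'u::euclidean_space set"
  assumes M: "charted M" and \<omega>: "two_form M \<omega>" and L: "hermitian_line_bundle M L"
    and D: "hermitian_connection M L D" and hb: "hb > 0"
    and K: "has_curvature M L D (\<lambda>x u v. inverse hb * \<omega> x u v)"
    and \<alpha>: "plot M U \<alpha>" and p: "p \<in> U" and u: "u \<in> tangent (std U) p" and v: "v \<in> tangent (std U) p"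
  shows "ext_d1 (std U) (U, \<lambda>x. x) (plot_pull1 M U \<alpha> (lambda_form M \<omega>)) p u v =
    plot_pull2 M U \<alpha> (omega_tilde \<omega>) p u v - pull_form2 (std U) M (ev 0 \<circ> \<alpha>) \<omega> p u v"
proof -
  note U = plot_region[OF \<alpha>]
  let ?c = "(U, \<lambda>x. x)" and ?\<Omega> = "plot_coef M \<omega> U \<alpha>"
  let ?\<beta> = "\<lambda>a p. integral {0..1} (\<lambda>t. (1 - t) * ?\<Omega> (0, 1) (a, 0) (p, t))"
  have coef: "coef1 (std U) ?c (plot_pull1 M U \<alpha> (lambda_form M \<omega>)) a y = ?\<beta> a y" if "y \<in> U" for a y
    using that by (simp add: coef1_def cinv_std plot_pull_lambda_form[OF M \<alpha> \<omega>] std_vec_tangent[OF U] std_vec_self[OF U])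
  have "ext_d1 (std U) ?c (plot_pull1 M U \<alpha> (lambda_form M \<omega>)) p u v =
      fd U (?\<beta> (v ?c)) p (u ?c) - fd U (?\<beta> (u ?c)) p (v ?c)"
    unfolding ext_d1_def cimg_std snd_conv using fd_cong[OF coef p] by simp
  also have "\<dots> = integral {0..1} (\<lambda>t. ?\<Omega> (u ?c, 0) (v ?c, 0) (p, t)) - ?\<Omega> (u ?c, 0) (v ?c, 0) (p, 0)"
    by (rule fibre_integral_of_closed[OF U smooth_on_plot_coef[OF M \<alpha> \<omega>]
          plot_coef_closed[OF M \<omega> L D hb K \<alpha>] p])
  also have "?\<Omega> (u ?c, 0) (v ?c, 0) (p, 0) = pull_form2 (std U) M (ev 0 \<circ> \<alpha>) \<omega> p u v"
  proof -
    have "tmap (std U) M (ev 0 \<circ> \<alpha>) p w = tmap (std (U \<times> {0..1})) M (case_prod \<alpha>) (p, 0)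
        (std_vec (U \<times> {0..1}) (p, 0) (w ?c, 0))" if "w \<in> tangent (std U) p" for w
      using plot_tmap_std_vec[OF M \<alpha> _ p, of 0 "w ?c"] tangent_std[OF p that] by simp
    then show ?thesis using u v by (simp add: plot_coef_def pull_form2_def ev_def)
  qed
  finally show ?thesis unfolding plot_pull_omega_tilde[OF M \<alpha> p u v] .
qed

lemma path_has_curvature_nabla_tilde:
  assumes M: "charted M" and \<omega>: "two_form M \<omega>" and L: "hermitian_line_bundle M L"
    and D: "hermitian_connection M L D" and hb: "hb > 0"
    and K: "has_curvature M L D (\<lambda>x u v. inverse hb * \<omega> x u v)"
  shows "path_has_curvature M (ev_bundle M 0 L)
    (nabla_tilde hb M \<omega> L D :: ('u::euclidean_space, 'm, 'l) path_conn)
    (\<lambda>\<gamma> u v. inverse hb * omega_tilde \<omega> \<gamma> u v)"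
  unfolding path_has_curvature_def
proof (intro allI impI)
  fix U :: "'u set" and \<alpha> assume \<alpha>: "plot M U \<alpha>"
  note U = plot_region[OF \<alpha>]
  note X = charted_std[OF U]
  have 0: "(0::real) \<in> {0..1}" by simp
  let ?f = "ev 0 \<circ> \<alpha>" and ?c = "(U, \<lambda>x. x)"
  note f = smooth_map_ev_plot[OF M \<alpha> 0]
  show "has_curvature (std U) (pull_bundle U \<alpha> (ev_bundle M 0 L)) (nabla_tilde hb M \<omega> L D U \<alpha>)
      (plot_pull2 M U \<alpha> (\<lambda>\<gamma> u v. inverse hb * omega_tilde \<omega> \<gamma> u v))"
  proof (rule has_curvature_of_conn_forms[OF X hermitian_plot_bundle[OF M L \<alpha> 0]])
    fix p assume "p \<in> topspace (mtop (std U))"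
    then have p: "p \<in> U" by simp
    obtain W e A where E: "conn_form M L D W e A" and pW: "\<alpha> p 0 \<in> W" using nabla_tilde_local[OF M L D \<alpha> p] .
    have W: "openin (mtop M) W" by (rule unitary_openin[OF conn_form_frame[OF E]])
    note A = conn_form_one_form[OF E]
    let ?P = "{p \<in> U. \<alpha> p 0 \<in> W}"
    let ?B = "plot_pull1 M U \<alpha> (lambda_form M \<omega>)" and ?A = "pull_form1 (std U) M ?f A"
    have PP: "{p \<in> topspace (mtop (std U)). ?f p \<in> W} = ?P" by (simp add: ev_def)
    have op: "openin (top_of_set U) ?P" using smooth_map_openin[OF f W] unfolding PP by simp
    have pP: "p \<in> ?P" using p pW by simp
    have curv: "plot_pull2 M U \<alpha> (\<lambda>\<gamma> u v. inverse hb * omega_tilde \<omega> \<gamma> u v) p u v =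
        ext_d1 (std U) c (nabla_form hb M \<omega> A U \<alpha>) p u v"
      if c: "chart_at (std U) p c" and u: "u \<in> tangent (std U) p" and v: "v \<in> tangent (std U) p" for c u v
    proof -
      have c': "c = ?c" using c by (simp add: chart_at_std)
      have RP: "relopen ?P" by (rule relopen_openin[OF relopen_region[OF U] op])
      have at: "at p within ?P = at p within U" by (rule at_within_openin[OF op pP])
      have dA: "coef1 (std U) ?c ?A a differentiable (at p within U)" for a
      proof -
        have "smooth_on (snd ?c ` (fst ?c \<inter> ?P)) (coef1 (std U) ?c ?A a)"
          using one_form_on_coef1[OF one_form_on_pull[OF X M f W A], of ?c a] unfolding PP by simp
        moreover have "snd ?c ` (fst ?c \<inter> ?P) = ?P" by auto
        ultimately have "smooth_on ?P (coef1 (std U) ?c ?A a)" by simp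
        from smooth_on_differentiable[OF this pP] show ?thesis unfolding at .
      qed
      have dB: "coef1 (std U) ?c ?B a differentiable (at p within U)" for a
        using one_form_plot_lambda[OF M \<omega> \<alpha>] p by (intro smooth_on_differentiable) (simp_all add: one_form_def)
      have d: "fd U (coef1 (std U) ?c (nabla_form hb M \<omega> A U \<alpha>) a) p b =
          fd U (coef1 (std U) ?c ?A a) p b + inverse hb * fd U (coef1 (std U) ?c ?B a) p b" for a b
      proof -
        have eq: "coef1 (std U) ?c (nabla_form hb M \<omega> A U \<alpha>) a =
            (\<lambda>y. coef1 (std U) ?c ?A a y + inverse hb * coef1 (std U) ?c ?B a y)"
          by (simp add: coef1_def nabla_form_def plot_pull1_def)
        have "((\<lambda>y. coef1 (std U) ?c ?A a y + inverse hb * coef1 (std U) ?c ?B a y) has_derivative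
            (\<lambda>b. fd U (coef1 (std U) ?c ?A a) p b + inverse hb * fd U (coef1 (std U) ?c ?B a) p b)) (at p within U)"
          by (intro has_derivative_add has_derivative_mult_right has_derivative_fd dA dB)
        from fd_eq[OF relopen_region[OF U] p this] show ?thesis unfolding eq by simp
      qed
      have fp: "?f p \<in> W" using pW by (simp add: ev_def)
      have "?f p \<in> topspace (mtop M)" using fp W openin_subset by blast
      then obtain d where d': "chart_at M (?f p) d" using chart_at_exists[OF M] by metis
      have pt: "p \<in> topspace (mtop (std U))" using p by simp
      have "ext_d1 (std U) ?c ?A p u v = ext_d1 M d A (?f p) (tmap (std U) M ?f p u) (tmap (std U) M ?f p v)"
        using ext_d1_pull[OF X M f W A fp _ d' u v] c unfolding c' .
      also have "\<dots> = inverse hb * pull_form2 (std U) M ?f \<omega> p u v"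
        unfolding pull_form2_def
        by (rule curvature_of_conn_form[OF M E K L fp d', symmetric]) (intro tmap_in_tangent[OF X M f pt] u v)+
      finally have A0: "ext_d1 (std U) ?c ?A p u v = inverse hb * pull_form2 (std U) M ?f \<omega> p u v" .
      have "ext_d1 (std U) ?c (nabla_form hb M \<omega> A U \<alpha>) p u v =
          ext_d1 (std U) ?c ?A p u v + inverse hb * ext_d1 (std U) ?c ?B p u v"
        unfolding ext_d1_def cimg_std snd_conv d by (simp add: algebra_simps)
      also have "\<dots> = inverse hb * plot_pull2 M U \<alpha> (omega_tilde \<omega>) p u v"
        unfolding A0 ext_d1_lambda[OF M \<omega> L D hb K \<alpha> p u v] by (simp add: algebra_simps)
      finally show ?thesis unfolding c' by (simp add: plot_pull2_def)
    qed
    then have "\<forall>c. chart_at (std U) p c \<longrightarrow> (\<forall>u\<in>tangent (std U) p. \<forall>v\<in>tangent (std U) p.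
        plot_pull2 M U \<alpha> (\<lambda>\<gamma> u v. inverse hb * omega_tilde \<omega> \<gamma> u v) p u v =
          ext_d1 (std U) c (nabla_form hb M \<omega> A U \<alpha>) p u v)"
      by (intro allI impI ballI)
    from conjI[OF pP conjI[OF nabla_tilde_conn_form[OF M \<omega> L \<alpha> E] this]]
    show "\<exists>W e A. p \<in> W \<and> conn_form (std U) (pull_bundle U \<alpha> (ev_bundle M 0 L))
        (nabla_tilde hb M \<omega> L D U \<alpha>) W e A \<and>
        (\<forall>c. chart_at (std U) p c \<longrightarrow> (\<forall>u\<in>tangent (std U) p. \<forall>v\<in>tangent (std U) p.
          plot_pull2 M U \<alpha> (\<lambda>\<gamma> u v. inverse hb * omega_tilde \<omega> \<gamma> u v) p u v = ext_d1 (std U) c A p u v))"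
      by (intro exI)
  qed
qed

theorem proposition4p2:
  fixes hb :: real
    and M :: "('m, 'e::euclidean_space) smooth_space"
    and \<omega> :: "('m, 'e) form2"
    and L :: "('m, 'l) line_bundle"
    and nabla :: "('m, 'e, 'l) conn"
  assumes "hb > 0"
    and "smooth_manifold M" and "compact_space (mtop M)" and "connected_space (mtop M)"
    and "symplectic_form M \<omega>"
    and "integral_class M (\<lambda>x u v. inverse (2 * pi * hb) * \<omega> x u v)"
    and "hermitian_line_bundle M L" and "hermitian_connection M L nabla"
    and "has_curvature M L nabla (\<lambda>x u v. inverse hb * \<omega> x u v)"
  shows "path_one_form TYPE('u::euclidean_space) M (lambda_form M \<omega>) \<and>
     path_two_form TYPE('u) M (omega_tilde \<omega>) \<and>
     path_hermitian_line_bundle TYPE('u) M (ev_bundle M 0 L) \<and>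
     path_hermitian_connection M (ev_bundle M 0 L)
           (nabla_tilde hb M \<omega> L nabla :: ('u, 'm, 'l) path_conn) \<and>
     path_conn_compatible M (ev_bundle M 0 L)
           (nabla_tilde hb M \<omega> L nabla :: ('u, 'm, 'l) path_conn)
           (nabla_tilde hb M \<omega> L nabla :: ('v::euclidean_space, 'm, 'l) path_conn) \<and>
     path_has_curvature M (ev_bundle M 0 L)
           (nabla_tilde hb M \<omega> L nabla :: ('u, 'm, 'l) path_conn)
           (\<lambda>\<gamma> v\<^sub>1 v\<^sub>2. inverse hb * omega_tilde \<omega> \<gamma> v\<^sub>1 v\<^sub>2)"
proof -
  have M: "charted M" using assms(2) by (rule charted_manifold)
  have \<omega>: "two_form M \<omega>" using assms(5) by (simp add: symplectic_form_def)
  note L = assms(7) and D = assms(8) and K = assms(9) and hb = assms(1)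
  have E: "path_hermitian_line_bundle TYPE('u) M (ev_bundle M 0 L)"
    unfolding path_hermitian_line_bundle_def by (intro allI impI hermitian_plot_bundle[OF M L]) auto
  show ?thesis
    by (intro conjI path_one_form_lambda[OF M \<omega>] path_two_form_omega_tilde[OF M \<omega>] E
        path_hermitian_connection_nabla_tilde[OF M \<omega> L D]
        path_conn_compatible_nabla_tilde[OF M \<omega> L D]
        path_has_curvature_nabla_tilde[OF M \<omega> L D hb K])
qed

end
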